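(* Suppose $u\in C^1\big([0,T_{max});\dot H^s_{\mathcal M}\big)$, $s>\frac52$, is a solution of the Fourier-restricted Euler equation, with $T_{max}$ its maximal time of existence. Then for all $0\le t<T_{max}$, $$\|S(\cdot,t)\|_{L^2}^2\le\|S^0\|_{L^2}^2\exp\left(2\int_0^t\|\lambda_2^+(\cdot,\tau)\|_{L^\infty}\,d\tau\right),$$ where $\lambda_1(x,t)\le\lambda_2(x,t)\le\lambda_3(x,t)$ are the eigenvalues of the strain matrix $S(x,t)$. In particular, if $T_{max}<+\infty$, then $$\int_0^{T_{max}}\|\lambda_2^+(\cdot,t)\|_{L^\infty}\,dt=+\infty.$$
   Context: Function spaces: $\mathbb T^3=\mathbb R^3/\mathbb Z^3$, $\hat u(k)=\int_{\mathbb T^3}u(x)e^{-2\pi i k\cdot x}\,dx$ for $k\in\mathbb Z^3$. For $s\ge0$, $\dot H^s=\dot H^s(\mathbb T^3;\mathbb R^3)$ is the space of mean-zero $L^2$ vector fields with $\|u\|_{\dot H^s}^2=\sum_{k\ne0}(4\pi^2|k|^2)^s|\hat u(k)|^2<\infty$. Frequencies: let $\sigma=(1,1,1)$. For integers $m\ge0$ let $k^m=2^{2m}\sigma+3^m(1,0,-1)$, $h^m=2^{2m+1}\sigma+3^m(1,1,-2)$, $j^m=2^{2m+1}\sigma+3^m(2,-1,-1)$. For $v\in\mathbb R^3$, $\mathcal P[v]$ is the set of all vectors obtained by permuting the entries of $v$. Let $\mathcal M^+_{2m}=\mathcal P[k^m]$, $\mathcal M^+_{2m+1}=\mathcal P[h^m]\cup\mathcal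 P[j^m]$, $\mathcal M^+=\bigcup_{n\ge0}\mathcal M_n^+$, $\mathcal M=\mathcal M^+\cup(-\mathcal M^+)$. For $k\in\mathcal M$ let $P_k^\perp(\sigma)=\sigma-\frac{k\cdot\sigma}{|k|^2}k$ and $v^k=P_k^\perp(\sigma)/|P_k^\perp(\sigma)|$. Constraint space: $\dot H^s_{\mathcal M}$ is the set of $u\in\dot H^s(\mathbb T^3;\mathbb R^3)$ with $\operatorname{supp}\hat u\subset\mathcal M$ and $\hat u(k)\in\operatorname{span}\{v^k\}$ (complex multiples of $v^k$) for all $k\in\mathcal M$. The projection $\mathbb P_{\mathcal M}$ is given by $\widehat{\mathbb P_{\mathcal M}w}(k)=(v^k\cdot\hat w(k))v^k$ for $k\in\mathcal M$ and $0$ for $k\notin\mathcal M$. The Fourier-restricted Euler equation is $\partial_tu+\mathbb P_{\mathcal M}((u\cdot\nabla)u)=0$. Strain: $S_{ij}=\frac12(\partial_iu_j+\partial_ju_i)$, $S^0=S(\cdot,0)$, and $f^+=\max(f,0)$. *)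

theory Defs
  imports "HOL-Analysis.Analysis" "HOL-Probability.Essential_Supremum"
begin

section \<open>Function spaces on the torus\<close>

text \<open>A vector field on $R^3/Z^3$ is a $Z^3$-periodic function on $R^3$, integrated over the
  unit cube. Elements of $L^2$ and of the Sobolev spaces are classes modulo null sets: no
  definition below depends on the representative of such a class.\<close>

definition rvec :: "int ^ 3 \<Rightarrow> real ^ 3" where
  "rvec k = (\<chi> i. real_of_int (k $ i))"

definition cvec :: "real ^ 3 \<Rightarrow> complex ^ 3" where
  "cvec v = (\<chi> i. complex_of_real (v $ i))"

definition torus :: "(real ^ 3) measure" where
  "torus = lebesgue_on (cbox 0 1)"

definition periodic :: "(real ^ 3 \<Rightarrow> 'a) \<Rightarrow> bool" where
  "periodic u \<longleftrightarrow> (\<forall>x n. u (x + rvec n) = u x)"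

definition L2_field :: "(real ^ 3 \<Rightarrow> real ^ 3) \<Rightarrow> bool" where
  "L2_field u \<longleftrightarrow> periodic u \<and> u \<in> borel_measurable torus \<and>
     integrable torus (\<lambda>x. (norm (u x))\<^sup>2)"

definition fourier :: "(real ^ 3 \<Rightarrow> real ^ 3) \<Rightarrow> int ^ 3 \<Rightarrow> complex ^ 3" where
  "fourier u k =
     (\<chi> j. LINT x|torus. complex_of_real (u x $ j) * exp (- 2 * pi * \<i> * complex_of_real (rvec k \<bullet> x)))"

definition Hdot_weight :: "real \<Rightarrow> (real ^ 3 \<Rightarrow> real ^ 3) \<Rightarrow> int ^ 3 \<Rightarrow> real" where
  "Hdot_weight s u k = (4 * pi\<^sup>2 * (norm (rvec k))\<^sup>2) powr s * (norm (fourier u k))\<^sup>2"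

definition Hdot :: "real \<Rightarrow> (real ^ 3 \<Rightarrow> real ^ 3) set" where
  "Hdot s = {u. L2_field u \<and> (LINT x|torus. u x) = 0 \<and> Hdot_weight s u summable_on (UNIV - {0})}"

definition Hdot_norm :: "real \<Rightarrow> (real ^ 3 \<Rightarrow> real ^ 3) \<Rightarrow> real" where
  "Hdot_norm s u = sqrt (\<Sum>\<^sub>\<infinity>k\<in>UNIV - {0}. Hdot_weight s u k)"

definition L2_norm :: "(real ^ 3 \<Rightarrow> 'a::real_normed_vector) \<Rightarrow> real" where
  "L2_norm f = sqrt (LINT x|torus. (norm (f x))\<^sup>2)"

definition Linf_norm :: "(real ^ 3 \<Rightarrow> real) \<Rightarrow> ennreal" where
  "Linf_norm f = esssup torus (\<lambda>x. ennreal \<bar>f x\<bar>)"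

section \<open>The frequency set and the constraint space\<close>

definition sigma :: "int ^ 3" where
  "sigma = vector [1, 1, 1]"

definition kfreq :: "nat \<Rightarrow> int ^ 3" where
  "kfreq m = 2 ^ (2 * m) *s sigma + 3 ^ m *s vector [1, 0, -1]"

definition hfreq :: "nat \<Rightarrow> int ^ 3" where
  "hfreq m = 2 ^ (2 * m + 1) *s sigma + 3 ^ m *s vector [1, 1, -2]"

definition jfreq :: "nat \<Rightarrow> int ^ 3" where
  "jfreq m = 2 ^ (2 * m + 1) *s sigma + 3 ^ m *s vector [2, -1, -1]"

definition perms :: "int ^ 3 \<Rightarrow> (int ^ 3) set" where
  "perms v = {\<chi> i. v $ p i | p. bij p}"

definition Mplus_shell :: "nat \<Rightarrow> (int ^ 3) set" where
  "Mplus_shell n =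
     (if even n then perms (kfreq (n div 2)) else perms (hfreq (n div 2)) \<union> perms (jfreq (n div 2)))"

definition Mplus :: "(int ^ 3) set" where
  "Mplus = (\<Union>n. Mplus_shell n)"

definition Mfreq :: "(int ^ 3) set" where
  "Mfreq = Mplus \<union> uminus ` Mplus"

definition perp_sigma :: "int ^ 3 \<Rightarrow> real ^ 3" where
  "perp_sigma k = rvec sigma - ((rvec k \<bullet> rvec sigma) / (norm (rvec k))\<^sup>2) *\<^sub>R rvec k"

definition vdir :: "int ^ 3 \<Rightarrow> real ^ 3" where
  "vdir k = (1 / norm (perp_sigma k)) *\<^sub>R perp_sigma k"

definition HdotM :: "real \<Rightarrow> (real ^ 3 \<Rightarrow> real ^ 3) set" where
  "HdotM s = {u \<in> Hdot s. (\<forall>k. k \<notin> Mfreq \<longrightarrow> fourier u k = 0) \<and>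
                          (\<forall>k\<in>Mfreq. \<exists>c. fourier u k = c *s cvec (vdir k))}"

text \<open>The field \<open>f\<close> is (a representative of) the projection of \<open>w\<close> onto the constraint space.\<close>

definition is_projM :: "(real ^ 3 \<Rightarrow> real ^ 3) \<Rightarrow> (real ^ 3 \<Rightarrow> real ^ 3) \<Rightarrow> bool" where
  "is_projM w f \<longleftrightarrow> L2_field f \<and>
     (\<forall>k. fourier f k =
        (if k \<in> Mfreq
         then (\<Sum>i\<in>UNIV. cvec (vdir k) $ i * fourier w k $ i) *s cvec (vdir k) else 0))"

section \<open>Gradient, strain and eigenvalues\<close>

text \<open>For $s > 5/2$ a class in $\dot H^s$ contains exactly one continuous field, and that field
  is $C^1$; pointwise derivatives are those of this representative.\<close>

definition cont_rep :: "(real ^ 3 \<Rightarrow> real ^ 3) \<Rightarrow> real ^ 3 \<Rightarrow> real ^ 3" where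
  "cont_rep u = (THE v. continuous_on UNIV v \<and> periodic v \<and> (AE x in torus. v x = u x))"

text \<open>The entry \<open>jacobian u x $ j $ i\<close> is $\partial_i u_j(x)$.\<close>

definition jacobian :: "(real ^ 3 \<Rightarrow> real ^ 3) \<Rightarrow> real ^ 3 \<Rightarrow> real ^ 3 ^ 3" where
  "jacobian u x = matrix (frechet_derivative (cont_rep u) (at x))"

text \<open>$(u \cdot \nabla) u$, with components $\sum_i u_i \partial_i u_j$.\<close>

definition advection :: "(real ^ 3 \<Rightarrow> real ^ 3) \<Rightarrow> real ^ 3 \<Rightarrow> real ^ 3" where
  "advection u x = jacobian u x *v cont_rep u x"

definition strain :: "(real ^ 3 \<Rightarrow> real ^ 3) \<Rightarrow> real ^ 3 \<Rightarrow> real ^ 3 ^ 3" where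
  "strain u x = (1 / 2) *\<^sub>R (jacobian u x + transpose (jacobian u x))"

text \<open>\<open>a \<le> b \<le> c\<close> are the eigenvalues of \<open>A\<close>, repeated according to multiplicity as roots of the
  characteristic polynomial. (\<open>mat z\<close> is \<open>z\<close> times the identity matrix.)\<close>

definition ordered_eigenvalues :: "real ^ 3 ^ 3 \<Rightarrow> real \<Rightarrow> real \<Rightarrow> real \<Rightarrow> bool" where
  "ordered_eigenvalues A a b c \<longleftrightarrow>
     a \<le> b \<and> b \<le> c \<and> (\<forall>z. det (mat z - A) = (z - a) * (z - b) * (z - c))"

section \<open>Maximal solutions\<close>

definition time_interval :: "ereal \<Rightarrow> real set" where
  "time_interval T = {t. 0 \<le> t \<and> ereal t < T}"

text \<open>\<open>u\<close> is in $C^1([0,T); \dot H^s_M)$ with time derivative \<open>du\<close> (one-sided at \<open>0\<close>);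
  limits are taken in the norm of $\dot H^s$.\<close>

definition C1_HdotM ::
  "real \<Rightarrow> ereal \<Rightarrow> (real \<Rightarrow> real ^ 3 \<Rightarrow> real ^ 3) \<Rightarrow> (real \<Rightarrow> real ^ 3 \<Rightarrow> real ^ 3) \<Rightarrow> bool" where
  "C1_HdotM s T u du \<longleftrightarrow>
     (\<forall>t\<in>time_interval T. u t \<in> HdotM s \<and> du t \<in> HdotM s \<and>
        ((\<lambda>r. Hdot_norm s (\<lambda>x. (1 / (r - t)) *\<^sub>R (u r x - u t x) - du t x)) \<longlongrightarrow> 0)
          (at t within time_interval T) \<and>
        ((\<lambda>r. Hdot_norm s (\<lambda>x. du r x - du t x)) \<longlongrightarrow> 0) (at t within time_interval T))"

definition restricted_Euler_solution ::
  "real \<Rightarrow> ereal \<Rightarrow> (real \<Rightarrow> real ^ 3 \<Rightarrow> real ^ 3) \<Rightarrow> bool" where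
  "restricted_Euler_solution s T u \<longleftrightarrow>
     (\<exists>du. C1_HdotM s T u du \<and>
           (\<forall>t\<in>time_interval T. is_projM (advection (u t)) (\<lambda>x. - du t x)))"

definition maximal_restricted_Euler_solution ::
  "real \<Rightarrow> ereal \<Rightarrow> (real \<Rightarrow> real ^ 3 \<Rightarrow> real ^ 3) \<Rightarrow> bool" where
  "maximal_restricted_Euler_solution s Tmax u \<longleftrightarrow>
     0 < Tmax \<and> restricted_Euler_solution s Tmax u \<and>
     \<not> (\<exists>T v. Tmax < T \<and> restricted_Euler_solution s T v \<and>
              (\<forall>t\<in>time_interval Tmax. AE x in torus. v t x = u t x))"

end

theory Submission
  imports Defs
begin

text \<open>The projection onto the constraint space commutes with the Laplacian, so the enstrophy
  $\|S\|_{L^2}^2$ obeys the same identity as for the full Euler equation: its derivative is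
  $\int \Delta u \cdot (u \cdot \nabla) u = -4 \int \det S$. As $S$ is traceless,
  $-4 \det S = -4 \lambda_1 \lambda_2 \lambda_3 \le 2 \lambda_2^+ |S|^2$, and Gronwall's inequality gives the
  estimate. For the blowup criterion, only frequencies of comparable size interact, so the
  nonlinearity is a bounded bilinear map $B$ on $\dot H^s_M$ with
  $\|B(u,u)\|_{\dot H^s} \le C \|S\|_{L^2} \|u\|_{\dot H^s}$. The equation is then an ordinary differential
  equation in a Hilbert space whose solutions can be continued as long as the enstrophy is bounded.\<close>

section \<open>Integration over the torus\<close>

text \<open>The frequency set is lacunary: a dyadic level holds at most 108 points, so every
  negative power of \<open>norm (rvec k)\<close> is summable over it. For s > 2 the series of u thus
  converges absolutely together with its second derivatives, and the integrations by parts behind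
  the enstrophy identity are classical. Each convolution sum is finite. Fields are classes modulo
  null sets, with derivatives taken on \<open>cont_rep\<close>. Uniqueness of Fourier coefficients
  identifies that representative with the series. As the constraint fixes the direction
  \<open>vdir k\<close>, one scalar per frequency encodes a field. Bounded enstrophy controls |k|
  |u^(k)| uniformly in k. The three frequencies of a triad are comparable, so this one factor pays
  for the derivative while the other carries the full Sobolev weight. A second use of Gronwall then
  bounds the Sobolev norm up to the maximal time. Time integrals lie in [0,\<infinity>] and pass
  through \<open>enn2real\<close>, which sends \<infinity> to 0. So finiteness of the integrals over
  [0,t] is essential; it comes from joint continuity of the middle eigenvalue in space and
  time.\<close>

definition wave :: "int ^ 3 \<Rightarrow> real ^ 3 \<Rightarrow> complex" where
  "wave k x = cis (2 * pi * (rvec k \<bullet> x))"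

lemma rvec_simps [simp]: "rvec 0 = 0" "rvec (k + l) = rvec k + rvec l" "rvec (- k) = - rvec k"
  "rvec (k - l) = rvec k - rvec l" "rvec k $ i = real_of_int (k $ i)"
  by (auto simp: rvec_def vec_eq_iff)

lemma rvec_axis: "rvec (axis i 1) = axis i 1"
  by (auto simp: rvec_def vec_eq_iff axis_def)

lemma wave_simps [simp]: "wave 0 x = 1" "norm (wave k x) = 1" "cnj (wave k x) = wave (- k) x"
  by (auto simp: wave_def cis_cnj)

lemma wave_add: "wave (k + l) x = wave k x * wave l x"
  by (simp add: wave_def inner_add_left distrib_left cis_mult)

lemma wave_plus: "wave k (x + y) = wave k x * wave k y"
  by (simp add: wave_def inner_add_right distrib_left cis_mult)

lemma rvec_inner_rvec: "rvec k \<bullet> rvec n = real_of_int (\<Sum>i\<in>UNIV. k $ i * n $ i)"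
  by (simp add: inner_vec_def)

lemma wave_rvec [simp]: "wave k (rvec n) = 1"
  unfolding wave_def rvec_inner_rvec
  by (metis cis_multiple_2pi Ints_of_int)

lemma continuous_wave [continuous_intros]: "continuous_on S (wave k)"
  unfolding wave_def by (intro continuous_intros)

lemma periodic_wave: "periodic (wave k)"
  by (simp add: periodic_def wave_plus)

section \<open>The unit cube as a probability space: translations and integrals of
  derivatives\<close>

lemma space_torus [simp]: "space torus = cbox 0 1"
  by (simp add: torus_def)

lemma emeasure_torus: "emeasure torus (cbox 0 1) = 1"
proof -
  have "(0::real^3) \<le> 1" by (simp add: less_eq_vec_def)
  have "Henstock_Kurzweil_Integration.content (cbox (0::real^3) 1) = 1"
    by (subst content_cbox_cart) (auto simp: interval_eq_empty_cart)
  then show ?thesis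
    unfolding torus_def
    by (simp add: emeasure_restrict_space emeasure_eq_measure2 emeasure_lborel_cbox_eq content_cbox_if box_eq_empty)
qed

lemma continuous_measurable_torus:
  fixes f :: "real^3 \<Rightarrow> 'b::euclidean_space"
  shows "continuous_on UNIV f \<Longrightarrow> f \<in> borel_measurable torus"
  unfolding torus_def by (intro continuous_imp_measurable_on_sets_lebesgue) (auto intro: continuous_on_subset)

lemma continuous_integrable_torus:
  fixes f :: "real^3 \<Rightarrow> 'b::euclidean_space"
  shows "continuous_on UNIV f \<Longrightarrow> integrable torus f"
  unfolding torus_def by (intro continuous_imp_integrable) (auto intro: continuous_on_subset)

lemma integrable_torus_mult_bounded:
  fixes f g :: "real^3 \<Rightarrow> 'b::{euclidean_space,real_normed_field}"
  assumes "integrable torus f" "g \<in> borel_measurable torus" "\<And>x. norm (g x) \<le> B"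
  shows "integrable torus (\<lambda>x. f x * g x)"
proof (rule Bochner_Integration.integrable_bound)
  show "integrable torus (\<lambda>x. B *\<^sub>R f x)" using assms(1) by simp
  show "(\<lambda>x. f x * g x) \<in> borel_measurable torus" using assms by (intro borel_measurable_times) auto
  have "norm (g x) \<le> \<bar>B\<bar>" for x using assms(3)[of x] by linarith
  then show "AE x in torus. norm (f x * g x) \<le> norm (B *\<^sub>R f x)"
    by (intro AE_I2) (simp add: norm_mult mult_left_mono mult.commute[of "\<bar>B\<bar>"])
qed

lemma LINT_torus_eq_integral:
  fixes f :: "real^3 \<Rightarrow> 'b::euclidean_space"
  shows "continuous_on UNIV f \<Longrightarrow> (LINT x|torus. f x) = integral (cbox 0 1) f"
  using continuous_integrable_torus[of f] unfolding torus_def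
  by (intro lebesgue_integral_eq_integral) auto

text \<open>The shifted cube is cut at the face where coordinate i equals 1, and the protruding slab
  is moved back by one period. \<open>b1\<close> and \<open>b2\<close> describe this cut,
  \<open>b3\<close> and \<open>b4\<close> the matching cut of the unit cube.\<close>

lemma LINT_torus_shift:
  fixes F :: "real^3 \<Rightarrow> 'b::euclidean_space"
  assumes F: "continuous_on UNIV F" "periodic F" and h: "0 \<le> h" "h \<le> 1"
  shows "(LINT x|torus. F (x + h *\<^sub>R axis i 1)) = (LINT x|torus. F x)"
proof -
  define e :: "real^3" where "e = axis i 1"
  have eB: "e \<in> Basis" by (simp add: e_def axis_in_Basis_iff)
  have ee: "x \<bullet> e = x $ i" for x by (simp add: e_def inner_axis)
  have int: "F integrable_on cbox a b" for a b
    using F(1) by (intro integrable_continuous) (auto intro: continuous_on_subset)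
  have Fe: "F (x + e) = F x" for x
    using F(2) unfolding periodic_def e_def by (metis rvec_axis)
  have e_nth: "e $ j = (if j = i then 1 else 0)" for j by (simp add: e_def axis_def)
  have b1: "cbox (h *\<^sub>R e) (1 + h *\<^sub>R e) \<inter> {x. x \<bullet> e \<le> 1} = cbox (h *\<^sub>R e) 1"
    using h by (auto simp: mem_box_cart ee e_nth split: if_splits) (smt (verit))+
  have b2: "cbox (h *\<^sub>R e) (1 + h *\<^sub>R e) \<inter> {x. x \<bullet> e \<ge> 1} = cbox e (1 + h *\<^sub>R e)"
    using h by (auto simp: mem_box_cart ee e_nth split: if_splits) (smt (verit))+
  have b3: "cbox 0 1 \<inter> {x. x \<bullet> e \<le> h} = cbox 0 (1 + h *\<^sub>R e - e)"
    using h by (auto simp: mem_box_cart ee e_nth split: if_splits) (smt (verit))+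
  have b4: "cbox 0 1 \<inter> {x. x \<bullet> e \<ge> h} = cbox (h *\<^sub>R e) 1"
    using h by (auto simp: mem_box_cart ee e_nth split: if_splits) (smt (verit))+
  have "(LINT x|torus. F (x + h *\<^sub>R e)) = integral (cbox 0 1) (\<lambda>x. F (x + h *\<^sub>R e))"
    by (intro LINT_torus_eq_integral continuous_intros continuous_on_compose2[OF F(1)]) auto
  also have "\<dots> = integral (cbox (h *\<^sub>R e) (1 + h *\<^sub>R e)) F"
    using integral_shift_cbox[of "h *\<^sub>R e" "h *\<^sub>R e" "1 + h *\<^sub>R e" F] by simp
  also have "\<dots> = integral (cbox (h *\<^sub>R e) 1) F + integral (cbox e (1 + h *\<^sub>R e)) F"
    by (simp add: integral_split[OF int eB, of _ _ 1] b1 b2)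
  also have "integral (cbox e (1 + h *\<^sub>R e)) F = integral (cbox 0 (1 + h *\<^sub>R e - e)) F"
    using integral_shift_cbox[of e e "1 + h *\<^sub>R e" F] by (simp add: Fe)
  also have "integral (cbox (h *\<^sub>R e) 1) F + integral (cbox 0 (1 + h *\<^sub>R e - e)) F = integral (cbox 0 1) F"
    by (simp add: integral_split[OF int eB, of 0 1 h] b3 b4)
  also have "\<dots> = (LINT x|torus. F x)" using LINT_torus_eq_integral[OF F(1)] by simp
  finally show ?thesis by (simp add: e_def)
qed

text \<open>A shift by half a wavelength along an axis with nonzero \<open>k $ i\<close> flips the
  sign of the wave but preserves its integral.\<close>

lemma LINT_wave: "(LINT x|torus. wave k x) = (if k = 0 then 1 else 0)"
proof (cases "k = 0")
  case True
  then show ?thesis using emeasure_torus by (simp add: measure_def)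
next
  case False
  then obtain i where i: "k $ i \<noteq> 0" by (auto simp: vec_eq_iff)
  define h where "h = 1 / (2 * real_of_int \<bar>k $ i\<bar>)"
  have "0 \<le> h" "h \<le> 1" using i by (auto simp: h_def divide_simps)
  have "(rvec k \<bullet> (h *\<^sub>R axis i 1)) = real_of_int (k $ i) * h" by (simp add: inner_axis)
  also have "\<dots> = sgn (real_of_int (k $ i)) / 2" using i by (auto simp: h_def sgn_if)
  finally have "wave k (h *\<^sub>R axis i 1) = cis (2 * pi * (sgn (real_of_int (k $ i)) / 2))"
    by (simp only: wave_def)
  also have "2 * pi * (sgn (real_of_int (k $ i)) / 2) = pi * sgn (real_of_int (k $ i))" by simp
  finally have "wave k (h *\<^sub>R axis i 1) = cis (pi * sgn (real_of_int (k $ i)))" .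
  then have m: "wave k (h *\<^sub>R axis i 1) = -1" using i by (auto simp: sgn_if complex_eq_iff)
  have "(LINT x|torus. wave k x) = (LINT x|torus. wave k (x + h *\<^sub>R axis i 1))"
    using LINT_torus_shift[of "wave k" h i] continuous_wave periodic_wave \<open>0 \<le> h\<close> \<open>h \<le> 1\<close> by simp
  also have "\<dots> = - (LINT x|torus. wave k x)" by (simp add: wave_plus m)
  finally show ?thesis using False by simp
qed

lemma periodic_in_cube:
  assumes "periodic F"
  obtains y where "y \<in> cbox 0 1" "F x = F y"
proof -
  define n where "n = (\<chi> j. \<lfloor>x $ j\<rfloor>)"
  have "F ((x - rvec n) + rvec n) = F (x - rvec n)" using assms unfolding periodic_def by blast
  moreover have "x - rvec n \<in> cbox 0 1" unfolding mem_box_cart n_def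
    by (simp, intro conjI allI) linarith+
  ultimately show ?thesis using that by simp
qed

lemma periodic_bounded:
  fixes F :: "real^3 \<Rightarrow> 'b::real_normed_vector"
  assumes "continuous_on UNIV F" "periodic F"
  obtains B where "\<And>x. norm (F x) \<le> B"
proof -
  have "bounded (F ` cbox 0 1)"
    using assms(1) by (intro compact_imp_bounded compact_continuous_image) (auto intro: continuous_on_subset)
  then obtain B where "\<And>x. x \<in> cbox 0 1 \<Longrightarrow> norm (F x) \<le> B" by (auto simp: bounded_iff)
  then show ?thesis using that periodic_in_cube[OF assms(2)] by metis
qed

text \<open>Difference quotients integrate to 0 by translation invariance, and the mean value
  theorem bounds them by the supremum of \<open>G\<close>, so dominated convergence passes to the
  derivative. All later integrations by parts rest on this.\<close>

lemma LINT_partial_derivative: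
  fixes F G :: "real^3 \<Rightarrow> real"
  assumes F: "continuous_on UNIV F" "periodic F" and G: "continuous_on UNIV G" "periodic G"
    and D: "\<And>x. ((\<lambda>\<tau>. F (x + \<tau> *\<^sub>R axis i 1)) has_real_derivative G x) (at 0)"
  shows "(LINT x|torus. G x) = 0"
proof -
  define e :: "real^3" where "e = axis i 1"
  obtain B where B: "\<And>x. norm (G x) \<le> B" using periodic_bounded[OF G] by blast
  have D': "((\<lambda>\<tau>. F (x + \<tau> *\<^sub>R e)) has_real_derivative G (x + t *\<^sub>R e)) (at t)" for x t
    using D[of "x + t *\<^sub>R e"] DERIV_shift[of "\<lambda>\<tau>. F (x + \<tau> *\<^sub>R e)" "G (x + t *\<^sub>R e)" 0 t]
    by (simp add: e_def algebra_simps)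
  define h where "h n = 1 / real (Suc n)" for n
  have h: "0 < h n" "h n \<le> 1" for n by (auto simp: h_def)
  have h0: "h \<longlonglongrightarrow> 0" unfolding h_def using LIMSEQ_Suc lim_1_over_n by fast
  define q where "q n x = (F (x + h n *\<^sub>R e) - F x) / h n" for n x
  have cs: "continuous_on UNIV (\<lambda>x. F (x + c *\<^sub>R e))" for c
    by (intro continuous_intros continuous_on_compose2[OF F(1)]) auto
  have cq: "continuous_on UNIV (q n)" for n
    unfolding q_def using h[of n] by (intro continuous_intros cs F(1)) auto
  have "(LINT x|torus. q n x) = 0" for n
    using LINT_torus_shift[OF F, of "h n" i] h[of n] continuous_integrable_torus[OF cs[of "h n"]] continuous_integrable_torus[OF F(1)]
    by (simp add: q_def e_def)
  moreover have "(\<lambda>n. LINT x|torus. q n x) \<longlonglongrightarrow> (LINT x|torus. G x)"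
  proof (rule integral_dominated_convergence[where w = "\<lambda>x. B"])
    show "G \<in> borel_measurable torus" "q n \<in> borel_measurable torus" for n
      using cq G by (auto intro: continuous_measurable_torus)
    show "integrable torus (\<lambda>x. B)" by (simp add: continuous_integrable_torus)
    show "AE x in torus. (\<lambda>n. q n x) \<longlonglongrightarrow> G x"
    proof (intro AE_I2)
      fix x
      have "((\<lambda>\<tau>. (F (x + \<tau> *\<^sub>R e) - F x) / \<tau>) \<longlongrightarrow> G x) (at 0)"
        using D[of x] by (simp add: has_field_derivative_iff e_def)
      moreover have "filterlim h (at 0) sequentially"
        using h0 h(1) by (simp add: filterlim_at less_imp_neq[symmetric])
      ultimately show "(\<lambda>n. q n x) \<longlonglongrightarrow> G x" unfolding q_def by (rule filterlim_compose)
    qed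
    show "AE x in torus. norm (q n x) \<le> B" for n
    proof (intro AE_I2)
      fix x
      obtain z where z: "F (x + h n *\<^sub>R e) - F (x + 0 *\<^sub>R e) = (h n - 0) * G (x + z *\<^sub>R e)"
        using MVT2[of 0 "h n" "\<lambda>\<tau>. F (x + \<tau> *\<^sub>R e)" "\<lambda>t. G (x + t *\<^sub>R e)"] h[of n] D' by blast
      then show "norm (q n x) \<le> B" using B[of "x + z *\<^sub>R e"] h(1)[of n] by (simp add: q_def)
    qed
  qed
  ultimately show ?thesis by (simp add: LIMSEQ_const_iff)
qed

section \<open>Uniqueness of Fourier coefficients\<close>

text \<open>If \<open>h\<close> has vanishing Fourier coefficients, the bounded functions \<open>\<phi>\<close> below contain \<open>1\<close> and are
  stable under bounded limits and under multiplication by trigonometric polynomials, hence, by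
  Weierstrass in one variable applied to a cosine, by indicators of half spaces and so of Borel sets.\<close>

definition annihilated :: "(real ^ 3 \<Rightarrow> real) \<Rightarrow> (real ^ 3 \<Rightarrow> complex) \<Rightarrow> bool" where
  "annihilated h \<phi> \<longleftrightarrow> \<phi> \<in> borel_measurable torus \<and> (\<exists>B. \<forall>x. norm (\<phi> x) \<le> B) \<and>
     (\<forall>k. (LINT x|torus. of_real (h x) * \<phi> x * wave k x) = 0)"

lemma wave_measurable [measurable]: "wave k \<in> borel_measurable torus"
  by (intro continuous_measurable_torus continuous_wave)

lemma annihilated_integrable:
  assumes "integrable torus h" "annihilated h \<phi>"
  shows "integrable torus (\<lambda>x. of_real (h x) * \<phi> x * wave k x)"
proof -
  obtain B where B: "\<And>x. norm (\<phi> x) \<le> B" using assms by (auto simp: annihilated_def)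
  have "integrable torus (\<lambda>x. of_real (h x) * (\<phi> x * wave k x))"
    using assms B by (intro integrable_torus_mult_bounded[where B = B]) (auto simp: annihilated_def norm_mult)
  then show ?thesis by (simp add: mult.assoc)
qed

lemma annihilated_wave:
  assumes "annihilated h \<phi>" shows "annihilated h (\<lambda>x. \<phi> x * wave l x)"
  unfolding annihilated_def
proof (intro conjI allI)
  show "(\<lambda>x. \<phi> x * wave l x) \<in> borel_measurable torus"
    using assms by (auto simp: annihilated_def)
  show "\<exists>B. \<forall>x. norm (\<phi> x * wave l x) \<le> B" using assms by (auto simp: annihilated_def norm_mult)
  fix k
  have "(LINT x|torus. of_real (h x) * \<phi> x * wave (l + k) x) = 0" using assms by (auto simp: annihilated_def)
  then show "(LINT x|torus. of_real (h x) * (\<phi> x * wave l x) * wave k x) = 0"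
    by (simp add: wave_add mult.assoc)
qed

lemma annihilated_lincomb:
  assumes h: "integrable torus h" and "annihilated h \<phi>" "annihilated h \<psi>"
  shows "annihilated h (\<lambda>x. c * \<phi> x + d * \<psi> x)"
  unfolding annihilated_def
proof (intro conjI allI)
  show "(\<lambda>x. c * \<phi> x + d * \<psi> x) \<in> borel_measurable torus"
    using assms by (auto simp: annihilated_def)
  obtain B1 B2 where B: "\<And>x. norm (\<phi> x) \<le> B1" "\<And>x. norm (\<psi> x) \<le> B2"
    using assms by (auto simp: annihilated_def)
  have "norm (c * \<phi> x + d * \<psi> x) \<le> norm c * B1 + norm d * B2" for x
    using B[of x] by (intro order_trans[OF norm_triangle_ineq] add_mono) (auto simp: norm_mult intro: mult_left_mono)
  then show "\<exists>B. \<forall>x. norm (c * \<phi> x + d * \<psi> x) \<le> B" by blast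
  fix k
  have "(LINT x|torus. of_real (h x) * (c * \<phi> x + d * \<psi> x) * wave k x) =
        (LINT x|torus. c * (of_real (h x) * \<phi> x * wave k x) + d * (of_real (h x) * \<psi> x * wave k x))"
    by (simp add: algebra_simps)
  also have "\<dots> = 0"
    using annihilated_integrable[OF h assms(2), of k] annihilated_integrable[OF h assms(3), of k] assms
    by (auto simp: annihilated_def)
  finally show "(LINT x|torus. of_real (h x) * (c * \<phi> x + d * \<psi> x) * wave k x) = 0" .
qed

lemma annihilated_lim:
  assumes h: "integrable torus h" and a: "\<And>n. annihilated h (\<phi> n)"
    and B: "\<And>n x. norm (\<phi> n x) \<le> B" and l: "\<And>x. (\<lambda>n. \<phi> n x) \<longlonglongrightarrow> \<psi> x"
  shows "annihilated h \<psi>"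
  unfolding annihilated_def
proof (intro conjI allI)
  have m: "\<phi> n \<in> borel_measurable torus" for n using a by (auto simp: annihilated_def)
  show \<psi>: "\<psi> \<in> borel_measurable torus" 
    by (rule borel_measurable_LIMSEQ_metric[OF m]) (rule l)
  show "\<exists>B. \<forall>x. norm (\<psi> x) \<le> B"
    using B l by (intro exI[of _ B] allI) (rule tendsto_upperbound[OF tendsto_norm[OF l]], auto)
  fix k
  have [measurable]: "h \<in> borel_measurable torus" using h by auto
  have "(\<lambda>n. LINT x|torus. of_real (h x) * \<phi> n x * wave k x) \<longlonglongrightarrow> (LINT x|torus. of_real (h x) * \<psi> x * wave k x)"
  proof (rule integral_dominated_convergence[where w = "\<lambda>x. \<bar>h x\<bar> * B"])
    show "(\<lambda>x. of_real (h x) * \<psi> x * wave k x) \<in> borel_measurable torus" using \<psi> by auto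
    show "(\<lambda>x. of_real (h x) * \<phi> n x * wave k x) \<in> borel_measurable torus" for n using m[of n] by auto
    show "integrable torus (\<lambda>x. \<bar>h x\<bar> * B)" using h by auto
    show "AE x in torus. (\<lambda>n. of_real (h x) * \<phi> n x * wave k x) \<longlonglongrightarrow> of_real (h x) * \<psi> x * wave k x"
      using l by (auto intro!: tendsto_intros)
    show "AE x in torus. norm (of_real (h x) * \<phi> n x * wave k x) \<le> \<bar>h x\<bar> * B" for n
      using B by (auto simp: norm_mult intro!: mult_left_mono)
  qed
  moreover have "(LINT x|torus. of_real (h x) * \<phi> n x * wave k x) = 0" for n
    using a by (auto simp: annihilated_def)
  ultimately show "(LINT x|torus. of_real (h x) * \<psi> x * wave k x) = 0" by (simp add: LIMSEQ_const_iff)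
qed

text \<open>Euler's formula writes the cosine as a combination of the waves at plus and minus
  \<open>axis i 1\<close>. The phase m stays free because the arcs below must be centred at an
  arbitrary point.\<close>

lemma annihilated_cos:
  assumes h: "integrable torus h" and a: "annihilated h \<phi>"
  shows "annihilated h (\<lambda>x. \<phi> x * of_real (cos (2 * pi * (x $ i - m))))"
proof -
  have w: "wave (axis i 1) x = cis (2 * pi * x $ i)" for x
    unfolding wave_def rvec_axis by (simp add: inner_axis')
  have w': "wave (- axis i 1) x = cis (- (2 * pi * x $ i))" for x
    unfolding wave_def rvec_simps rvec_axis by (simp add: inner_axis')
  have "\<phi> x * of_real (cos (2 * pi * (x $ i - m))) =
     cis (- (2 * pi * m)) / 2 * (\<phi> x * wave (axis i 1) x) + cis (2 * pi * m) / 2 * (\<phi> x * wave (- axis i 1) x)" for x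
  proof -
    have "of_real (cos (2 * pi * (x $ i - m))) = (cis (2 * pi * (x $ i - m)) + cis (- (2 * pi * (x $ i - m)))) / 2"
      by (simp add: complex_eq_iff)
    also have "\<dots> = (cis (2 * pi * x $ i) * cis (- (2 * pi * m)) + cis (- (2 * pi * x $ i)) * cis (2 * pi * m)) / 2"
      by (simp add: cis_mult algebra_simps)
    finally have E: "complex_of_real (cos (2 * pi * (x $ i - m))) = (cis (2 * pi * x $ i) * cis (- (2 * pi * m)) + cis (- (2 * pi * x $ i)) * cis (2 * pi * m)) / 2" .
    have "p * c = b / 2 * (p * a') + d / 2 * (p * c')" if "c = (a' * b + c' * d) / 2" for p a' b c c' d :: complex
      using arg_cong[OF that, of "\<lambda>y. p * y"] by (simp add: field_simps)
    from this[OF E] show ?thesis unfolding w w' .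
  qed
  then show ?thesis
    by (simp only:) (intro annihilated_lincomb annihilated_wave h a)
qed

lemma annihilated_poly:
  assumes h: "integrable torus h" and "real_polynomial_function p"
  shows "annihilated h \<phi> \<Longrightarrow> annihilated h (\<lambda>x. \<phi> x * of_real (p (cos (2 * pi * (x $ i - m)))))"
  using assms(2)
\<comment> \<open>Generalising over \<phi> settles the product case: the hypothesis for the second
  factor is applied to \<phi> times the first factor.\<close>
proof (induction p arbitrary: \<phi>)
  case (linear f)
  have "f (y *\<^sub>R 1) = y *\<^sub>R f 1" for y
    by (rule linear_scale[OF bounded_linear.linear[OF linear(1)]])
  then have f1: "f y = y * f 1" for y unfolding real_scaleR_def mult_1_right .
  define c where "c = f 1"
  have f: "f y = y * c" for y unfolding c_def by (rule f1)
  show ?case unfolding f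
    using annihilated_lincomb[OF h annihilated_cos[OF h linear(2), of i m] linear(2), of "of_real c" 0]
    by (simp add: mult_ac)
next
  case (const c)
  then show ?case using annihilated_lincomb[OF h const const, of "of_real c" 0] by (simp add: mult.commute)
next
  case (add f g)
  show ?case using annihilated_lincomb[OF h add.IH(1)[OF add.prems] add.IH(2)[OF add.prems], of 1 1]
    by (simp add: distrib_left)
next
  case (mult f g)
  show ?case using mult.IH(2)[OF mult.IH(1)[OF mult.prems]] by (simp add: mult.assoc)
qed

lemma annihilated_continuous:
  fixes f :: "real \<Rightarrow> real"
  assumes h: "integrable torus h" and f: "continuous_on {-1..1} f" and a: "annihilated h \<phi>"
  shows "annihilated h (\<lambda>x. \<phi> x * of_real (f (cos (2 * pi * (x $ i - m)))))"
proof -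
  have "\<exists>p. real_polynomial_function p \<and> (\<forall>y\<in>{-1..1}. \<bar>f y - p y\<bar> < 1 / real (Suc n))" for n
    by (rule Stone_Weierstrass_real_polynomial_function[OF compact_Icc f, of "1 / real (Suc n)"]) auto
  then have "\<forall>n. \<exists>p. real_polynomial_function p \<and> (\<forall>y\<in>{-1..1}. \<bar>f y - p y\<bar> < 1 / real (Suc n))" by (rule allI)
  from choice[OF this] obtain p where p: "\<And>n. real_polynomial_function (p n)"
    and pf: "\<And>n y. y \<in> {-1..1} \<Longrightarrow> \<bar>f y - p n y\<bar> < 1 / real (Suc n)" by blast
  define c where "c x = cos (2 * pi * (x $ i - m))" for x :: "real^3"
  have c: "c x \<in> {-1..1}" for x by (simp add: c_def)
  obtain C where C: "\<And>x. norm (\<phi> x) \<le> C" using a by (auto simp: annihilated_def)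
  have "bounded (f ` {-1..1})" using f by (intro compact_imp_bounded compact_continuous_image) auto
  then obtain A where A: "\<And>y. y \<in> {-1..1} \<Longrightarrow> \<bar>f y\<bar> \<le> A" unfolding bounded_iff real_norm_def by blast
  have "annihilated h (\<lambda>x. \<phi> x * of_real (f (c x)))"
  proof (rule annihilated_lim[OF h])
    show "annihilated h (\<lambda>x. \<phi> x * of_real (p n (c x)))" for n
      using annihilated_poly[OF h p a] by (simp add: c_def)
    fix x
    \<comment> \<open>Every approximant is within 1 of \<open>f\<close>, so \<open>A + 1\<close>
      bounds all of them at once.\<close>
    show "norm (\<phi> x * of_real (p n (c x))) \<le> C * (A + 1)" for n
    proof -
      have "1 / real (Suc n) \<le> 1" by simp
      then have "\<bar>p n (c x)\<bar> \<le> A + 1" using pf[OF c, of x n] A[OF c, of x] by linarith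
      moreover have "0 \<le> C" using order_trans[OF norm_ge_zero C[of x]] .
      ultimately show ?thesis unfolding norm_mult norm_of_real using C[of x] by (intro mult_mono) auto
    qed
    have "(\<lambda>n. p n (c x)) \<longlonglongrightarrow> f (c x)"
    proof (rule LIM_zero_cancel, rule Lim_null_comparison)
      show "\<forall>\<^sub>F n in sequentially. norm (p n (c x) - f (c x)) \<le> 1 / real (Suc n)"
        using pf[OF c] by (intro always_eventually allI) (simp add: abs_minus_commute less_imp_le)
      show "(\<lambda>n. 1 / real (Suc n)) \<longlonglongrightarrow> 0" using LIMSEQ_Suc lim_1_over_n by fast
    qed
    then show "(\<lambda>n. \<phi> x * of_real (p n (c x))) \<longlonglongrightarrow> \<phi> x * of_real (f (c x))" by (intro tendsto_intros)
  qed
  then show ?thesis by (simp add: c_def)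
qed

lemma annihilated_arc:
  assumes h: "integrable torus h" and a: "annihilated h \<phi>"
  shows "annihilated h (\<lambda>x. \<phi> x * of_bool (cos (2 * pi * (x $ i - m)) > c))"
proof -
  \<comment> \<open>Ramps of slope n that start at c tend pointwise to the indicator of y > c, also
    at y = c, where all of them vanish.\<close>
  define f where "f n y = min 1 (real n * max 0 (y - c))" for n y
  obtain C where C: "\<And>x. norm (\<phi> x) \<le> C" using a by (auto simp: annihilated_def)
  have lim: "(\<lambda>n. f n y) \<longlonglongrightarrow> of_bool (y > c)" for y
  proof (cases "y > c")
    case True
    have "eventually (\<lambda>n. real n * (y - c) > 1) sequentially"
    proof -
      obtain N where "1 / (y - c) < real N" using reals_Archimedean2 by blast
      then have "real n * (y - c) > 1" if "n \<ge> N" for n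
      proof -
        have "1 < real N * (y - c)" using \<open>1 / (y - c) < real N\<close> True by (simp add: divide_simps)
        also have "\<dots> \<le> real n * (y - c)" using that True by (intro mult_right_mono) auto
        finally show ?thesis .
      qed
      then show ?thesis by (auto simp: eventually_at_top_linorder)
    qed
    then have "eventually (\<lambda>n. f n y = 1) sequentially"
      by eventually_elim (use True in \<open>auto simp: f_def\<close>)
    then show ?thesis using True by (simp add: tendsto_eventually)
  qed (simp add: f_def)
  show ?thesis
  proof (rule annihilated_lim[OF h])
    show "annihilated h (\<lambda>x. \<phi> x * of_real (f n (cos (2 * pi * (x $ i - m)))))" for n
      by (rule annihilated_continuous[OF h _ a]) (auto simp: f_def intro!: continuous_intros)
    fix x
    show "norm (\<phi> x * of_real (f n (cos (2 * pi * (x $ i - m))))) \<le> C * 1" for n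
      unfolding norm_mult using C[of x] order_trans[OF norm_ge_zero C[of x]] by (intro mult_mono) (auto simp: f_def)
    show "(\<lambda>n. \<phi> x * of_real (f n (cos (2 * pi * (x $ i - m))))) \<longlonglongrightarrow> \<phi> x * of_bool (cos (2 * pi * (x $ i - m)) > c)"
    proof -
      have e: "of_real (of_bool b) = (of_bool b :: complex)" for b by (cases b) auto
      show ?thesis
        using tendsto_mult[OF tendsto_const[of "\<phi> x"] tendsto_of_real[OF lim[of "cos (2 * pi * (x $ i - m))"]]]
        unfolding e .
    qed
  qed
qed

lemma AE_torus_iff: "(AE x in torus. P x) \<longleftrightarrow> (AE x in lebesgue. x \<in> cbox 0 1 \<longrightarrow> P x)"
  unfolding torus_def by (rule AE_restrict_space_iff) auto

lemma AE_torus_interior: "AE x in torus. x \<in> box 0 1"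
proof -
  have "negligible (cbox (0::real^3) 1 - box 0 1)" by (rule negligible_frontier_interval)
  then have "AE x in lebesgue. x \<notin> cbox (0::real^3) 1 - box 0 1"
    unfolding negligible_iff_null_sets by (rule AE_not_in)
  then show ?thesis unfolding AE_torus_iff by eventually_elim auto
qed

lemma borel_measurable_torus: "f \<in> borel_measurable borel \<Longrightarrow> f \<in> borel_measurable torus"
  unfolding torus_def by (intro measurable_restrict_space1 measurable_completion) auto

lemma annihilated_AE_cong:
  assumes h: "integrable torus h" and a: "annihilated h \<phi>" and m: "\<psi> \<in> borel_measurable torus"
    and B: "\<And>x. norm (\<psi> x) \<le> B" and e: "AE x in torus. \<phi> x = \<psi> x"
  shows "annihilated h \<psi>"
  unfolding annihilated_def
proof (intro conjI allI)
  fix k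
  have [measurable]: "h \<in> borel_measurable torus" "\<phi> \<in> borel_measurable torus" "\<psi> \<in> borel_measurable torus"
    using h a m by (auto simp: annihilated_def)
  have "(LINT x|torus. of_real (h x) * \<psi> x * wave k x) = (LINT x|torus. of_real (h x) * \<phi> x * wave k x)"
    by (rule integral_cong_AE) (use e in auto)
  then show "(LINT x|torus. of_real (h x) * \<psi> x * wave k x) = 0" using a by (simp add: annihilated_def)
qed (use m B in auto)

text \<open>The interval from 0 to a is the arc of the circle with centre a / 2 and half opening
  angle pi * a, and an arc is a superlevel set of the cosine of the angle measured from its
  centre.\<close>

lemma cos_gt_iff_half_arc:
  assumes x: "0 < x" "x < 1" and a: "0 < a" "a < (1::real)"
  shows "cos (2 * pi * (x - a / 2)) > cos (pi * a) \<longleftrightarrow> x < a"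
proof -
  define \<theta> where "\<theta> = 2 * pi * (x - a / 2)"
  have l: "- (pi * a) < \<theta>" using x pi_gt_zero by (simp add: \<theta>_def algebra_simps)
  have u: "\<theta> < 2 * pi - pi * a" 
    using mult_strict_left_mono[OF x(2), of "2 * pi"] pi_gt_zero by (simp add: \<theta>_def algebra_simps)
  have pa: "0 < pi * a" "pi * a < pi" using a by auto
  have xa: "x < a \<longleftrightarrow> \<theta> < pi * a" by (simp add: \<theta>_def field_simps) 
  show ?thesis
  proof (cases "\<bar>\<theta>\<bar> \<le> pi")
    case True
    have "cos \<theta> = cos \<bar>\<theta>\<bar>" by (simp add: abs_if)
    moreover have "cos \<bar>\<theta>\<bar> > cos (pi * a) \<longleftrightarrow> \<bar>\<theta>\<bar> < pi * a"
      using cos_mono_less_eq[of "pi * a" "\<bar>\<theta>\<bar>"] True pa by auto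
    ultimately show ?thesis using l xa unfolding \<theta>_def[symmetric] by auto
  next
    case False
    then have t: "\<theta> > pi" using l pa by linarith
    have "cos \<theta> = cos (2 * pi - \<theta>)" by (simp add: cos_diff)
    moreover have "cos (pi * a) > cos (2 * pi - \<theta>)"
      using cos_mono_less_eq[of "2 * pi - \<theta>" "pi * a"] t u pa by auto
    ultimately show ?thesis using xa t pa unfolding \<theta>_def[symmetric] by auto
  qed
qed

text \<open>Inside the open unit cube a half space is empty, an arc in one coordinate, or
  everything, according to the position of c. The faces of the cube are null.\<close>

lemma annihilated_halfspace:
  assumes h: "integrable torus h" and a: "annihilated h \<phi>"
  shows "annihilated h (\<lambda>x. \<phi> x * of_bool (x $ i < c))"
proof -
  obtain C where C: "\<And>x. norm (\<phi> x) \<le> C" using a by (auto simp: annihilated_def)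
  have [measurable]: "\<phi> \<in> borel_measurable torus" using a by (auto simp: annihilated_def)
  have "(\<lambda>x::real^3. of_bool (x $ i < c) :: complex) \<in> borel_measurable torus"
    by (intro borel_measurable_torus) simp
  then have m: "(\<lambda>x. \<phi> x * of_bool (x $ i < c)) \<in> borel_measurable torus" by simp
  have B: "norm (\<phi> x * of_bool (x $ i < c)) \<le> C" for x using C[of x] order_trans[OF norm_ge_zero C[of x]] by simp
  consider "c \<le> 0" | "0 < c" "c < 1" | "1 \<le> c" by linarith
  then show ?thesis
  proof cases
    case 1
    have "annihilated h (\<lambda>x. 0 * \<phi> x + 0 * \<phi> x)" by (rule annihilated_lincomb[OF h a a])
    then show ?thesis
    proof (rule annihilated_AE_cong[OF h _ m B])
      show "AE x in torus. 0 * \<phi> x + 0 * \<phi> x = \<phi> x * of_bool (x $ i < c)"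
        using AE_torus_interior
      proof eventually_elim
        case (elim x)
        then have "0 < x $ i" by (auto simp: mem_box_cart)
        then show ?case using 1 by simp
      qed
    qed
  next
    case 2
    show ?thesis
    proof (rule annihilated_AE_cong[OF h annihilated_arc[OF h a, where i = i and m = "c / 2" and c = "cos (pi * c)"] m B])
      show "AE x in torus. \<phi> x * of_bool (cos (pi * c) < cos (2 * pi * (x $ i - c / 2))) = \<phi> x * of_bool (x $ i < c)"
        using AE_torus_interior
      proof eventually_elim
        case (elim x)
        then have "0 < x $ i" "x $ i < 1" by (auto simp: mem_box_cart)
        then show ?case using cos_gt_iff_half_arc[of "x $ i" c] 2 by simp
      qed
    qed
  next
    case 3
    show ?thesis
    proof (rule annihilated_AE_cong[OF h a m B])
      show "AE x in torus. \<phi> x = \<phi> x * of_bool (x $ i < c)" 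
        using AE_torus_interior
      proof eventually_elim
        case (elim x)
        then have "x $ i < 1" by (auto simp: mem_box_cart)
        then show ?case using 3 by simp
      qed
    qed
  qed
qed

text \<open>With \<phi> general, intersections amount to repeated multiplication by indicators, so
  the induction runs directly over the sigma-algebra and needs no Dynkin system. A countable union
  is handled through its complement, a decreasing limit of finite intersections of
  complements.\<close>

lemma annihilated_borel:
  assumes h: "integrable torus h" and A: "A \<in> sets borel"
  shows "annihilated h \<phi> \<Longrightarrow> annihilated h (\<lambda>x. \<phi> x * of_bool (x \<in> A))"
proof -
  have "A \<in> sigma_sets UNIV ((\<lambda>(a, i). {x::real^3. x \<bullet> i < a}) ` (UNIV \<times> Basis))"
    using A by (subst (asm) borel_eq_halfspace_less) auto
  then show "annihilated h \<phi> \<Longrightarrow> annihilated h (\<lambda>x. \<phi> x * of_bool (x \<in> A))"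
  proof (induction arbitrary: \<phi>)
    case (Basic A)
    then obtain a j where "A = {x. x $ j < a}" by (auto simp: Basis_vec_def inner_axis)
    then show ?case using annihilated_halfspace[OF h Basic(2)] by simp
  next
    case Empty
    then show ?case using annihilated_lincomb[OF h Empty Empty, of 0 0] by simp
  next
    case (Compl A)
    have "annihilated h (\<lambda>x. 1 * \<phi> x + (- 1) * (\<phi> x * of_bool (x \<in> A)))"
      by (intro annihilated_lincomb[OF h] Compl)
    then show ?case by (rule back_subst[of "annihilated h"]) auto
  next
    case (Union A)
    obtain C where C: "\<And>x. norm (\<phi> x) \<le> C" using Union.prems by (auto simp: annihilated_def)
    have fin: "annihilated h (\<lambda>x. \<phi> x * of_bool (\<forall>i<n. x \<notin> A i))" for n
    proof (induction n)
      case (Suc n)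
      have "annihilated h (\<lambda>x. 1 * (\<phi> x * of_bool (\<forall>i<n. x \<notin> A i)) + (- 1) * (\<phi> x * of_bool (\<forall>i<n. x \<notin> A i) * of_bool (x \<in> A n)))"
        by (intro annihilated_lincomb[OF h] Suc Union.IH)
      then show ?case by (rule back_subst[of "annihilated h"]) (auto simp: less_Suc_eq of_bool_def fun_eq_iff)
    qed (use Union.prems in simp)
    have lim: "annihilated h (\<lambda>x. \<phi> x * of_bool (\<forall>i. x \<notin> A i))"
    proof (rule annihilated_lim[OF h fin])
      show "norm (\<phi> x * of_bool (\<forall>i<n. x \<notin> A i)) \<le> C" for n x
        using C[of x] order_trans[OF norm_ge_zero C[of x]] by simp
      show "(\<lambda>n. \<phi> x * of_bool (\<forall>i<n. x \<notin> A i)) \<longlonglongrightarrow> \<phi> x * of_bool (\<forall>i. x \<notin> A i)" for x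
      proof (cases "\<forall>i. x \<notin> A i")
        case False
        then obtain i where i: "x \<in> A i" by blast
        have "eventually (\<lambda>n. \<phi> x * of_bool (\<forall>i<n. x \<notin> A i) = \<phi> x * of_bool (\<forall>i. x \<notin> A i)) sequentially"
          using eventually_gt_at_top[of i] by eventually_elim (use i in auto)
        then show ?thesis by (rule tendsto_eventually)
      qed simp
    qed
    have "annihilated h (\<lambda>x. 1 * \<phi> x + (- 1) * (\<phi> x * of_bool (\<forall>i. x \<notin> A i)))"
      by (intro annihilated_lincomb[OF h] Union.prems lim)
    then show ?case by (rule back_subst[of "annihilated h"]) auto
  qed
qed

text \<open>Testing against the indicators of the sets where the function is positive and where it
  is negative shows that both its positive and its negative part have integral 0.\<close>

lemma fourier_uniqueness:
  assumes h: "integrable torus h" and z: "\<And>k. (LINT x|torus. of_real (h x) * wave k x) = 0"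
  shows "AE x in torus. h x = 0"
proof -
  have "h \<in> borel_measurable torus" using h by auto
  then have "(\<lambda>x. if x \<in> cbox 0 1 then h x else 0) \<in> borel_measurable lebesgue"
    unfolding torus_def by (subst borel_measurable_if) auto
  \<comment> \<open>\<open>h\<close> is only Lebesgue measurable, whereas
    \<open>annihilated_borel\<close> speaks of Borel sets, so the sign sets are taken from a Borel
    version of \<open>h\<close>.\<close>
  then obtain g where g [measurable]: "g \<in> borel_measurable borel"
    and "AE x in lborel. (if x \<in> cbox 0 1 then h x else 0) = g x"
    using completion_ex_borel_measurable_real[of _ lborel] by auto
  then have "AE x in lebesgue. (if x \<in> cbox 0 1 then h x else 0) = g x" by (intro AE_completion) 
  then have gh: "AE x in torus. h x = g x" unfolding AE_torus_iff by eventually_elim auto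
  have [measurable]: "g \<in> borel_measurable torus" "h \<in> borel_measurable torus"
    using h by (auto intro: borel_measurable_torus)
  have a: "annihilated h (\<lambda>x. 1)" using z by (auto simp: annihilated_def)
  have gi: "integrable torus g" using h gh by (subst integrable_cong_AE[symmetric, of h]) auto
  have nn: "(LINT x|torus. c * g x * of_bool (0 < c * g x)) = 0" if "c \<noteq> 0" for c
  proof -
    have "{x. 0 < c * g x} \<in> sets borel" by measurable
    from annihilated_borel[OF h this a] have "(LINT x|torus. of_real (h x) * (1 * of_bool (x \<in> {x. 0 < c * g x})) * wave 0 x) = 0"
      unfolding annihilated_def by blast
    moreover have "of_real (h x) * (1 * of_bool (x \<in> {x. 0 < c * g x})) * wave 0 x = complex_of_real (h x * of_bool (0 < c * g x))" for x
      by simp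
    ultimately have "(LINT x|torus. complex_of_real (h x * of_bool (0 < c * g x))) = 0" by (simp only:)
    then have 0: "(LINT x|torus. h x * of_bool (0 < c * g x)) = 0" by (simp only: integral_complex_of_real of_real_eq_0_iff)
    have "(\<lambda>x::real^3. of_bool (0 < c * g x) :: real) \<in> borel_measurable borel" by measurable
    then have [measurable]: "(\<lambda>x::real^3. of_bool (0 < c * g x) :: real) \<in> borel_measurable torus" 
      by (rule borel_measurable_torus)
    have "(LINT x|torus. h x * of_bool (0 < c * g x)) = (LINT x|torus. g x * of_bool (0 < c * g x))"
      by (rule integral_cong_AE) (use gh in auto)
    with 0 show ?thesis by (simp add: mult.assoc)
  qed
  have AE: "AE x in torus. c * g x * of_bool (0 < c * g x) = 0" if "c \<noteq> 0" for c
  proof -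
    have "(\<lambda>x::real^3. of_bool (0 < c * g x) :: real) \<in> borel_measurable borel" by measurable
    then have m [measurable]: "(\<lambda>x::real^3. of_bool (0 < c * g x) :: real) \<in> borel_measurable torus" 
      by (rule borel_measurable_torus)
    have "integrable torus (\<lambda>x. c * g x * of_bool (0 < c * g x))"
      by (rule integrable_torus_mult_bounded[where B = 1]) (use gi m in auto)
    moreover have "AE x in torus. 0 \<le> c * g x * of_bool (0 < c * g x)" by (intro AE_I2) (simp add: of_bool_def)
    ultimately show ?thesis using integral_nonneg_eq_0_iff_AE nn[OF that] by blast
  qed
  have "AE x in torus. g x * of_bool (0 < g x) = 0" "AE x in torus. - g x * of_bool (0 < - g x) = 0"
    using AE[of 1] AE[of "-1"] by (simp_all only: mult_1 mult_minus1 one_neq_zero neg_equal_0_iff_equal not_False_eq_True simp_thms)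
  then show ?thesis using gh by eventually_elim (auto simp: of_bool_def split: if_splits)
qed

text \<open>The points of disagreement in the open cube form an open null set, hence none exist.
  Closure and periodicity spread the equality to all of space.\<close>

lemma continuous_AE_eq:
  fixes f g :: "real^3 \<Rightarrow> 'b::real_normed_vector"
  assumes "continuous_on UNIV f" "continuous_on UNIV g" "periodic f" "periodic g"
    and e: "AE x in torus. f x = g x"
  shows "f = g"
proof -
  have op: "open {x \<in> box 0 1. f x \<noteq> g x}"
    using open_Int[OF open_box open_Collect_neq[OF assms(1,2)], of 0 1] by (simp add: Int_def)
  have "AE x in lebesgue. x \<notin> {x \<in> box 0 1. f x \<noteq> g x}"
    using e unfolding AE_torus_iff by eventually_elim (auto simp: mem_box_cart less_imp_le)
  then have "negligible {x \<in> box 0 1. f x \<noteq> g x}"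
    unfolding negligible_iff_null_sets by (subst AE_iff_null_sets) (use op in auto)
  with op have "{x \<in> box 0 1. f x \<noteq> g x} = {}" using open_not_negligible by blast
  then have "box 0 1 \<subseteq> {x. f x = g x}" by auto
  moreover have "closed {x. f x = g x}" using closed_Collect_eq[OF assms(1,2)] .
  ultimately have "closure (box 0 1) \<subseteq> {x. f x = g x}" by (rule closure_minimal)
  moreover have "(0::real^3) \<in> cbox 0 1" by (simp add: mem_box_cart)
  moreover have "box (0::real^3) 1 \<noteq> {}" by (simp add: interval_eq_empty_cart)
  ultimately have c: "cbox 0 1 \<subseteq> {x. f x = g x}" by simp
  have "periodic (\<lambda>x. (f x, g x))" using assms(3,4) by (simp add: periodic_def)
  show ?thesis
  proof
    fix x
    show "f x = g x"
      by (rule periodic_in_cube[OF \<open>periodic (\<lambda>x. (f x, g x))\<close>, of x]) (use c in auto)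
  qed
qed

section \<open>Absolutely convergent Fourier series\<close>

definition hermitian :: "(int ^ 3 \<Rightarrow> complex) \<Rightarrow> bool" where
  "hermitian a \<longleftrightarrow> (\<forall>k. a (- k) = cnj (a k))"

text \<open>The real part makes the function real for every \<open>a\<close>. For hermitian
  coefficients it discards nothing, see \<open>hermitian_fseries\<close>.\<close>

definition fseries :: "(int ^ 3 \<Rightarrow> complex) \<Rightarrow> real ^ 3 \<Rightarrow> real" where
  "fseries a x = Re (\<Sum>\<^sub>\<infinity>k. a k * wave k x)"

definition fdiff :: "3 \<Rightarrow> (int ^ 3 \<Rightarrow> complex) \<Rightarrow> int ^ 3 \<Rightarrow> complex" where
  "fdiff i a k = 2 * pi * \<i> * of_int (k $ i) * a k"

abbreviation abssummable :: "(int ^ 3 \<Rightarrow> complex) \<Rightarrow> bool" where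
  "abssummable a \<equiv> (\<lambda>k. norm (a k)) summable_on UNIV"

abbreviation abssummable1 :: "(int ^ 3 \<Rightarrow> complex) \<Rightarrow> bool" where
  "abssummable1 a \<equiv> (\<lambda>k. (1 + norm (rvec k)) * norm (a k)) summable_on UNIV"

lemma has_sum_finite_sum:
  fixes f :: "'i \<Rightarrow> 'k \<Rightarrow> 'b::{topological_comm_monoid_add}"
  assumes "finite I" "\<And>i. i \<in> I \<Longrightarrow> (f i has_sum s i) A"
  shows "((\<lambda>k. \<Sum>i\<in>I. f i k) has_sum (\<Sum>i\<in>I. s i)) A"
  using assms by (induction rule: finite_induct) (auto intro: has_sum_add)

lemma abssummable_mult_bounded:
  assumes "abssummable a" "\<And>k. norm (b k) \<le> B"
  shows "abssummable (\<lambda>k. a k * b k)" "(\<lambda>k. a k * b k) summable_on UNIV"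
proof -
  show 1: "abssummable (\<lambda>k. a k * b k)"
    using assms by (intro Infinite_Sum.abs_summable_on_comparison_test'[where g = "\<lambda>k. norm (a k) * B"])
      (auto simp: norm_mult intro!: summable_on_cmult_left mult_left_mono)
  show "(\<lambda>k. a k * b k) summable_on UNIV" using 1 by (rule abs_summable_summable)
qed

lemma abssummable1_imp: "abssummable1 a \<Longrightarrow> abssummable a"
  by (rule Infinite_Sum.abs_summable_on_comparison_test'[where g = "\<lambda>k. (1 + norm (rvec k)) * norm (a k)"])
     (auto simp: algebra_simps)

lemma wave_summable: "abssummable a \<Longrightarrow> (\<lambda>k. a k * wave k x) summable_on UNIV"
  by (rule abssummable_mult_bounded(2)[where B = 1]) auto

lemma norm_rvec_component: "\<bar>real_of_int (k $ i)\<bar> \<le> norm (rvec k)"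
  using component_le_norm_cart[of "rvec k" i] by simp

lemma abssummable_fdiff: "abssummable1 a \<Longrightarrow> abssummable (fdiff i a)"
proof (rule Infinite_Sum.abs_summable_on_comparison_test'[where g = "\<lambda>k. 2 * pi * ((1 + norm (rvec k)) * norm (a k))"])
  fix k
  have "\<bar>real_of_int (k $ i)\<bar> \<le> 1 + norm (rvec k)" using norm_rvec_component[of k i] by simp
  then show "norm (fdiff i a k) \<le> 2 * pi * ((1 + norm (rvec k)) * norm (a k))"
    unfolding fdiff_def by (simp add: norm_mult mult_right_mono)
qed (intro summable_on_cmult_right)

lemma hermitian_fdiff: "hermitian a \<Longrightarrow> hermitian (fdiff i a)"
  by (auto simp: hermitian_def fdiff_def)

lemma fdiff_commute: "fdiff i (fdiff j a) = fdiff j (fdiff i a)"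
  by (auto simp: fdiff_def)

lemma uminus_bij: "bij_betw uminus (UNIV :: (int^3) set) UNIV"
  by (rule bij_betw_byWitness[where f' = uminus]) auto

lemma hermitian_fseries:
  assumes "hermitian a"
  shows "complex_of_real (fseries a x) = (\<Sum>\<^sub>\<infinity>k. a k * wave k x)"
proof -
  have "cnj (\<Sum>\<^sub>\<infinity>k. a k * wave k x) = (\<Sum>\<^sub>\<infinity>k. cnj (a k * wave k x))"
    by (rule infsum_cnj[symmetric])
  also have "\<dots> = (\<Sum>\<^sub>\<infinity>k. a (- k) * wave (- k) x)"
    using assms by (simp add: hermitian_def)
  also have "\<dots> = (\<Sum>\<^sub>\<infinity>k. a k * wave k x)"
    by (rule infsum_reindex_bij_betw[OF uminus_bij])
  finally show ?thesis unfolding fseries_def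
    by (metis Reals_cnj_iff of_real_Re)
qed

lemma continuous_wave_series:
  assumes "abssummable a"
  shows "continuous_on UNIV (\<lambda>x. \<Sum>\<^sub>\<infinity>k. a k * wave k x)"
proof (rule uniform_limit_theorem)
  show "uniform_limit UNIV (\<lambda>X x. \<Sum>k\<in>X. a k * wave k x) (\<lambda>x. \<Sum>\<^sub>\<infinity>k. a k * wave k x) (finite_subsets_at_top UNIV)"
    by (rule Weierstrass_m_test_general[OF _ assms]) (auto simp: norm_mult)
  show "\<forall>\<^sub>F X in finite_subsets_at_top UNIV. continuous_on UNIV (\<lambda>x. \<Sum>k\<in>X. a k * wave k x)"
    by (intro always_eventually allI continuous_intros)
qed simp

lemma continuous_fseries: "abssummable a \<Longrightarrow> continuous_on UNIV (fseries a)"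
  unfolding fseries_def[abs_def] by (intro continuous_intros continuous_wave_series)

lemma periodic_fseries: "periodic (fseries a)"
  by (simp add: periodic_def fseries_def wave_plus)

lemma infinite_int3: "infinite (UNIV :: (int ^ 3) set)"
proof -
  have "inj (\<lambda>n::int. (\<chi> i. n) :: int^3)" by (auto simp: inj_def vec_eq_iff)
  then show ?thesis using range_inj_infinite infinite_super finite_imageD[of _ UNIV]
    by (metis infinite_UNIV_int finite_subset subset_UNIV)
qed

text \<open>Termwise differentiation and integration are used for series indexed by naturals; an
  enumeration of the lattice carries unordered sums over to them.\<close>

lemma freq_enumeration: obtains \<kappa> :: "nat \<Rightarrow> int ^ 3" where "bij_betw \<kappa> UNIV UNIV"
  using countableE_infinite[OF _ infinite_int3] by (metis bij_betw_inv_into countableI_type)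

lemma summable_enumerated:
  fixes f :: "int ^ 3 \<Rightarrow> 'b::banach"
  assumes k: "bij_betw \<kappa> (UNIV::nat set) UNIV" and s: "(\<lambda>k. norm (f k)) summable_on UNIV"
  shows "summable (\<lambda>n. norm (f (\<kappa> n)))" "(\<lambda>n. f (\<kappa> n)) sums (\<Sum>\<^sub>\<infinity>k. f k)"
proof -
  have "(\<lambda>n. norm (f (\<kappa> n))) summable_on UNIV"
    using s summable_on_reindex_bij_betw[OF k, of "\<lambda>k. norm (f k)"] by simp
  then show "summable (\<lambda>n. norm (f (\<kappa> n)))" by (rule summable_on_imp_summable)
  have "f summable_on UNIV" using s by (rule abs_summable_summable)
  then have "(f has_sum (\<Sum>\<^sub>\<infinity>k. f k)) UNIV" by simp
  then have "((\<lambda>n. f (\<kappa> n)) has_sum (\<Sum>\<^sub>\<infinity>k. f k)) UNIV"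
    using has_sum_reindex_bij_betw[OF k, of f] by simp
  then show "(\<lambda>n. f (\<kappa> n)) sums (\<Sum>\<^sub>\<infinity>k. f k)" by (rule has_sum_imp_sums)
qed

lemma has_derivative_wave:
  "(wave k has_derivative (\<lambda>h. 2 * pi * \<i> * of_real (rvec k \<bullet> h) * wave k x)) (at x)"
proof -
  have w: "wave k = (\<lambda>x. exp (\<i> * of_real (2 * pi * (rvec k \<bullet> x))))"
    by (auto simp: wave_def cis_conv_exp)
  have "((\<lambda>x. \<i> * of_real (2 * pi * (rvec k \<bullet> x))) has_derivative (\<lambda>h. \<i> * of_real (2 * pi * (rvec k \<bullet> h)))) (at x)"
    by (intro has_derivative_mult_right has_derivative_of_real has_derivative_inner_right has_derivative_ident)
  from has_derivative_compose[OF this DERIV_exp[THEN has_field_derivative_imp_has_derivative]] show ?thesis unfolding w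
    by (simp add: mult_ac)
qed

lemma has_derivative_wave_series:
  assumes a: "abssummable1 a"
  shows "((\<lambda>x. \<Sum>\<^sub>\<infinity>k. a k * wave k x) has_derivative
          (\<lambda>h. \<Sum>\<^sub>\<infinity>k. 2 * pi * \<i> * of_real (rvec k \<bullet> h) * a k * wave k x)) (at x)"
proof -
  obtain \<kappa> :: "nat \<Rightarrow> int ^ 3" where \<kappa>: "bij_betw \<kappa> UNIV UNIV" by (rule freq_enumeration)
  define f' where "f' k x h = 2 * pi * \<i> * of_real (rvec k \<bullet> h) * a k * wave k x" for k x h
  \<comment> \<open>Bound on the operator norm of the derivative of the k-th term, uniform in x. Its
    tails give the uniform convergence required for termwise differentiation.\<close>
  define M where "M k = 2 * pi * (norm (rvec k) * norm (a k))" for k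
  have M: "(\<lambda>k. norm (M k)) summable_on UNIV"
    unfolding M_def by (rule Infinite_Sum.abs_summable_on_comparison_test'[OF summable_on_cmult_right[OF a, of "2 * pi"]])
      (simp add: norm_mult mult_right_mono)
  have f'M: "norm (f' k x h) \<le> M k * norm h" for k x h
    using mult_left_mono[OF Cauchy_Schwarz_ineq2[of "rvec k" h], of "2 * pi * norm (a k)"]
    by (simp add: f'_def M_def norm_mult mult_ac)
  have f's: "(\<lambda>k. norm (f' k x h)) summable_on UNIV" for x h
    using M by (intro Infinite_Sum.abs_summable_on_comparison_test'[where g = "\<lambda>k. M k * norm h"] summable_on_cmult_left f'M)
      (auto intro: abs_summable_summable)
  have sM: "summable (\<lambda>n. M (\<kappa> n))" using summable_enumerated(1)[OF \<kappa> M] by (rule summable_norm_cancel)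
  have s: "(\<lambda>n. a (\<kappa> n) * wave (\<kappa> n) x) sums (\<Sum>\<^sub>\<infinity>k. a k * wave k x)" for x
    by (rule summable_enumerated(2)[OF \<kappa>]) (use abssummable1_imp[OF a] in \<open>simp add: norm_mult\<close>)
  have "\<exists>g. \<forall>x\<in>UNIV. (\<lambda>n. a (\<kappa> n) * wave (\<kappa> n) x) sums g x \<and> (g has_derivative (\<lambda>h. \<Sum>\<^sub>\<infinity>k. f' k x h)) (at x within UNIV)"
  proof (rule has_derivative_series[where f' = "\<lambda>n. f' (\<kappa> n)"])
    fix n x
    show "((\<lambda>x. a (\<kappa> n) * wave (\<kappa> n) x) has_derivative f' (\<kappa> n) x) (at x within UNIV)"
      unfolding f'_def by (auto intro!: derivative_eq_intros has_derivative_wave simp: mult_ac)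
  next
    fix e :: real assume "e > 0"
    then obtain N where N: "\<And>n. n \<ge> N \<Longrightarrow> norm (\<Sum>i. M (\<kappa> (i + n))) < e"
      using suminf_exist_split[OF _ sM] by blast
    have "norm ((\<Sum>i<n. f' (\<kappa> i) x h) - (\<Sum>\<^sub>\<infinity>k. f' k x h)) \<le> e * norm h" if "n \<ge> N" for n x h
    proof -
      have sf: "(\<lambda>n. f' (\<kappa> n) x h) sums (\<Sum>\<^sub>\<infinity>k. f' k x h)" by (rule summable_enumerated(2)[OF \<kappa> f's])
      have sn: "summable (\<lambda>i. norm (f' (\<kappa> (i + n)) x h))"
        using summable_ignore_initial_segment[OF summable_enumerated(1)[OF \<kappa> f's]] .
      have "(\<Sum>\<^sub>\<infinity>k. f' k x h) - (\<Sum>i<n. f' (\<kappa> i) x h) = (\<Sum>i. f' (\<kappa> (i + n)) x h)"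
        using suminf_minus_initial_segment[OF sums_summable[OF sf], of n] sums_unique[OF sf] by simp
      then have "norm ((\<Sum>i<n. f' (\<kappa> i) x h) - (\<Sum>\<^sub>\<infinity>k. f' k x h)) = norm (\<Sum>i. f' (\<kappa> (i + n)) x h)"
        by (simp add: norm_minus_commute)
      also have "\<dots> \<le> (\<Sum>i. norm (f' (\<kappa> (i + n)) x h))" by (rule summable_norm[OF sn])
      also have "\<dots> \<le> (\<Sum>i. M (\<kappa> (i + n)) * norm h)"
        by (rule suminf_le[OF f'M sn]) (intro summable_mult2 summable_ignore_initial_segment sM)
      also have "\<dots> = (\<Sum>i. M (\<kappa> (i + n))) * norm h"
        by (rule suminf_mult2[symmetric]) (intro summable_ignore_initial_segment sM)
      also have "\<dots> \<le> e * norm h" using N[OF that] by (intro mult_right_mono) auto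
      finally show ?thesis .
    qed
    then show "\<forall>\<^sub>F n in sequentially. \<forall>x\<in>UNIV. \<forall>h. norm ((\<Sum>i<n. f' (\<kappa> i) x h) - (\<Sum>\<^sub>\<infinity>k. f' k x h)) \<le> e * norm h"
      unfolding eventually_sequentially by blast
  next
    show "(\<lambda>n. a (\<kappa> n) * wave (\<kappa> n) 0) sums (\<Sum>\<^sub>\<infinity>k. a k * wave k 0)" by (rule s)
  qed auto
  then obtain g where g: "\<And>x. (\<lambda>n. a (\<kappa> n) * wave (\<kappa> n) x) sums g x"
    and gd: "\<And>x. (g has_derivative (\<lambda>h. \<Sum>\<^sub>\<infinity>k. f' k x h)) (at x)" by auto
  have "g = (\<lambda>x. \<Sum>\<^sub>\<infinity>k. a k * wave k x)" using sums_unique2[OF g s] by auto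
  then show ?thesis using gd unfolding f'_def by simp
qed

lemma has_derivative_fseries:
  assumes a: "abssummable1 a"
  shows "(fseries a has_derivative (\<lambda>h. \<Sum>i\<in>UNIV. h $ i * fseries (fdiff i a) x)) (at x)"
proof -
  have s: "(\<lambda>k. fdiff i a k * wave k x) summable_on UNIV" for i
    by (rule wave_summable[OF abssummable_fdiff[OF a]])
  have "(\<Sum>\<^sub>\<infinity>k. 2 * pi * \<i> * of_real (rvec k \<bullet> h) * a k * wave k x) =
        (\<Sum>i\<in>UNIV. of_real (h $ i) * (\<Sum>\<^sub>\<infinity>k. fdiff i a k * wave k x))" for h
  proof -
    have "2 * pi * \<i> * of_real (rvec k \<bullet> h) * a k * wave k x = (\<Sum>i\<in>UNIV. of_real (h $ i) * (fdiff i a k * wave k x))" for k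
      by (simp add: inner_vec_def fdiff_def sum_distrib_left sum_distrib_right mult_ac)
    moreover have "((\<lambda>k. \<Sum>i\<in>UNIV. of_real (h $ i) * (fdiff i a k * wave k x)) has_sum
        (\<Sum>i\<in>UNIV. of_real (h $ i) * (\<Sum>\<^sub>\<infinity>k. fdiff i a k * wave k x))) UNIV"
      using s by (intro has_sum_finite_sum has_sum_cmult_right) auto
    ultimately show ?thesis by (simp add: infsumI)
  qed
  then have "((\<lambda>x. \<Sum>\<^sub>\<infinity>k. a k * wave k x) has_derivative
      (\<lambda>h. \<Sum>i\<in>UNIV. of_real (h $ i) * (\<Sum>\<^sub>\<infinity>k. fdiff i a k * wave k x))) (at x)"
    using has_derivative_wave_series[OF a, of x] by simp
  from bounded_linear.has_derivative[OF bounded_linear_Re this] show ?thesis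
    unfolding fseries_def[abs_def] by simp
qed

lemma has_real_derivative_fseries:
  assumes a: "abssummable1 a"
  shows "((\<lambda>\<tau>. fseries a (x + \<tau> *\<^sub>R axis i 1)) has_real_derivative fseries (fdiff i a) x) (at 0)"
proof -
  have "((\<lambda>\<tau>. fseries a (x + \<tau> *\<^sub>R axis i 1)) has_derivative
      (\<lambda>\<tau>. \<Sum>j\<in>UNIV. (\<tau> *\<^sub>R axis i 1) $ j * fseries (fdiff j a) (x + 0 *\<^sub>R axis i 1))) (at 0)"
    by (rule has_derivative_compose[OF _ has_derivative_fseries[OF a]]) (auto intro!: derivative_eq_intros)
  then show ?thesis
  proof -
    assume D: "((\<lambda>\<tau>. fseries a (x + \<tau> *\<^sub>R axis i 1)) has_derivative
      (\<lambda>\<tau>. \<Sum>j\<in>UNIV. (\<tau> *\<^sub>R axis i 1) $ j * fseries (fdiff j a) (x + 0 *\<^sub>R axis i 1))) (at 0)"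
    have "(\<tau> *\<^sub>R axis i 1) $ j * fseries (fdiff j a) (x + 0 *\<^sub>R axis i 1) = (if j = i then fseries (fdiff i a) x * \<tau> else 0)" for j \<tau>
      by (simp add: axis_def)
    with D show ?thesis by (simp add: has_field_derivative_def)
  qed
qed

text \<open>Waves have modulus 1, so absolute convergence of the coefficients justifies termwise
  integration. As \<open>g\<close> is any integrable function, this one lemma yields the
  coefficients of a series, those of a product, and Parseval's identity.\<close>

lemma LINT_fseries_mult:
  assumes a: "abssummable a" "hermitian a" and g: "integrable torus g"
  shows "(LINT x|torus. of_real (fseries a x) * g x) = (\<Sum>\<^sub>\<infinity>k. a k * (LINT x|torus. wave k x * g x))"
    (is "?L = _")
    and "abssummable (\<lambda>k. a k * (LINT x|torus. wave k x * g x))"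
proof -
  define G where "G = (LINT x|torus. norm (g x))"
  have [measurable]: "g \<in> borel_measurable torus" using g by auto
  have wg: "integrable torus (\<lambda>x. wave k x * g x)" for k
    using integrable_torus_mult_bounded[OF g, of "wave k" 1] by (simp add: mult.commute)
  have le: "norm (LINT x|torus. wave k x * g x) \<le> G" for k
    using integral_norm_bound[of torus "\<lambda>x. wave k x * g x"] by (simp add: norm_mult G_def)
  show s: "abssummable (\<lambda>k. a k * (LINT x|torus. wave k x * g x))"
    by (rule abssummable_mult_bounded[OF a(1) le])
  obtain \<kappa> :: "nat \<Rightarrow> int ^ 3" where \<kappa>: "bij_betw \<kappa> UNIV UNIV" by (rule freq_enumeration)
  have sa: "summable (\<lambda>n. norm (a (\<kappa> n)))" by (rule summable_enumerated(1)[OF \<kappa> a(1)])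
  have ptw: "(\<lambda>n. a (\<kappa> n) * (wave (\<kappa> n) x * g x)) sums (of_real (fseries a x) * g x)" for x
    using sums_mult2[OF summable_enumerated(2)[OF \<kappa>, of "\<lambda>k. a k * wave k x"], of "g x"] a
    by (simp add: hermitian_fseries norm_mult mult.assoc)
  have "(\<lambda>n. LINT x|torus. a (\<kappa> n) * (wave (\<kappa> n) x * g x)) sums (LINT x|torus. (\<Sum>n. a (\<kappa> n) * (wave (\<kappa> n) x * g x)))"
  proof (rule sums_integral)
    show "integrable torus (\<lambda>x. a (\<kappa> n) * (wave (\<kappa> n) x * g x))" for n using wg by simp
    show "AE x in torus. summable (\<lambda>n. norm (a (\<kappa> n) * (wave (\<kappa> n) x * g x)))"
      using summable_mult2[OF sa] by (auto simp: norm_mult)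
    show "summable (\<lambda>n. LINT x|torus. norm (a (\<kappa> n) * (wave (\<kappa> n) x * g x)))"
      using summable_mult2[OF sa] by (simp add: norm_mult)
  qed
  then have "(\<lambda>n. a (\<kappa> n) * (LINT x|torus. wave (\<kappa> n) x * g x)) sums ?L"
    using sums_unique[OF ptw] wg by simp
  then show "?L = (\<Sum>\<^sub>\<infinity>k. a k * (LINT x|torus. wave k x * g x))"
    using summable_enumerated(2)[OF \<kappa> s] by (rule sums_unique2)
qed

lemma fourier_coeff_fseries:
  assumes a: "abssummable a" "hermitian a"
  shows "(LINT x|torus. of_real (fseries a x) * wave (- l) x) = a l"
proof -
  have "(LINT x|torus. of_real (fseries a x) * wave (- l) x) = (\<Sum>\<^sub>\<infinity>k. a k * (LINT x|torus. wave k x * wave (- l) x))"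
    by (rule LINT_fseries_mult[OF a]) (intro continuous_integrable_torus continuous_wave)
  also have "\<dots> = (\<Sum>\<^sub>\<infinity>k. if k = l then a l else 0)"
    by (intro infsum_cong) (auto simp: wave_add[symmetric] LINT_wave)
  also have "\<dots> = (\<Sum>\<^sub>\<infinity>k\<in>{l}. a l)"
    by (rule infsum_cong_neutral) auto
  finally show ?thesis by simp
qed

lemma fourier_coeff_fseries_product:
  assumes a: "abssummable a" "hermitian a" and b: "abssummable b" "hermitian b"
  shows "(LINT x|torus. of_real (fseries a x * fseries b x) * wave (- l) x) = (\<Sum>\<^sub>\<infinity>k. a k * b (l - k))"
proof -
  have "(LINT x|torus. of_real (fseries a x * fseries b x) * wave (- l) x) =
     (LINT x|torus. of_real (fseries a x) * (of_real (fseries b x) * wave (- l) x))"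
    by (simp add: mult.assoc)
  also have "\<dots> = (\<Sum>\<^sub>\<infinity>k. a k * (LINT x|torus. wave k x * (of_real (fseries b x) * wave (- l) x)))"
    by (intro LINT_fseries_mult[OF a] continuous_integrable_torus continuous_intros continuous_fseries b)
  also have "\<dots> = (\<Sum>\<^sub>\<infinity>k. a k * b (l - k))"
  proof (intro infsum_cong arg_cong[where f = "(*) _"])
    fix k
    have "(LINT x|torus. wave k x * (of_real (fseries b x) * wave (- l) x)) =
      (LINT x|torus. of_real (fseries b x) * wave (- (l - k)) x)"
      by (intro Bochner_Integration.integral_cong) (auto simp: wave_add[symmetric] mult_ac)
    then show "(LINT x|torus. wave k x * (of_real (fseries b x) * wave (- l) x)) = b (l - k)"
      by (simp only: fourier_coeff_fseries[OF b])
  qed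
  finally show ?thesis .
qed

section \<open>Vector fields given by Fourier series\<close>

definition vfseries :: "(3 \<Rightarrow> int ^ 3 \<Rightarrow> complex) \<Rightarrow> real ^ 3 \<Rightarrow> real ^ 3" where
  "vfseries a x = (\<chi> j. fseries (a j) x)"

lemma fourier_component:
  "fourier u k $ j = (LINT x|torus. complex_of_real (u x $ j) * wave (- k) x)"
proof -
  have "exp (- 2 * pi * \<i> * complex_of_real (rvec k \<bullet> x)) = wave (- k) x" for x
    by (simp add: wave_def cis_conv_exp mult_ac)
  then show ?thesis by (simp add: fourier_def)
qed

lemma vec_eqI_cart: "(\<And>i. x $ i = y $ i) \<Longrightarrow> x = y" by (simp add: vec_eq_iff)

lemma measurable_vec_nth_torus: 
  fixes u :: "real^3 \<Rightarrow> real^3"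
  shows "u \<in> borel_measurable torus \<Longrightarrow> (\<lambda>x. u x $ j) \<in> borel_measurable torus"
  by (rule borel_measurable_continuous_on[of "\<lambda>y. y $ j"]) (auto intro!: continuous_intros)

lemma L2_field_integrable:
  assumes "L2_field u" shows "integrable torus (\<lambda>x. u x $ j)"
proof (rule Bochner_Integration.integrable_bound)
  show "integrable torus (\<lambda>x. 1 + (norm (u x))\<^sup>2)"
    using assms continuous_integrable_torus[of "\<lambda>x. 1 :: real"] by (simp add: L2_field_def)
  show "(\<lambda>x. u x $ j) \<in> borel_measurable torus"
    using assms by (auto simp: L2_field_def intro: measurable_vec_nth_torus)
  have "\<bar>u x $ j\<bar> \<le> 1 + (norm (u x))\<^sup>2" for x
  proof -
    have "\<bar>u x $ j\<bar> \<le> norm (u x)" by (rule component_le_norm_cart)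
    also have "t \<le> 1 + t\<^sup>2" for t :: real
      using zero_le_power2[of "t - 1 / 2"] by (simp add: power2_eq_square algebra_simps)
    finally show ?thesis .
  qed
  then show "AE x in torus. norm (u x $ j) \<le> norm (1 + (norm (u x))\<^sup>2)" by (intro AE_I2) simp
qed

lemma integrable_mult_wave:
  assumes "integrable torus (\<lambda>x. f x)"
  shows "integrable torus (\<lambda>x. complex_of_real (f x) * wave k x)"
  by (rule integrable_torus_mult_bounded[where B = 1]) (use assms in auto)

lemma fourier_diff:
  assumes "\<And>j. integrable torus (\<lambda>x. u x $ j)" "\<And>j. integrable torus (\<lambda>x. v x $ j)"
  shows "fourier (\<lambda>x. u x - v x) k = fourier u k - fourier v k"
  by (rule vec_eqI_cart)
     (simp add: fourier_component left_diff_distrib integrable_mult_wave assms)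

lemma fourier_scaleR: "fourier (\<lambda>x. c *\<^sub>R u x) k = c *\<^sub>R fourier u k"
proof (rule vec_eqI_cart)
  fix j
  have "(LINT x|torus. complex_of_real c * (complex_of_real (u x $ j) * wave (- k) x)) =
    complex_of_real c * (LINT x|torus. complex_of_real (u x $ j) * wave (- k) x)"
    by (rule integral_mult_right_zero)
  then show "fourier (\<lambda>x. c *\<^sub>R u x) k $ j = (c *\<^sub>R fourier u k) $ j"
    unfolding vector_scaleR_component fourier_component real_scaleR_def of_real_mult
      mult.assoc scaleR_conv_of_real[of c "LINT x|torus. f x" for f] .
qed

lemma fourier_minus: "fourier (\<lambda>x. - u x) k = - fourier u k"
  by (rule vec_eqI_cart) (simp add: fourier_component)

lemma fourier_hermitian: "fourier u (- k) $ j = cnj (fourier u k $ j)"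
proof -
  have "(LINT x|torus. cnj (complex_of_real (u x $ j) * wave (- k) x)) = cnj (LINT x|torus. complex_of_real (u x $ j) * wave (- k) x)"
    by (rule integral_bounded_linear'[OF bounded_linear_cnj bounded_linear_cnj]) simp
  then show ?thesis by (simp add: fourier_component)
qed

lemma continuous_vfseries: "(\<And>j. abssummable (a j)) \<Longrightarrow> continuous_on UNIV (vfseries a)"
  unfolding vfseries_def[abs_def] by (intro continuous_intros continuous_fseries)

lemma periodic_vfseries: "periodic (vfseries a)"
  using periodic_fseries by (simp add: periodic_def vfseries_def)

lemma L2_field_continuous:
  fixes u :: "real^3 \<Rightarrow> real^3"
  shows "continuous_on UNIV u \<Longrightarrow> periodic u \<Longrightarrow> L2_field u"
  unfolding L2_field_def
  by (intro conjI continuous_measurable_torus continuous_integrable_torus continuous_on_power continuous_on_norm)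

lemma fourier_vfseries:
  assumes "\<And>j. abssummable (a j)" "\<And>j. hermitian (a j)"
  shows "fourier (vfseries a) k = (\<chi> j. a j k)"
  by (rule vec_eqI_cart) (simp add: fourier_component vfseries_def fourier_coeff_fseries assms)

lemma LINT_vfseries:
  assumes "\<And>j. abssummable (a j)" "\<And>j. hermitian (a j)" "\<And>j. a j 0 = 0"
  shows "(LINT x|torus. vfseries a x) = 0"
proof (rule vec_eqI_cart)
  fix j
  have i: "integrable torus (vfseries a)" by (intro continuous_integrable_torus continuous_vfseries assms)
  have "(LINT x|torus. vfseries a x) $ j = (LINT x|torus. vfseries a x $ j)"
    by (rule integral_bounded_linear[OF bounded_linear_vec_nth i, symmetric])
  also have "\<dots> = (LINT x|torus. fseries (a j) x)" by (simp add: vfseries_def)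
  also have "complex_of_real \<dots> = a j 0"
    using fourier_coeff_fseries[of "a j" 0] assms by simp
  finally show "(LINT x|torus. vfseries a x) $ j = 0 $ j" using assms by simp
qed

text \<open>Uniqueness of Fourier coefficients, applied to each component of the difference. This is
  the bridge from a class modulo null sets to its continuous representative.\<close>

lemma L2_field_eq_vfseries:
  assumes u: "L2_field u" and a: "\<And>j. abssummable (a j)" "\<And>j. hermitian (a j)"
    and f: "\<And>j k. fourier u k $ j = a j k"
  shows "AE x in torus. vfseries a x = u x"
proof -
  have "AE x in torus. u x $ j - fseries (a j) x = 0" for j
  proof (rule fourier_uniqueness)
    have iu: "integrable torus (\<lambda>x. u x $ j)" by (rule L2_field_integrable[OF u])
    have ia: "integrable torus (fseries (a j))" by (intro continuous_integrable_torus continuous_fseries a)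
    show "integrable torus (\<lambda>x. u x $ j - fseries (a j) x)" using iu ia by simp
    fix k
    have "(LINT x|torus. complex_of_real (u x $ j - fseries (a j) x) * wave k x) =
      fourier u (- k) $ j - (LINT x|torus. complex_of_real (fseries (a j) x) * wave k x)"
      using integrable_mult_wave[OF iu, of k] integrable_mult_wave[OF ia, of k]
      by (simp add: fourier_component left_diff_distrib)
    also have "\<dots> = 0" using fourier_coeff_fseries[OF a, of j "- k"] f by simp
    finally show "(LINT x|torus. complex_of_real (u x $ j - fseries (a j) x) * wave k x) = 0" .
  qed
  then have "AE x in torus. \<forall>j\<in>UNIV. u x $ j - fseries (a j) x = 0"
    by (subst AE_finite_all[OF finite]) blast
  then show ?thesis by eventually_elim (simp add: vec_eq_iff vfseries_def)
qed

lemma cont_rep_eqI: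
  assumes "continuous_on UNIV v" "periodic v" "AE x in torus. v x = u x"
  shows "cont_rep u = v"
  unfolding cont_rep_def
proof (rule the_equality)
  fix w assume w: "continuous_on UNIV w \<and> periodic w \<and> (AE x in torus. w x = u x)"
  then have "AE x in torus. w x = u x" by blast
  then have "AE x in torus. w x = v x" using assms(3) by eventually_elim simp
  then show "w = v" using w assms by (intro continuous_AE_eq) auto
qed (use assms in auto)

lemma cont_rep_vfseries:
  assumes "L2_field u" and a: "\<And>j. abssummable (a j)" "\<And>j. hermitian (a j)"
    and f: "\<And>j k. fourier u k $ j = a j k"
  shows "cont_rep u = vfseries a"
  by (intro cont_rep_eqI continuous_vfseries periodic_vfseries L2_field_eq_vfseries assms)

lemma jacobian_vfseries:
  assumes c: "cont_rep u = vfseries a" and a: "\<And>j. abssummable1 (a j)"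
  shows "jacobian u x = (\<chi> j i. fseries (fdiff i (a j)) x)"
proof -
  have "(vfseries a has_derivative (\<lambda>h. (\<chi> j. \<Sum>i\<in>UNIV. h $ i * fseries (fdiff i (a j)) x))) (at x)"
  proof (rule iffD2[OF has_derivative_componentwise_within], rule ballI)
    fix b :: "real^3" assume "b \<in> Basis"
    then obtain j where b: "b = axis j 1" by (auto simp: Basis_vec_def)
    show "((\<lambda>x. vfseries a x \<bullet> b) has_derivative (\<lambda>h. (\<chi> j. \<Sum>i\<in>UNIV. h $ i * fseries (fdiff i (a j)) x) \<bullet> b)) (at x)"
      using has_derivative_fseries[OF a[of j], of x] by (simp add: b inner_axis vfseries_def)
  qed
  then have fd: "frechet_derivative (vfseries a) (at x) = (\<lambda>h. (\<chi> j. \<Sum>i\<in>UNIV. h $ i * fseries (fdiff i (a j)) x))"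
    by (rule frechet_derivative_at[symmetric])
  have ax: "(\<Sum>l\<in>UNIV. axis i (1::real) $ l * F l) = F i" for i :: 3 and F
  proof -
    have "axis i (1::real) $ l * F l = (if l = i then F i else 0)" for l by (simp add: axis_def)
    then show ?thesis by simp
  qed
  show ?thesis unfolding jacobian_def c matrix_def fd by (simp add: vec_eq_iff ax)
qed

lemma advection_vfseries:
  assumes c: "cont_rep u = vfseries a" and a: "\<And>j. abssummable1 (a j)"
  shows "advection u x = (\<chi> j. \<Sum>i\<in>UNIV. fseries (a i) x * fseries (fdiff i (a j)) x)"
  unfolding advection_def jacobian_vfseries[OF assms] c
  by (simp add: matrix_vector_mult_def vfseries_def mult.commute vec_eq_iff)

lemma fourier_advection:
  assumes c: "cont_rep u = vfseries a" and a: "\<And>j. abssummable1 (a j)" "\<And>j. hermitian (a j)"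
  shows "fourier (advection u) l $ j = (\<Sum>i\<in>UNIV. \<Sum>\<^sub>\<infinity>k. a i k * fdiff i (a j) (l - k))"
proof -
  have cn: "continuous_on UNIV (\<lambda>x. fseries (a i) x * fseries (fdiff i (a j)) x)" for i
    by (intro continuous_intros continuous_fseries abssummable1_imp abssummable_fdiff a)
  have "fourier (advection u) l $ j =
    (LINT x|torus. (\<Sum>i\<in>UNIV. complex_of_real (fseries (a i) x * fseries (fdiff i (a j)) x) * wave (- l) x))"
    unfolding fourier_component advection_vfseries[OF c a(1)] by (simp add: sum_distrib_right)
  also have "\<dots> = (\<Sum>i\<in>UNIV. LINT x|torus. complex_of_real (fseries (a i) x * fseries (fdiff i (a j)) x) * wave (- l) x)"
    by (intro Bochner_Integration.integral_sum integrable_mult_wave continuous_integrable_torus cn)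
  also have "\<dots> = (\<Sum>i\<in>UNIV. \<Sum>\<^sub>\<infinity>k. a i k * fdiff i (a j) (l - k))"
    by (intro sum.cong refl fourier_coeff_fseries_product abssummable1_imp abssummable_fdiff hermitian_fdiff a)
  finally show ?thesis .
qed

section \<open>Geometry of the frequency set\<close>

text \<open>The scalar product of k with \<open>sigma\<close>, kept as an integer. It is additive
  and invariant under permutation of entries, so it reads off the level of a frequency.\<close>

definition csum :: "int ^ 3 \<Rightarrow> int" where
  "csum k = (\<Sum>i\<in>UNIV. k $ i)"

lemma csum_simps [simp]: "csum (k + l) = csum k + csum l" "csum (- k) = - csum k" "csum (k - l) = csum k - csum l"
  by (simp_all add: csum_def sum.distrib sum_negf sum_subtractf)

lemma norm_rvec_sq: "(norm (rvec k))\<^sup>2 = real_of_int (\<Sum>i\<in>UNIV. (k $ i)\<^sup>2)"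
  unfolding power2_norm_eq_inner inner_vec_def by (simp add: power2_eq_square)

lemma rvec_inner_sigma: "rvec k \<bullet> rvec sigma = real_of_int (csum k)"
  by (simp add: inner_vec_def csum_def sigma_def sum_3)

lemma perms_invariants:
  assumes "k \<in> perms v"
  shows "csum k = csum v" "(\<Sum>i\<in>UNIV. (k $ i)\<^sup>2) = (\<Sum>i\<in>UNIV. (v $ i)\<^sup>2)"
proof -
  obtain p where k: "k = (\<chi> i. v $ p i)" and p: "bij p" using assms by (auto simp: perms_def)
  show "csum k = csum v" "(\<Sum>i\<in>UNIV. (k $ i)\<^sup>2) = (\<Sum>i\<in>UNIV. (v $ i)\<^sup>2)"
    using sum.reindex_bij_betw[OF p, of "\<lambda>i. v $ i"] sum.reindex_bij_betw[OF p, of "\<lambda>i. (v $ i)\<^sup>2"]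
    by (simp_all add: k csum_def)
qed

text \<open>The vectors added to the multiple of \<open>sigma\<close> have entry sum 0, so they
  leave \<open>csum\<close> alone and add orthogonally: the squared norm is 3 * 4^n plus 2 * 9^m for
  even n and plus 6 * 9^m for odd n, where m = n div 2. Then 9^m \<le> 16^m gives the upper bound,
  and positivity of 9^m the strict lower one.\<close>

lemma shell_invariants:
  assumes "k \<in> Mplus_shell n"
  shows "csum k = 3 * 2 ^ n" "3 * 4 ^ n < (norm (rvec k))\<^sup>2" "(norm (rvec k))\<^sup>2 \<le> 5 * 4 ^ n"
proof -
  define m where "m = n div 2"
  have p: "(9::int) ^ m \<le> 16 ^ m" "(9::int) ^ m > 0" "(16::int) ^ m > 0" by (auto intro: power_mono)
  have p': "3 * (9::int) ^ m \<le> 4 * 16 ^ m" using p by linarith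
  have sq: "(a ^ m)\<^sup>2 = (a\<^sup>2) ^ m" for a :: int
    by (simp only: power_mult[symmetric] mult.commute[of m 2])
  have 2: "(2::int) ^ (2 * m) = 4 ^ m" "(4::int) ^ (2 * m) = 16 ^ m" by (simp_all add: power_mult)
  have e: "(3 ^ m)\<^sup>2 = (9::int) ^ m" "(2 ^ (2 * m))\<^sup>2 = (16::int) ^ m" "(2 ^ (2 * m + 1))\<^sup>2 = 4 * (16::int) ^ m"
    "(4::int) ^ (2 * m) = 16 ^ m" "(4::int) ^ (2 * m + 1) = 4 * 16 ^ m"
    unfolding power_add power_mult_distrib 2 sq by simp_all
  have "csum k = 3 * 2 ^ n \<and> 3 * 4 ^ n < (\<Sum>i\<in>UNIV. (k $ i)\<^sup>2) \<and> (\<Sum>i\<in>UNIV. (k $ i)\<^sup>2) \<le> 5 * 4 ^ n"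
  proof (cases "even n")
    case True
    then have n: "n = 2 * m" by (simp add: m_def)
    have kf: "k \<in> perms (kfreq m)" using assms True by (simp add: Mplus_shell_def m_def)
    have "csum (kfreq m) = 3 * 2 ^ n" by (simp add: csum_def kfreq_def sigma_def sum_3 n)
    moreover have "(\<Sum>i\<in>UNIV. (kfreq m $ i)\<^sup>2) = 3 * (2 ^ (2 * m))\<^sup>2 + 2 * (3 ^ m)\<^sup>2"
      by (simp add: kfreq_def sigma_def sum_3) (simp add: power2_eq_square algebra_simps)
    ultimately show ?thesis using perms_invariants[OF kf] p by (simp add: e n)
  next
    case False
    then have n: "n = 2 * m + 1" unfolding m_def by presburger
    have kf: "k \<in> perms (hfreq m) \<or> k \<in> perms (jfreq m)" using assms False by (auto simp: Mplus_shell_def m_def)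
    have "csum (hfreq m) = 3 * 2 ^ n" "csum (jfreq m) = 3 * 2 ^ n"
      by (simp_all add: csum_def hfreq_def jfreq_def sigma_def sum_3 n)
    moreover have "(\<Sum>i\<in>UNIV. (hfreq m $ i)\<^sup>2) = 3 * (2 ^ (2 * m + 1))\<^sup>2 + 6 * (3 ^ m)\<^sup>2"
      "(\<Sum>i\<in>UNIV. (jfreq m $ i)\<^sup>2) = 3 * (2 ^ (2 * m + 1))\<^sup>2 + 6 * (3 ^ m)\<^sup>2"
      by (simp_all add: hfreq_def jfreq_def sigma_def sum_3 del: power_Suc) (simp_all add: power2_eq_square algebra_simps)
    ultimately show ?thesis using kf perms_invariants[of k "hfreq m"] perms_invariants[of k "jfreq m"] p p'
      unfolding n e by (elim disjE) simp_all
  qed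
  then have *: "csum k = 3 * 2 ^ n" "3 * 4 ^ n < (\<Sum>i\<in>UNIV. (k $ i)\<^sup>2)" "(\<Sum>i\<in>UNIV. (k $ i)\<^sup>2) \<le> 5 * 4 ^ n"
    by auto
  show "csum k = 3 * 2 ^ n" by fact
  have "real_of_int (3 * 4 ^ n) < real_of_int (\<Sum>i\<in>UNIV. (k $ i)\<^sup>2)" using *(2) by (simp only: of_int_less_iff)
  then show "3 * 4 ^ n < (norm (rvec k))\<^sup>2" unfolding norm_rvec_sq by simp
  have "real_of_int (\<Sum>i\<in>UNIV. (k $ i)\<^sup>2) \<le> real_of_int (5 * 4 ^ n)" using *(3) by (simp only: of_int_le_iff)
  then show "(norm (rvec k))\<^sup>2 \<le> 5 * 4 ^ n" unfolding norm_rvec_sq by simp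
qed

definition Mlevel :: "nat \<Rightarrow> (int ^ 3) set" where
  "Mlevel n = Mplus_shell n \<union> uminus ` Mplus_shell n"

lemma Mfreq_eq: "Mfreq = (\<Union>n. Mlevel n)"
  by (auto simp: Mfreq_def Mplus_def Mlevel_def)

lemma Mfreq_uminus [simp]: "- k \<in> Mfreq \<longleftrightarrow> k \<in> Mfreq"
proof -
  have "- k \<in> Mfreq" if k: "k \<in> Mfreq" for k
  proof (cases "k \<in> Mplus")
    case True
    then show ?thesis unfolding Mfreq_def by (intro UnI2 imageI)
  next
    case False
    then obtain l where "k = - l" "l \<in> Mplus" using k unfolding Mfreq_def by blast
    then show ?thesis unfolding Mfreq_def by (intro UnI1) simp
  qed
  then show ?thesis by (metis minus_minus)
qed

lemma Mlevel_invariants: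
  assumes "k \<in> Mlevel n"
  shows "\<bar>csum k\<bar> = 3 * 2 ^ n" "3 * 4 ^ n < (norm (rvec k))\<^sup>2" "(norm (rvec k))\<^sup>2 \<le> 5 * 4 ^ n"
  using assms shell_invariants by (auto simp: Mlevel_def)

lemma Mlevel_norm:
  assumes "k \<in> Mlevel n"
  shows "2 ^ n \<le> norm (rvec k)" "norm (rvec k) \<le> 3 * 2 ^ n"
proof -
  have 4: "(4::real) ^ n = (2 ^ n)\<^sup>2" by (simp add: power2_eq_square flip: power_mult_distrib)
  have 3: "(3 * 2 ^ n)\<^sup>2 = 9 * (2 ^ n :: real)\<^sup>2" unfolding power_mult_distrib by simp
  have "(2 ^ n)\<^sup>2 \<le> (norm (rvec k))\<^sup>2" "(norm (rvec k))\<^sup>2 \<le> (3 * 2 ^ n)\<^sup>2"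
    using Mlevel_invariants(2,3)[OF assms] zero_le_power2[of "2 ^ n :: real"] unfolding 4 3 by linarith+
  then show "2 ^ n \<le> norm (rvec k)" "norm (rvec k) \<le> 3 * 2 ^ n"
    by (auto intro: power2_le_imp_le)
qed

lemma Mfreq_norm_ge_1: "k \<in> Mfreq \<Longrightarrow> 1 \<le> norm (rvec k)"
proof -
  assume "k \<in> Mfreq"
  then obtain n where "k \<in> Mlevel n" by (auto simp: Mfreq_eq)
  from Mlevel_norm(1)[OF this] show ?thesis using one_le_power[of "2::real" n] by linarith
qed

lemma zero_notin_Mfreq [simp]: "0 \<notin> Mfreq"
  using Mfreq_norm_ge_1[of 0] by auto

text \<open>Since $|k \cdot \sigma| = 3 \cdot 2^n$ at level \<open>n\<close>, a triad of frequencies gives a relation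
  $\pm 2^a \pm 2^b = \pm 2^c$, which forces neighbouring levels. So all interactions are between
  comparable frequencies, and the nonlinearity loses no derivative.\<close>

lemma power2_sum_level:
  fixes x y z :: int
  assumes "\<bar>x\<bar> = 2 ^ a" "\<bar>y\<bar> = 2 ^ b" "\<bar>z\<bar> = 2 ^ c" "x + y = z"
  shows "a \<le> b + 1"
proof (rule ccontr)
  assume "\<not> a \<le> b + 1"
  then obtain d where d: "a = b + 2 + d" using less_eqE[of "b + 2" a] by force
  define B :: int where "B = 2 ^ b"
  define D :: int where "D = 2 ^ d"
  have pos: "B > 0" "D > 0" by (auto simp: B_def D_def)
  have BD: "B \<le> B * D" using pos by simp
  have "2 ^ a = 4 * (B * D)" by (simp add: d B_def D_def power_add)
  then have x: "\<bar>x\<bar> = 4 * (B * D)" "\<bar>y\<bar> = B" using assms by (auto simp: B_def)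
  \<comment> \<open>2 B D, 4 B D and 8 B D are 2^(a-1), 2^a and 2^(a+1). A summand y of at most a
    quarter of the size of x leaves |z| strictly between the outer two, and y being nonzero keeps it
    off the middle one, so |z| cannot be a power of two.\<close>
  have z: "2 * (B * D) < \<bar>z\<bar>" "\<bar>z\<bar> < 8 * (B * D)" "\<bar>z\<bar> \<noteq> 4 * (B * D)"
    using x pos BD assms(4) by linarith+
  have e: "2 * (B * D) = 2 ^ (b + d + 1)" "8 * (B * D) = 2 ^ (b + d + 3)" "4 * (B * D) = 2 ^ (b + d + 2)"
    by (simp_all add: B_def D_def power_add)
  have pw: "(2::int) ^ (b + d + 1) < 2 ^ c" "(2::int) ^ c < 2 ^ (b + d + 3)"
    using z(1,2) unfolding e assms(3) .
  have "b + d + 1 < c" using pw(1) by (rule power_less_imp_less_exp[rotated]) simp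
  moreover have "c < b + d + 3" using pw(2) by (rule power_less_imp_less_exp[rotated]) simp
  moreover have "c \<noteq> b + d + 2" using z(3) unfolding e assms(3) by blast
  ultimately show False by simp
qed

lemma Mfreq_triad_level:
  assumes "p \<in> Mlevel a" "q \<in> Mlevel b" "p + q \<in> Mfreq"
  shows "a \<le> b + 1"
proof -
  obtain c where c: "p + q \<in> Mlevel c" using assms by (auto simp: Mfreq_eq)
  \<comment> \<open>Dividing out the common factor 3 turns the entry sums into signed powers of
    two.\<close>
  have "3 dvd csum k" if "\<bar>csum k\<bar> = 3 * 2 ^ n" for k n
    using that by (metis dvd_abs_iff dvd_triv_left)
  then obtain x y z where xyz: "csum p = 3 * x" "csum q = 3 * y" "csum (p + q) = 3 * z"
    using Mlevel_invariants(1) assms c by (meson dvdE)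
  show ?thesis
    by (rule power2_sum_level[of x a y b z c])
      (use xyz Mlevel_invariants(1)[OF assms(1)] Mlevel_invariants(1)[OF assms(2)] Mlevel_invariants(1)[OF c] in \<open>auto simp: abs_mult\<close>)
qed

text \<open>The constant is 2 * 3: the level of p exceeds that of q by at most one, and norms at
  level n lie between 2^n and 3 * 2^n.\<close>

lemma Mfreq_triad:
  assumes "p \<in> Mfreq" "q \<in> Mfreq" "p + q \<in> Mfreq"
  shows "norm (rvec p) \<le> 6 * norm (rvec q)"
proof -
  obtain a b where a: "p \<in> Mlevel a" and b: "q \<in> Mlevel b" using assms by (auto simp: Mfreq_eq)
  have "(2::real) ^ a \<le> 2 ^ (b + 1)"
    using Mfreq_triad_level[OF a b assms(3)] by (intro power_increasing) auto
  then show ?thesis using Mlevel_norm[OF a] Mlevel_norm[OF b] by simp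
qed

lemma Mfreq_triad_sum:
  assumes "p \<in> Mfreq" "q \<in> Mfreq" "p + q \<in> Mfreq"
  shows "norm (rvec (p + q)) \<le> 6 * norm (rvec p)"
  using Mfreq_triad[of "p + q" "- p"] assms by simp

text \<open>27 counts all maps of the index type to itself, bijective or not. The later bounds grow
  from it: 54 for two orbits, 108 for both signs, 324 for three neighbouring levels.\<close>

lemma perms_finite: "finite (perms v)" "card (perms v) \<le> 27"
proof -
  define P where "P = (\<lambda>p. \<chi> i. v $ p i) ` (UNIV :: (3 \<Rightarrow> 3) set)"
  have sub: "perms v \<subseteq> P" by (auto simp: perms_def P_def)
  have fin: "finite P" by (simp add: P_def)
  have "card P \<le> 27"
    unfolding P_def using card_image_le[of "UNIV :: (3 \<Rightarrow> 3) set" "\<lambda>p. \<chi> i. v $ p i"] by (simp add: card_fun)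
  then show "card (perms v) \<le> 27" using card_mono[OF fin sub] by linarith
  show "finite (perms v)" using sub fin by (rule finite_subset)
qed

lemma Mlevel_finite: "finite (Mlevel n)" "card (Mlevel n) \<le> 108"
proof -
  have "finite (Mplus_shell n) \<and> card (Mplus_shell n) \<le> 54"
  proof (cases "even n")
    case True
    then show ?thesis using perms_finite[of "kfreq (n div 2)"] by (simp add: Mplus_shell_def)
  next
    case False
    then show ?thesis
      using perms_finite[of "hfreq (n div 2)"] perms_finite[of "jfreq (n div 2)"]
        card_Un_le[of "perms (hfreq (n div 2))" "perms (jfreq (n div 2))"]
      by (simp add: Mplus_shell_def)
  qed
  then have s: "finite (Mplus_shell n)" "card (Mplus_shell n) \<le> 54" by auto
  then show "finite (Mlevel n)" by (simp add: Mlevel_def)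
  show "card (Mlevel n) \<le> 108"
    using card_Un_le[of "Mplus_shell n" "uminus ` Mplus_shell n"] card_image_le[OF s(1), of uminus] s(2)
    by (simp add: Mlevel_def)
qed

text \<open>The frequencies p that interact with k - p to feed mode k. Convolutions at k reduce to
  this set, which is finite for k in \<open>Mfreq\<close>.\<close>

definition partners :: "int ^ 3 \<Rightarrow> (int ^ 3) set" where
  "partners k = {p \<in> Mfreq. k - p \<in> Mfreq}"

lemma Mfreq_neighbours_finite:
  assumes "q \<in> Mfreq"
  shows "finite {p \<in> Mfreq. p + q \<in> Mfreq}" "card {p \<in> Mfreq. p + q \<in> Mfreq} \<le> 324"
proof -
  obtain b where b: "q \<in> Mlevel b" using assms by (auto simp: Mfreq_eq)
  \<comment> \<open>For b = 0 truncated subtraction repeats level 0, which is harmless in a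
    union.\<close>
  have sub: "{p \<in> Mfreq. p + q \<in> Mfreq} \<subseteq> Mlevel (b - 1) \<union> (Mlevel b \<union> Mlevel (b + 1))"
  proof
    fix p assume p: "p \<in> {p \<in> Mfreq. p + q \<in> Mfreq}"
    then obtain a where a: "p \<in> Mlevel a" by (auto simp: Mfreq_eq)
    have "a \<le> b + 1" "b \<le> a + 1"
      using Mfreq_triad_level[OF a b] Mfreq_triad_level[OF b a] p by (auto simp: add.commute)
    then have "a = b - 1 \<or> a = b \<or> a = b + 1" by linarith
    then show "p \<in> Mlevel (b - 1) \<union> (Mlevel b \<union> Mlevel (b + 1))" using a by auto
  qed
  then show "finite {p \<in> Mfreq. p + q \<in> Mfreq}" by (rule finite_subset) (simp add: Mlevel_finite)
  have "card (Mlevel (b - 1) \<union> (Mlevel b \<union> Mlevel (b + 1))) \<le> card (Mlevel (b - 1)) + (card (Mlevel b) + card (Mlevel (b + 1)))"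
    by (intro order_trans[OF card_Un_le] add_mono order_refl)
  also have "\<dots> \<le> 324" using Mlevel_finite(2)[of "b - 1"] Mlevel_finite(2)[of b] Mlevel_finite(2)[of "b + 1"] by linarith
  finally show "card {p \<in> Mfreq. p + q \<in> Mfreq} \<le> 324"
    using card_mono[OF _ sub] Mlevel_finite(1) by (meson finite_UnI order_trans)
qed

lemma partners_finite:
  assumes "k \<in> Mfreq"
  shows "finite (partners k)" "card (partners k) \<le> 324"
proof -
  have b: "bij_betw uminus {p \<in> Mfreq. p + k \<in> Mfreq} (partners k)"
    by (rule bij_betw_byWitness[where f' = uminus])
      (auto simp: partners_def add.commute)
  show "finite (partners k)" "card (partners k) \<le> 324"
    using bij_betw_finite[OF b] bij_betw_same_card[OF b] Mfreq_neighbours_finite[OF assms] by auto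
qed

text \<open>Each level contributes at most 108 r^n with r = 2^(-e) < 1, so a geometric series
  dominates. On the full lattice an exponent above 3 would be required; here lacunarity admits every
  positive one.\<close>

lemma summable_norm_powr_Mfreq:
  assumes e: "e > 0"
  shows "(\<lambda>k. norm (rvec k) powr (- e)) summable_on Mfreq"
proof (rule nonneg_bounded_partial_sums_imp_summable_on)
  define r where "r = (2::real) powr (- e)"
  have r: "0 < r" "r < 1" using e by (auto simp: r_def intro: powr_less_one)
  have lev: "(\<Sum>k\<in>Mlevel n. norm (rvec k) powr (- e)) \<le> 108 * r ^ n" for n
  proof -
    have "norm (rvec k) powr (- e) \<le> r ^ n" if "k \<in> Mlevel n" for k
    proof -
      have "norm (rvec k) powr (- e) \<le> (2 ^ n) powr (- e)"
        using Mlevel_norm(1)[OF that] e by (intro powr_mono2') auto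
      also have "\<dots> = r ^ n" by (simp add: r_def powr_powr powr_realpow[symmetric] mult.commute)
      finally show ?thesis .
    qed
    then have "(\<Sum>k\<in>Mlevel n. norm (rvec k) powr (- e)) \<le> real (card (Mlevel n)) * r ^ n"
      by (rule sum_bounded_above)
    also have "\<dots> \<le> 108 * r ^ n" using Mlevel_finite(2)[of n] r by (intro mult_right_mono) auto
    finally show ?thesis .
  qed
  have bound: "sum (\<lambda>k. norm (rvec k) powr (- e)) F \<le> 108 * (1 / (1 - r))" if F: "finite F" "F \<subseteq> Mfreq" for F
  proof -
    have "\<exists>N. F \<subseteq> (\<Union>n<N. Mlevel n)" using F
    proof (induction F rule: finite_induct)
      case (insert k F)
      then obtain N n where "F \<subseteq> (\<Union>n<N. Mlevel n)" "k \<in> Mlevel n" by (auto simp: Mfreq_eq)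
      then have "insert k F \<subseteq> (\<Union>n<max N (Suc n). Mlevel n)" by (fastforce simp: less_max_iff_disj)
      then show ?case by blast
    qed simp
    then obtain N where N: "F \<subseteq> (\<Union>n<N. Mlevel n)" by blast
    have "sum (\<lambda>k. norm (rvec k) powr (- e)) F \<le> sum (\<lambda>k. norm (rvec k) powr (- e)) (\<Union>n<N. Mlevel n)"
      by (rule sum_mono2[OF _ N]) (auto simp: Mlevel_finite)
    also have "\<dots> = (\<Sum>n<N. \<Sum>k\<in>Mlevel n. norm (rvec k) powr (- e))"
    proof (rule sum.UNION_disjoint)
      show "\<forall>i\<in>{..<N}. \<forall>j\<in>{..<N}. i \<noteq> j \<longrightarrow> Mlevel i \<inter> Mlevel j = {}"
      proof (intro ballI impI)
        fix i j :: nat assume "i \<noteq> j"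
        then show "Mlevel i \<inter> Mlevel j = {}"
          by (auto dest!: Mlevel_invariants(1))
      qed
    qed (auto simp: Mlevel_finite)
    also have "\<dots> \<le> (\<Sum>n<N. 108 * r ^ n)" by (intro sum_mono lev)
    also have "\<dots> \<le> (\<Sum>n. 108 * r ^ n)" using r by (intro sum_le_suminf summable_mult summable_geometric) auto
    also have "\<dots> = 108 * (1 / (1 - r))" using r by (simp add: suminf_mult summable_geometric suminf_geometric)
    finally show ?thesis .
  qed
  show "\<forall>\<^sub>F X in finite_subsets_at_top Mfreq. sum (\<lambda>k. norm (rvec k) powr (- e)) X \<le> 108 * (1 / (1 - r))"
    by (rule eventually_finite_subsets_at_top_weakI) (rule bound)
qed simp

text \<open>If k were parallel to \<open>sigma\<close>, equality would hold in Cauchy-Schwarz and 3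
  |k|^2 would equal 9 * 4^n, against the strict lower bound on |k|^2. Hence \<open>vdir k\<close> is
  a genuine unit vector.\<close>

lemma perp_sigma_nonzero: "k \<in> Mfreq \<Longrightarrow> perp_sigma k \<noteq> 0"
proof
  assume k: "k \<in> Mfreq" and z: "perp_sigma k = 0"
  obtain n where n: "k \<in> Mlevel n" using k by (auto simp: Mfreq_eq)
  have 4: "(4::real) ^ n = (2 ^ n)\<^sup>2" by (simp add: power2_eq_square flip: power_mult_distrib)
  define N where "N = (norm (rvec k))\<^sup>2"
  have N: "N > 3 * 4 ^ n" using Mlevel_invariants(2)[OF n] by (simp add: N_def)
  have N0: "N > 0" using N zero_less_power[of "4::real" n] by linarith
  have "rvec sigma \<bullet> rvec sigma = 3" by (simp add: inner_vec_def sigma_def sum_3)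
  moreover have "rvec sigma = (real_of_int (csum k) / N) *\<^sub>R rvec k"
    using z by (simp add: perp_sigma_def rvec_inner_sigma N_def)
  ultimately have "3 = (real_of_int (csum k) / N) * real_of_int (csum k)"
    by (metis inner_scaleR_left rvec_inner_sigma)
  then have "3 * N = (real_of_int (csum k))\<^sup>2" using N0 by (simp add: power2_eq_square field_simps)
  also have "\<dots> = (real_of_int \<bar>csum k\<bar>)\<^sup>2" by simp
  also have "\<dots> = 9 * 4 ^ n" unfolding Mlevel_invariants(1)[OF n] by (simp add: 4 power_mult_distrib)
  finally show False using N by simp
qed

lemma norm_vdir: "k \<in> Mfreq \<Longrightarrow> norm (vdir k) = 1"
  using perp_sigma_nonzero by (simp add: vdir_def)

lemma norm_vdir_le: "norm (vdir k) \<le> 1"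
  by (simp add: vdir_def)

text \<open>This is incompressibility on the Fourier side: fields in the constraint space are
  divergence free.\<close>

lemma vdir_orthogonal: "vdir k \<bullet> rvec k = 0"
proof (cases "rvec k = 0")
  case False
  then have "perp_sigma k \<bullet> rvec k = 0"
    unfolding perp_sigma_def inner_diff_left inner_scaleR_left power2_norm_eq_inner by (simp add: inner_commute)
  then show ?thesis by (simp add: vdir_def)
qed simp

lemma vdir_uminus [simp]: "vdir (- k) = vdir k"
  by (simp add: vdir_def perp_sigma_def)

section \<open>The Hilbert space of coefficient sequences\<close>

text \<open>Real fields in the constraint space correspond to sequences \<open>f\<close> where \<open>f k\<close> is the coefficient
  along \<open>vdir k\<close>, multiplied by a Sobolev weight so that the norm is that of $\ell^2$.\<close>

definition mseq_set :: "(int ^ 3 \<Rightarrow> complex) set" where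
  "mseq_set = {f. hermitian f \<and> (\<forall>k. k \<notin> Mfreq \<longrightarrow> f k = 0) \<and> (\<lambda>k. (norm (f k))\<^sup>2) summable_on UNIV}"

typedef mseq = mseq_set
  morphisms coef mk_mseq
  by (rule exI[of _ "\<lambda>_. 0"]) (simp add: mseq_set_def hermitian_def)

lemma coef_props:
  "hermitian (coef x)" "k \<notin> Mfreq \<Longrightarrow> coef x k = 0" "(\<lambda>k. (norm (coef x k))\<^sup>2) summable_on UNIV"
  using coef[of x] by (auto simp: mseq_set_def)

lemma norm_add_sq_le: "(norm (z + w))\<^sup>2 \<le> 2 * (norm z)\<^sup>2 + 2 * (norm (w::complex))\<^sup>2"
proof -
  have "(norm (z + w))\<^sup>2 \<le> (norm z + norm w)\<^sup>2" by (intro power_mono norm_triangle_ineq) auto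
  also have "\<dots> \<le> 2 * (norm z)\<^sup>2 + 2 * (norm w)\<^sup>2"
    using sum_squares_bound[of "norm z" "norm w"] by (simp add: power2_sum)
  finally show ?thesis .
qed

lemma mseq_set_lincomb:
  assumes "f \<in> mseq_set" "g \<in> mseq_set"
  shows "(\<lambda>k. of_real a * f k + of_real b * g k) \<in> mseq_set"
proof -
  have "(\<lambda>k. norm ((norm (of_real a * f k + of_real b * g k))\<^sup>2)) summable_on UNIV"
  proof (rule Infinite_Sum.abs_summable_on_comparison_test')
    show "(\<lambda>k. 2 * a\<^sup>2 * (norm (f k))\<^sup>2 + 2 * b\<^sup>2 * (norm (g k))\<^sup>2) summable_on UNIV"
      using assms by (intro summable_on_add summable_on_cmult_right) (auto simp: mseq_set_def)
    show "norm ((norm (of_real a * f k + of_real b * g k))\<^sup>2) \<le> 2 * a\<^sup>2 * (norm (f k))\<^sup>2 + 2 * b\<^sup>2 * (norm (g k))\<^sup>2" for k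
      using norm_add_sq_le[of "of_real a * f k" "of_real b * g k"] by (simp add: norm_mult power_mult_distrib)
  qed
  then show ?thesis using assms by (auto simp: mseq_set_def hermitian_def)
qed

instantiation mseq :: real_vector
begin

definition zero_mseq :: mseq where "zero_mseq = mk_mseq (\<lambda>_. 0)"
definition plus_mseq :: "mseq \<Rightarrow> mseq \<Rightarrow> mseq" where "plus_mseq x y = mk_mseq (\<lambda>k. coef x k + coef y k)"
definition uminus_mseq :: "mseq \<Rightarrow> mseq" where "uminus_mseq x = mk_mseq (\<lambda>k. - coef x k)"
definition minus_mseq :: "mseq \<Rightarrow> mseq \<Rightarrow> mseq" where "minus_mseq x y = mk_mseq (\<lambda>k. coef x k - coef y k)"
definition scaleR_mseq :: "real \<Rightarrow> mseq \<Rightarrow> mseq" where "scaleR_mseq r x = mk_mseq (\<lambda>k. of_real r * coef x k)"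

lemma coef_simps [simp]:
  "coef 0 k = 0" "coef (x + y) k = coef x k + coef y k" "coef (- x) k = - coef x k"
  "coef (x - y) k = coef x k - coef y k" "coef (r *\<^sub>R x) k = of_real r * coef x k"
  using mseq_set_lincomb[OF coef coef, of 1 x 1 y] mseq_set_lincomb[OF coef coef, of "-1" x 0 x]
    mseq_set_lincomb[OF coef coef, of 1 x "-1" y] mseq_set_lincomb[OF coef coef, of r x 0 x]
    mseq_set_lincomb[OF coef coef, of 0 x 0 x]
  by (simp_all add: zero_mseq_def plus_mseq_def uminus_mseq_def minus_mseq_def scaleR_mseq_def mk_mseq_inverse)

lemma mseq_eqI: "(\<And>k. coef x k = coef y k) \<Longrightarrow> x = y"
  by (metis coef_inject ext)

instance
  by standard (auto intro!: mseq_eqI simp: algebra_simps)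

end

lemma coef_products_summable: "(\<lambda>k. Re (coef x k * cnj (coef y k))) summable_on UNIV"
proof (rule abs_summable_summable, rule Infinite_Sum.abs_summable_on_comparison_test')
  show "(\<lambda>k. (norm (coef x k))\<^sup>2 + (norm (coef y k))\<^sup>2) summable_on UNIV"
    by (intro summable_on_add coef_props)
  show "norm (Re (coef x k * cnj (coef y k))) \<le> (norm (coef x k))\<^sup>2 + (norm (coef y k))\<^sup>2" for k
  proof -
    have "norm (Re (coef x k * cnj (coef y k))) \<le> norm (coef x k * cnj (coef y k))"
      unfolding real_norm_def by (rule abs_Re_le_cmod)
    also have "\<dots> = norm (coef x k) * norm (coef y k)" by (simp add: norm_mult)
    also have "\<dots> \<le> (norm (coef x k))\<^sup>2 + (norm (coef y k))\<^sup>2"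
      using sum_squares_bound[of "norm (coef x k)" "norm (coef y k)"] mult_nonneg_nonneg[OF norm_ge_zero norm_ge_zero, of "coef x k" "coef y k"] by linarith
    finally show ?thesis .
  qed
qed

lemma Re_mult_cnj_self: "Re (z * cnj z) = (norm z)\<^sup>2"
  unfolding complex_norm_square[symmetric] by (simp flip: of_real_power)

instantiation mseq :: real_inner
begin

definition inner_mseq :: "mseq \<Rightarrow> mseq \<Rightarrow> real" where "inner_mseq x y = (\<Sum>\<^sub>\<infinity>k. Re (coef x k * cnj (coef y k)))"
definition norm_mseq :: "mseq \<Rightarrow> real" where "norm_mseq x = sqrt (inner x x)"
definition sgn_mseq :: "mseq \<Rightarrow> mseq" where "sgn_mseq x = x /\<^sub>R norm x"
definition dist_mseq :: "mseq \<Rightarrow> mseq \<Rightarrow> real" where "dist_mseq x y = norm (x - y)"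
definition uniformity_mseq :: "(mseq \<times> mseq) filter" where
  "uniformity_mseq = (INF e\<in>{0<..}. principal {(x, y). dist x y < e})"
definition open_mseq :: "mseq set \<Rightarrow> bool" where
  "open_mseq U = (\<forall>x\<in>U. eventually (\<lambda>(x', y). x' = x \<longrightarrow> y \<in> U) uniformity)"

instance
proof
  fix x y z :: mseq and r :: real
  show "dist x y = norm (x - y)" by (rule dist_mseq_def)
  show "sgn x = x /\<^sub>R norm x" by (rule sgn_mseq_def)
  show "uniformity = (INF e\<in>{0<..}. principal {(x::mseq, y). dist x y < e})" by (rule uniformity_mseq_def)
  show "open U = (\<forall>x\<in>U. \<forall>\<^sub>F (x', y) in uniformity. x' = x \<longrightarrow> y \<in> U)" for U :: "mseq set" by (rule open_mseq_def)
  show "norm x = sqrt (inner x x)" by (rule norm_mseq_def)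
  show "inner x y = inner y x" unfolding inner_mseq_def by (intro infsum_cong) simp
  show "inner (x + y) z = inner x z + inner y z"
    unfolding inner_mseq_def infsum_add[OF coef_products_summable coef_products_summable, symmetric]
    by (simp only: coef_simps distrib_right plus_complex.sel)
  have "Re (coef (r *\<^sub>R x) k * cnj (coef y k)) = r * Re (coef x k * cnj (coef y k))" for k
    by (simp only: coef_simps mult.assoc) simp
  then show "inner (r *\<^sub>R x) y = r * inner x y"
    unfolding inner_mseq_def infsum_cmult_right'[symmetric] by (simp only:)
  have self: "inner x x = (\<Sum>\<^sub>\<infinity>k. (norm (coef x k))\<^sup>2)"
    unfolding inner_mseq_def Re_mult_cnj_self ..
  show "0 \<le> inner x x" unfolding self by (rule infsum_nonneg) simp
  show "inner x x = 0 \<longleftrightarrow> x = 0"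
  proof
    assume "inner x x = 0"
    then have "(norm (coef x k))\<^sup>2 = 0" for k
      unfolding self using coef_props(3)[of x] by (intro nonneg_infsum_le_0D[of "\<lambda>k. (norm (coef x k))\<^sup>2" UNIV k]) auto
    then show "x = 0" by (intro mseq_eqI) simp
  qed (simp add: inner_mseq_def)
qed

end

lemma inner_self_mseq: "inner x x = (\<Sum>\<^sub>\<infinity>k. (norm (coef x k))\<^sup>2)" for x :: mseq
  unfolding inner_mseq_def Re_mult_cnj_self ..

lemma norm_mseq_sq: "(norm x)\<^sup>2 = (\<Sum>\<^sub>\<infinity>k. (norm (coef x k))\<^sup>2)" for x :: mseq
  by (simp add: power2_norm_eq_inner inner_self_mseq)

lemma sum_coef_le: "finite F \<Longrightarrow> (\<Sum>k\<in>F. (norm (coef x k))\<^sup>2) \<le> (norm x)\<^sup>2"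
  unfolding norm_mseq_sq by (rule finite_sum_le_infsum) (auto intro: coef_props)

lemma norm_coef_le: "norm (coef x k) \<le> norm x"
  using sum_coef_le[of "{k}" x] by (auto intro: power2_le_imp_le)

text \<open>A uniform bound on finite partial sums gives membership in the space and the norm bound
  together, so the constructions below only have to estimate finite sums.\<close>

lemma mk_mseq:
  assumes "hermitian f" "\<And>k. k \<notin> Mfreq \<Longrightarrow> f k = 0"
    and b: "\<And>F. finite F \<Longrightarrow> F \<subseteq> Mfreq \<Longrightarrow> (\<Sum>k\<in>F. (norm (f k))\<^sup>2) \<le> C\<^sup>2" and C: "0 \<le> C"
  shows "coef (mk_mseq f) = f" "norm (mk_mseq f) \<le> C"
proof -
  have b': "(\<Sum>k\<in>F. (norm (f k))\<^sup>2) \<le> C\<^sup>2" if "finite F" for F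
  proof -
    have "(\<Sum>k\<in>F. (norm (f k))\<^sup>2) = (\<Sum>k\<in>F \<inter> Mfreq. (norm (f k))\<^sup>2)"
      using that assms(2) by (intro sum.mono_neutral_right) auto
    then show ?thesis using b[of "F \<inter> Mfreq"] that by simp
  qed
  have s: "(\<lambda>k. (norm (f k))\<^sup>2) summable_on UNIV"
    by (rule nonneg_bounded_partial_sums_imp_summable_on[where C = "C\<^sup>2"])
       (auto intro!: eventually_finite_subsets_at_top_weakI b')
  then show e: "coef (mk_mseq f) = f"
    using assms(1,2) by (intro mk_mseq_inverse) (auto simp: mseq_set_def)
  have "(norm (mk_mseq f))\<^sup>2 \<le> C\<^sup>2"
    unfolding norm_mseq_sq e by (rule infsum_le_finite_sums[OF s b'])
  then show "norm (mk_mseq f) \<le> C" using C by (rule power2_le_imp_le)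
qed

instance mseq :: banach
proof
  fix X :: "nat \<Rightarrow> mseq" assume X: "Cauchy X"
  have "Cauchy (\<lambda>n. coef (X n) k)" for k
  proof (rule CauchyI)
    fix e :: real assume "0 < e"
    then obtain N where "\<forall>m\<ge>N. \<forall>n\<ge>N. norm (X m - X n) < e" using CauchyD[OF X] by blast
    moreover have "norm (coef (X m) k - coef (X n) k) \<le> norm (X m - X n)" for m n
      using norm_coef_le[of "X m - X n" k] by simp
    ultimately show "\<exists>M. \<forall>m\<ge>M. \<forall>n\<ge>M. norm (coef (X m) k - coef (X n) k) < e"
      by (meson le_less_trans)
  qed
  then have "\<exists>l. (\<lambda>n. coef (X n) k) \<longlonglongrightarrow> l" for k
    using Cauchy_convergent unfolding convergent_def by blast
  then obtain f where f: "\<And>k. (\<lambda>n. coef (X n) k) \<longlonglongrightarrow> f k" by metis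
  have hf: "hermitian f"
    unfolding hermitian_def
  proof
    fix k
    have "coef (X n) (- k) = cnj (coef (X n) k)" for n using coef_props(1)[of "X n"] by (simp add: hermitian_def)
    then have "(\<lambda>n. coef (X n) (- k)) \<longlonglongrightarrow> cnj (f k)" using tendsto_cnj[OF f[of k]] by simp
    then show "f (- k) = cnj (f k)" using LIMSEQ_unique[OF f[of "- k"]] by simp
  qed
  have zf: "f k = 0" if "k \<notin> Mfreq" for k
    using LIMSEQ_unique[OF f[of k]] coef_props(2)[OF that] by simp
  have tail: "(\<Sum>k\<in>F. (norm (coef (X m) k - f k))\<^sup>2) \<le> e\<^sup>2"
    if e: "\<forall>n\<ge>N. norm (X m - X n) < e" and F: "finite F" for m e N F
  proof (rule tendsto_upperbound)
    show "(\<lambda>n. \<Sum>k\<in>F. (norm (coef (X m) k - coef (X n) k))\<^sup>2) \<longlonglongrightarrow> (\<Sum>k\<in>F. (norm (coef (X m) k - f k))\<^sup>2)"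
      by (intro tendsto_intros f)
    show "\<forall>\<^sub>F n in sequentially. (\<Sum>k\<in>F. (norm (coef (X m) k - coef (X n) k))\<^sup>2) \<le> e\<^sup>2"
      using eventually_ge_at_top[of N]
    proof eventually_elim
      case (elim n)
      have "(\<Sum>k\<in>F. (norm (coef (X m) k - coef (X n) k))\<^sup>2) \<le> (norm (X m - X n))\<^sup>2"
        using sum_coef_le[OF F, of "X m - X n"] by simp
      also have "\<dots> \<le> e\<^sup>2" using e elim by (intro power_mono) (auto simp: less_imp_le)
      finally show ?case .
    qed
  qed simp
  have mk: "coef (mk_mseq (\<lambda>k. coef (X m) k - f k)) = (\<lambda>k. coef (X m) k - f k)" "norm (mk_mseq (\<lambda>k. coef (X m) k - f k)) \<le> e"
    if "\<forall>n\<ge>N. norm (X m - X n) < e" "0 < e" for m e N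
    using mk_mseq[of "\<lambda>k. coef (X m) k - f k" e] tail[OF that(1)] hf zf coef_props(1)[of "X m"] coef_props(2)[of _ "X m"] that(2)
    by (auto simp: hermitian_def)
  obtain N1 where N1: "\<forall>m\<ge>N1. \<forall>n\<ge>N1. norm (X m - X n) < 1" using CauchyD[OF X, of 1] by auto
  \<comment> \<open>The coordinatewise limit \<open>f\<close> is not yet known to be square
    summable, but its difference from \<open>X N1\<close> is, by the Cauchy estimate. Subtracting
    that difference produces an element with coefficients \<open>f\<close>.\<close>
  define L where "L = X N1 - mk_mseq (\<lambda>k. coef (X N1) k - f k)"
  have L: "coef L k = f k" for k
    using mk(1)[of N1 N1 1] N1 by (simp add: L_def)
  have "X \<longlonglongrightarrow> L"
  proof (rule LIMSEQ_I)
    fix r :: real assume r: "0 < r"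
    then obtain N where N: "\<forall>m\<ge>N. \<forall>n\<ge>N. norm (X m - X n) < r / 2" using CauchyD[OF X, of "r/2"] by auto
    have "norm (X m - L) < r" if "m \<ge> N" for m
    proof -
      have "X m - L = mk_mseq (\<lambda>k. coef (X m) k - f k)"
        by (intro mseq_eqI) (use mk(1)[of N m "r / 2"] N that r L in simp)
      then show ?thesis using mk(2)[of N m "r / 2"] N that r by auto
    qed
    then show "\<exists>N. \<forall>m\<ge>N. norm (X m - L) < r" by blast
  qed
  then show "convergent X" by (auto simp: convergent_def)
qed

section \<open>Sobolev weights and the nonlinearity acting on coefficients\<close>

definition weight :: "real \<Rightarrow> int ^ 3 \<Rightarrow> real" where
  "weight s k = (2 * pi * norm (rvec k)) powr s"

lemma weight_pos: "k \<in> Mfreq \<Longrightarrow> 0 < weight s k"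
  using Mfreq_norm_ge_1[of k] by (auto simp: weight_def)

lemma weight_uminus [simp]: "weight s (- k) = weight s k"
  by (simp add: weight_def)

lemma two_pi_norm_ge_1: "k \<in> Mfreq \<Longrightarrow> 1 \<le> 2 * pi * norm (rvec k)"
proof -
  assume "k \<in> Mfreq"
  then have "1 \<le> norm (rvec k)" by (rule Mfreq_norm_ge_1)
  then have "1 * 1 \<le> (2 * pi) * norm (rvec k)" using pi_ge_two by (intro mult_mono) auto
  then show ?thesis by simp
qed

lemma weight_ge: "k \<in> Mfreq \<Longrightarrow> 1 \<le> s \<Longrightarrow> 2 * pi * norm (rvec k) \<le> weight s k"
  using powr_mono[of 1 s "2 * pi * norm (rvec k)"] two_pi_norm_ge_1[of k] by (simp add: weight_def)

lemma norm_le_weight: "k \<in> Mfreq \<Longrightarrow> 1 \<le> s \<Longrightarrow> norm (rvec k) \<le> weight s k"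
proof -
  assume k: "k \<in> Mfreq" and s: "1 \<le> s"
  have "1 * norm (rvec k) \<le> (2 * pi) * norm (rvec k)" using pi_ge_two by (intro mult_right_mono) auto
  then show ?thesis using weight_ge[OF k s] by simp
qed

lemma weight_ratio:
  assumes "norm (rvec k) \<le> 6 * norm (rvec p)" "0 \<le> s"
  shows "weight s k \<le> 6 powr s * weight s p"
proof -
  have "weight s k \<le> (6 * (2 * pi * norm (rvec p))) powr s"
    unfolding weight_def using assms by (intro powr_mono2) auto
  also have "(6 * (2 * pi * norm (rvec p))) powr s = 6 powr s * (2 * pi * norm (rvec p)) powr s"
    by (rule powr_mult)
  finally show ?thesis by (simp only: weight_def)
qed

text \<open>The component along \<open>vdir k\<close> of the k-th coefficient of the field with
  coefficients \<open>a\<close> transporting the one with coefficients \<open>b\<close>. The first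
  inner product comes from the transport derivative, the second from the projection.\<close>

definition interaction :: "(int ^ 3 \<Rightarrow> complex) \<Rightarrow> (int ^ 3 \<Rightarrow> complex) \<Rightarrow> int ^ 3 \<Rightarrow> complex" where
  "interaction a b k = (\<Sum>p\<in>partners k.
     2 * pi * \<i> * of_real ((vdir p \<bullet> rvec (k - p)) * (vdir (k - p) \<bullet> vdir k)) * (a p * b (k - p)))"

text \<open>The weights convert normalised sequences to field coefficients and back. As
  \<open>mk_mseq\<close> is meaningful only on \<open>mseq_set\<close>, the coefficient formula
  becomes available with the estimate in \<open>euler_bilinear_props\<close>.\<close>

definition euler_bilinear :: "real \<Rightarrow> mseq \<Rightarrow> mseq \<Rightarrow> mseq" where
  "euler_bilinear s x y = mk_mseq (\<lambda>k. if k \<in> Mfreq then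
     of_real (weight s k) * interaction (\<lambda>p. coef x p / of_real (weight s p)) (\<lambda>p. coef y p / of_real (weight s p)) k else 0)"

lemma partners_uminus: "partners (- k) = uminus ` partners k"
proof -
  have sub: "uminus ` partners k \<subseteq> partners (- k)" for k
  proof (rule image_subsetI)
    fix p assume "p \<in> partners k"
    then have "- p \<in> Mfreq" "- (k - p) \<in> Mfreq" unfolding partners_def Mfreq_uminus by auto
    moreover have "- k - - p = - (k - p)" by simp
    ultimately show "- p \<in> partners (- k)" unfolding partners_def mem_Collect_eq by metis
  qed
  have "partners (- k) = uminus ` (uminus ` partners (- k))" by (simp add: image_comp)
  also have "\<dots> \<subseteq> uminus ` partners k" using image_mono[OF sub[of "- k"], of uminus] by simp
  finally show ?thesis using sub[of k] by blast
qed

lemma interaction_hermitian: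
  assumes "hermitian a" "hermitian b"
  shows "interaction a b (- k) = cnj (interaction a b k)"
proof -
  have "interaction a b (- k) = (\<Sum>p\<in>partners k.
     2 * pi * \<i> * of_real ((vdir (- p) \<bullet> rvec (- k - - p)) * (vdir (- k - - p) \<bullet> vdir (- k))) * (a (- p) * b (- k - - p)))"
    unfolding interaction_def partners_uminus by (subst sum.reindex) (auto simp: inj_on_def)
  also have "\<dots> = cnj (interaction a b k)"
    unfolding interaction_def cnj_sum
  proof (intro sum.cong refl)
    fix p
    have e: "- k - - p = - (k - p)" by simp
    have ab: "a (- p) = cnj (a p)" "b (- (k - p)) = cnj (b (k - p))" using assms unfolding hermitian_def by blast+
    show "2 * pi * \<i> * of_real ((vdir (- p) \<bullet> rvec (- k - - p)) * (vdir (- k - - p) \<bullet> vdir (- k))) * (a (- p) * b (- k - - p)) =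
      cnj (2 * pi * \<i> * of_real ((vdir p \<bullet> rvec (k - p)) * (vdir (k - p) \<bullet> vdir k)) * (a p * b (k - p)))"
      unfolding e vdir_uminus rvec_simps(3) ab by (simp del: rvec_simps(4))
  qed
  finally show ?thesis .
qed

lemma hermitian_div_weight: "hermitian a \<Longrightarrow> hermitian (\<lambda>p. a p / of_real (weight s p))"
  by (simp add: hermitian_def)

text \<open>Since |k| \<le> 6 |p| in a triad, the output weight is charged to \<open>x\<close> at
  the price of 6^s. The derivative |k - p| falls on \<open>y\<close>, where R absorbs it together
  with the remaining weight.\<close>

lemma euler_pointwise_bound:
  assumes s: "1 \<le> s" and k: "k \<in> Mfreq"
    and R: "\<And>q. q \<in> Mfreq \<Longrightarrow> norm (rvec q) * norm (coef y q) / weight s q \<le> R"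
  shows "norm (of_real (weight s k) * interaction (\<lambda>p. coef x p / of_real (weight s p)) (\<lambda>p. coef y p / of_real (weight s p)) k)
     \<le> 2 * pi * 6 powr s * R * (\<Sum>p\<in>partners k. norm (coef x p))"
proof -
  let ?t = "\<lambda>p. 2 * pi * \<i> * of_real ((vdir p \<bullet> rvec (k - p)) * (vdir (k - p) \<bullet> vdir k)) *
      (coef x p / of_real (weight s p) * (coef y (k - p) / of_real (weight s (k - p))))"
  have t: "weight s k * norm (?t p) \<le> 2 * pi * 6 powr s * R * norm (coef x p)" if p: "p \<in> partners k" for p
  proof -
    have M: "p \<in> Mfreq" "k - p \<in> Mfreq" using p by (auto simp: partners_def)
    have w: "weight s k / weight s p \<le> 6 powr s"
      using weight_ratio[of k p s] Mfreq_triad_sum[of p "k - p"] M k s weight_pos[OF M(1), of s]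
      by (simp add: divide_simps)
    have v: "\<bar>vdir p \<bullet> rvec (k - p)\<bar> * \<bar>vdir (k - p) \<bullet> vdir k\<bar> \<le> norm (rvec (k - p)) * 1"
    proof (intro mult_mono)
      show "\<bar>vdir p \<bullet> rvec (k - p)\<bar> \<le> norm (rvec (k - p))"
        using Cauchy_Schwarz_ineq2[of "vdir p" "rvec (k - p)"] norm_vdir[OF M(1)] by simp
      show "\<bar>vdir (k - p) \<bullet> vdir k\<bar> \<le> 1"
        using Cauchy_Schwarz_ineq2[of "vdir (k - p)" "vdir k"] norm_vdir[OF M(2)] norm_vdir[OF k] by simp
    qed auto
    have "weight s k * norm (?t p) = 2 * pi * (\<bar>vdir p \<bullet> rvec (k - p)\<bar> * \<bar>vdir (k - p) \<bullet> vdir k\<bar>) *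
        ((weight s k / weight s p) * norm (coef x p) * (norm (coef y (k - p)) / weight s (k - p)))"
      using weight_pos[OF M(1), of s] weight_pos[OF M(2), of s]
      by (simp add: norm_mult norm_divide abs_mult del: rvec_simps(4))
    also have "\<dots> \<le> 2 * pi * (norm (rvec (k - p)) * 1) * ((6 powr s) * norm (coef x p) * (norm (coef y (k - p)) / weight s (k - p)))"
      using weight_pos[OF M(1), of s] weight_pos[OF M(2), of s] weight_pos[OF k, of s]
      by (intro mult_mono mult_left_mono v w mult_right_mono mult_nonneg_nonneg) (auto simp del: rvec_simps(4))
    also have "\<dots> = 2 * pi * 6 powr s * norm (coef x p) * (norm (rvec (k - p)) * norm (coef y (k - p)) / weight s (k - p))"
      by (simp del: rvec_simps(4))
    also have "\<dots> \<le> 2 * pi * 6 powr s * norm (coef x p) * R"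
      by (intro mult_left_mono R M(2)) auto
    finally show ?thesis by (simp add: mult_ac)
  qed
  have "norm (of_real (weight s k) * interaction (\<lambda>p. coef x p / of_real (weight s p)) (\<lambda>p. coef y p / of_real (weight s p)) k)
    \<le> weight s k * (\<Sum>p\<in>partners k. norm (?t p))"
    using weight_pos[OF k, of s] unfolding interaction_def norm_mult[of "of_real (weight s k)"] norm_of_real
    by (intro mult_mono norm_sum) auto
  also have "\<dots> \<le> 2 * pi * 6 powr s * R * (\<Sum>p\<in>partners k. norm (coef x p))"
    unfolding sum_distrib_left by (intro sum_mono t)
  finally show ?thesis .
qed

text \<open>A Schur test: each k has at most 324 partners p, which costs one factor 324 by
  Cauchy-Schwarz, and each p is a partner of at most 324 frequencies k, which costs the
  other.\<close>

lemma convolution_square_sum: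
  assumes F: "finite F" "F \<subseteq> Mfreq"
  shows "(\<Sum>k\<in>F. (\<Sum>p\<in>partners k. norm (coef x p))\<^sup>2) \<le> (324 * norm x)\<^sup>2"
proof -
  define P where "P = (\<Union>k\<in>F. partners k)"
  have fp: "finite (partners k)" "card (partners k) \<le> 324" if "k \<in> F" for k
    using partners_finite that F by auto
  have fP: "finite P" using fp F by (auto simp: P_def)
  have PM: "P \<subseteq> Mfreq" by (auto simp: P_def partners_def)
  have "(\<Sum>k\<in>F. (\<Sum>p\<in>partners k. norm (coef x p))\<^sup>2) \<le> (\<Sum>k\<in>F. 324 * (\<Sum>p\<in>partners k. (norm (coef x p))\<^sup>2))"
  proof (rule sum_mono)
    fix k assume k: "k \<in> F"
    have "(\<Sum>p\<in>partners k. 1 * norm (coef x p))\<^sup>2 \<le> (\<Sum>p\<in>partners k. 1\<^sup>2) * (\<Sum>p\<in>partners k. (norm (coef x p))\<^sup>2)"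
      by (rule Cauchy_Schwarz_ineq_sum)
    also have "\<dots> \<le> 324 * (\<Sum>p\<in>partners k. (norm (coef x p))\<^sup>2)"
      using fp[OF k] by (intro mult_right_mono sum_nonneg) auto
    finally show "(\<Sum>p\<in>partners k. norm (coef x p))\<^sup>2 \<le> 324 * (\<Sum>p\<in>partners k. (norm (coef x p))\<^sup>2)" by simp
  qed
  also have "\<dots> = 324 * (\<Sum>k\<in>F. \<Sum>p\<in>partners k. (norm (coef x p))\<^sup>2)"
    by (simp add: sum_distrib_left)
  also have "(\<Sum>k\<in>F. \<Sum>p\<in>partners k. (norm (coef x p))\<^sup>2) = (\<Sum>k\<in>F. \<Sum>p\<in>P. if p \<in> partners k then (norm (coef x p))\<^sup>2 else 0)"
  proof (rule sum.cong[OF refl])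
    fix k assume "k \<in> F"
    then have "P \<inter> {p. p \<in> partners k} = partners k" by (auto simp: P_def)
    then show "(\<Sum>p\<in>partners k. (norm (coef x p))\<^sup>2) = (\<Sum>p\<in>P. if p \<in> partners k then (norm (coef x p))\<^sup>2 else 0)"
      using sum.inter_restrict[OF fP, of "\<lambda>p. (norm (coef x p))\<^sup>2" "partners k"] by (simp add: Int_def)
  qed
  also have "\<dots> = (\<Sum>p\<in>P. \<Sum>k\<in>F. if p \<in> partners k then (norm (coef x p))\<^sup>2 else 0)" by (rule sum.swap)
  also have "\<dots> \<le> (\<Sum>p\<in>P. 324 * (norm (coef x p))\<^sup>2)"
  proof (rule sum_mono)
    fix p assume "p \<in> P"
    then have p: "p \<in> Mfreq" using PM by auto
    have inj: "inj_on (\<lambda>k. k - p) {k \<in> F. p \<in> partners k}" by (auto simp: inj_on_def)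
    have sub: "(\<lambda>k. k - p) ` {k \<in> F. p \<in> partners k} \<subseteq> {q \<in> Mfreq. q + p \<in> Mfreq}"
      using F by (auto simp: partners_def)
    have "card {k \<in> F. p \<in> partners k} \<le> card {q \<in> Mfreq. q + p \<in> Mfreq}"
      by (rule card_inj_on_le[OF inj sub]) (rule Mfreq_neighbours_finite[OF p])
    also have "\<dots> \<le> 324" by (rule Mfreq_neighbours_finite[OF p])
    finally have c: "real (card {k \<in> F. p \<in> partners k}) \<le> 324" by simp
    have "(\<Sum>k\<in>F. if p \<in> partners k then (norm (coef x p))\<^sup>2 else 0) = (\<Sum>k\<in>{k \<in> F. p \<in> partners k}. (norm (coef x p))\<^sup>2)"
      using F by (intro sum.inter_filter[symmetric]) 
    also have "\<dots> \<le> 324 * (norm (coef x p))\<^sup>2" using c by (simp add: mult_right_mono)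
    finally show "(\<Sum>k\<in>F. if p \<in> partners k then (norm (coef x p))\<^sup>2 else 0) \<le> 324 * (norm (coef x p))\<^sup>2" .
  qed
  also have "\<dots> \<le> 324 * (norm x)\<^sup>2"
    using sum_coef_le[OF fP, of x] by (simp add: sum_distrib_left[symmetric])
  finally show ?thesis by (simp add: power2_eq_square)
qed

text \<open>The bound R on |q| times the unweighted coefficients of \<open>y\<close> is left as a
  parameter. With R = \<open>norm y\<close> it yields boundedness of the bilinear map, and with R
  from the enstrophy it yields the linear growth used for the blowup criterion.\<close>

lemma euler_bilinear_props:
  assumes s: "1 \<le> s" and R: "\<And>q. q \<in> Mfreq \<Longrightarrow> norm (rvec q) * norm (coef y q) / weight s q \<le> R"
    and R0: "0 \<le> R"
  shows "coef (euler_bilinear s x y) = (\<lambda>k. if k \<in> Mfreq then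
     of_real (weight s k) * interaction (\<lambda>p. coef x p / of_real (weight s p)) (\<lambda>p. coef y p / of_real (weight s p)) k else 0)"
    (is "_ = ?f")
    and "norm (euler_bilinear s x y) \<le> 2 * pi * 6 powr s * 324 * R * norm x"
proof -
  have h: "hermitian ?f"
    unfolding hermitian_def
    using interaction_hermitian[OF hermitian_div_weight[OF coef_props(1)] hermitian_div_weight[OF coef_props(1)], of x s y s] by simp
  have b: "(\<Sum>k\<in>F. (norm (?f k))\<^sup>2) \<le> (2 * pi * 6 powr s * 324 * R * norm x)\<^sup>2" if F: "finite F" "F \<subseteq> Mfreq" for F
  proof -
    have "(\<Sum>k\<in>F. (norm (?f k))\<^sup>2) \<le> (\<Sum>k\<in>F. (2 * pi * 6 powr s * R * (\<Sum>p\<in>partners k. norm (coef x p)))\<^sup>2)"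
      using F euler_pointwise_bound[OF s _ R, of _ x]
      by (intro sum_mono power_mono) (auto simp: subset_iff)
    also have "\<dots> = (2 * pi * 6 powr s * R)\<^sup>2 * (\<Sum>k\<in>F. (\<Sum>p\<in>partners k. norm (coef x p))\<^sup>2)"
      by (subst sum_distrib_left) (simp only: power_mult_distrib)
    also have "\<dots> \<le> (2 * pi * 6 powr s * R)\<^sup>2 * (324 * norm x)\<^sup>2"
      by (intro mult_left_mono convolution_square_sum F) auto
    finally show ?thesis by (simp only: power_mult_distrib[symmetric] mult_ac)
  qed
  have "0 \<le> 2 * pi * 6 powr s * 324 * R * norm x" using R0 by simp
  from mk_mseq[OF h _ b this] show "coef (euler_bilinear s x y) = ?f" "norm (euler_bilinear s x y) \<le> 2 * pi * 6 powr s * 324 * R * norm x"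
    unfolding euler_bilinear_def by auto
qed

lemma coef_weight_bound:
  assumes "1 \<le> s" "q \<in> Mfreq"
  shows "norm (rvec q) * norm (coef y q) / weight s q \<le> norm y"
proof -
  have "norm (rvec q) / weight s q \<le> 1"
    using norm_le_weight[OF assms(2,1)] weight_pos[OF assms(2), of s] by simp
  then have "(norm (rvec q) / weight s q) * norm (coef y q) \<le> 1 * norm y"
    by (intro mult_mono norm_coef_le) auto
  then show ?thesis by simp
qed

lemmas coef_euler_bilinear = euler_bilinear_props(1)[OF _ coef_weight_bound norm_ge_zero]

lemma bounded_bilinear_euler:
  assumes s: "1 \<le> s" shows "bounded_bilinear (euler_bilinear s)"
proof
  fix x x' y y' :: mseq and r :: real
  note c = coef_euler_bilinear[OF s s]
  show "euler_bilinear s (x + x') y = euler_bilinear s x y + euler_bilinear s x' y"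
    by (rule mseq_eqI) (simp add: c interaction_def add_divide_distrib distrib_right distrib_left sum.distrib del: rvec_simps(4))
  show "euler_bilinear s x (y + y') = euler_bilinear s x y + euler_bilinear s x y'"
    by (rule mseq_eqI) (simp add: c interaction_def add_divide_distrib distrib_right distrib_left sum.distrib del: rvec_simps(4))
  show "euler_bilinear s (r *\<^sub>R x) y = r *\<^sub>R euler_bilinear s x y"
    by (rule mseq_eqI) (simp add: c interaction_def sum_distrib_left mult_ac del: rvec_simps(4))
  show "euler_bilinear s x (r *\<^sub>R y) = r *\<^sub>R euler_bilinear s x y"
    by (rule mseq_eqI) (simp add: c interaction_def sum_distrib_left mult_ac del: rvec_simps(4))
  show "\<exists>K. \<forall>x y. norm (euler_bilinear s x y) \<le> norm x * norm y * K"
    using euler_bilinear_props(2)[OF s coef_weight_bound[OF s] norm_ge_zero]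
    by (intro exI[of _ "2 * pi * 6 powr s * 324"]) (simp add: mult_ac)
qed

section \<open>Quadratic differential equations in Banach spaces\<close>

lemma has_vector_derivative_at_within_nhd:
  assumes "(f has_vector_derivative f') (at x within T)" "open S" "x \<in> S" "T \<inter> S = U \<inter> S"
  shows "(f has_vector_derivative f') (at x within U)"
proof -
  have "at x within T = at x within U" by (rule at_within_nhd[OF assms(3,2)]) (use assms(4) in auto)
  then show ?thesis using assms(1) by simp
qed

lemma norm_diff_le_vector_derivative:
  fixes f :: "real \<Rightarrow> 'a::real_normed_vector"
  assumes d: "\<And>t. t \<in> {a..b} \<Longrightarrow> (f has_vector_derivative f' t) (at t within {a..b})"
    and B: "\<And>t. t \<in> {a..b} \<Longrightarrow> norm (f' t) \<le> B" and "x \<in> {a..b}" "y \<in> {a..b}"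
  shows "norm (f x - f y) \<le> B * \<bar>x - y\<bar>"
proof -
  have "onorm (\<lambda>h. h *\<^sub>R f' t) \<le> B" if "t \<in> {a..b}" for t
    using mult_right_mono[OF B[OF that] abs_ge_zero] by (intro onorm_le) (simp add: mult.commute)
  then have "norm (f x - f y) \<le> B * norm (x - y)"
    using assms by (intro differentiable_bound[of "{a..b}" f "\<lambda>t h. h *\<^sub>R f' t"]) (auto simp: has_vector_derivative_def)
  then show ?thesis by simp
qed

definition solves :: "('a \<Rightarrow> 'a \<Rightarrow> 'a::real_normed_vector) \<Rightarrow> (real \<Rightarrow> 'a) \<Rightarrow> real set \<Rightarrow> bool" where
  "solves B w S \<longleftrightarrow> (\<forall>t\<in>S. (w has_vector_derivative B (w t) (w t)) (at t within S))"

lemma solves_subset: "solves B w S \<Longrightarrow> T \<subseteq> S \<Longrightarrow> solves B w T"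
  unfolding solves_def by (meson has_vector_derivative_within_subset subsetD)

lemma bilinear_square_diff:
  assumes B: "bounded_bilinear B" and C: "\<And>x y. norm (B x y) \<le> norm x * norm y * C" and C0: "0 \<le> C"
    and R: "norm x \<le> R" "norm y \<le> R"
  shows "norm (B x x - B y y) \<le> 2 * C * R * norm (x - y)"
proof -
  have "B x x - B y y = B x (x - y) + B (x - y) y"
    using bounded_bilinear.diff_left[OF B] bounded_bilinear.diff_right[OF B] by simp
  also have "norm \<dots> \<le> norm x * norm (x - y) * C + norm (x - y) * norm y * C"
    by (intro order_trans[OF norm_triangle_ineq] add_mono C)
  also have "\<dots> \<le> R * norm (x - y) * C + norm (x - y) * R * C"
    using R C0 by (intro add_mono mult_right_mono mult_left_mono) auto
  finally show ?thesis by (simp add: algebra_simps)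
qed

text \<open>Picard iteration in the ball of radius R about 0. The first smallness condition on
  \<delta> keeps the iterates in the ball, as the initial value leaves a margin of 1; the second
  makes the map a contraction with factor 1/2. The step length depends only on C and R, not on the
  starting time.\<close>

lemma quadratic_ode_local:
  fixes B :: "'a \<Rightarrow> 'a \<Rightarrow> 'a::banach"
  assumes B: "bounded_bilinear B" and C: "\<And>x y. norm (B x y) \<le> norm x * norm y * C" and C0: "0 \<le> C"
    and x0: "norm x0 \<le> R - 1" and \<delta>: "0 < \<delta>" "\<delta> * (C * R\<^sup>2) \<le> 1" "\<delta> * (2 * C * R) \<le> 1 / 2"
  obtains w where "w t0 = x0" "solves B w {t0..t0 + \<delta>}" "\<And>t. norm (w t) \<le> R"
proof -
  have R: "0 \<le> R" using x0 norm_ge_zero[of x0] by linarith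
  \<comment> \<open>Clamping time to the interval lets the Picard map act on bounded continuous
    functions on the whole line, a complete space.\<close>
  define cl where "cl t = max t0 (min (t0 + \<delta>) t)" for t
  have cl: "t0 \<le> cl t" "cl t \<le> t0 + \<delta>" for t using \<delta> by (auto simp: cl_def)
  have ccl: "continuous_on UNIV cl" unfolding cl_def by (intro continuous_intros)
  define g where "g w \<tau> = B (apply_bcontfun w \<tau>) (apply_bcontfun w \<tau>)" for w and \<tau> :: real
  have cg: "continuous_on S (g w)" for S w
    unfolding g_def by (rule bounded_bilinear.continuous_on[OF B]) auto
  have ig: "g w integrable_on {a..b}" for w a b by (intro integrable_continuous_real cg)
  have gb: "norm (g w \<tau>) \<le> C * R\<^sup>2" if "norm w \<le> R" for w \<tau>
  proof -
    have n: "norm (apply_bcontfun w \<tau>) \<le> R" using norm_bounded[of w \<tau>] that by simp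
    have "norm (g w \<tau>) \<le> norm (apply_bcontfun w \<tau>) * norm (apply_bcontfun w \<tau>) * C" unfolding g_def by (rule C)
    also have "\<dots> \<le> R * R * C" using n R C0 by (intro mult_right_mono mult_mono) auto
    finally show ?thesis by (simp add: power2_eq_square mult_ac)
  qed
  define J where "J w t = x0 + integral {t0..cl t} (g w)" for w t
  have cJ: "continuous_on UNIV (J w)" for w
    unfolding J_def
    by (intro continuous_intros continuous_on_compose2[OF indefinite_integral_continuous_1[OF ig[of w t0 "t0 + \<delta>"]] ccl])
      (use cl in auto)
  have bJ: "norm (J w t) \<le> R" if "norm w \<le> R" for w t
  proof -
    have "norm (integral {t0..cl t} (g w)) \<le> C * R\<^sup>2 * (cl t - t0)"
      by (intro integral_bound cl cg gb that)
    also have "\<dots> \<le> C * R\<^sup>2 * \<delta>" using cl(2)[of t] C0 by (intro mult_left_mono) auto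
    finally show ?thesis unfolding J_def using x0 \<delta>(2) norm_triangle_ineq[of x0 "integral {t0..cl t} (g w)"]
      by (simp add: mult.commute)
  qed
  define \<Phi> where "\<Phi> w = Bcontfun (J w)" for w
  have \<Phi>: "apply_bcontfun (\<Phi> w) = J w" if "norm w \<le> R" for w
    unfolding \<Phi>_def by (rule Bcontfun_inverse) (rule bcontfun_normI[OF cJ bJ[OF that]])
  have "\<exists>!w\<in>cball 0 R. \<Phi> w = w"
  proof (rule Banach_fix[of _ "1/2"])
    show "complete (cball 0 R :: (real \<Rightarrow>\<^sub>C 'a) set)" by (simp add: complete_eq_closed)
    show "cball 0 R \<noteq> ({} :: (real \<Rightarrow>\<^sub>C 'a) set)" using R by simp
    show "\<Phi> ` cball 0 R \<subseteq> cball 0 R"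
      using \<Phi> bJ by (auto intro!: norm_bound)
    fix v w :: "real \<Rightarrow>\<^sub>C 'a" assume "v \<in> cball 0 R" "w \<in> cball 0 R"
    then have vw: "norm v \<le> R" "norm w \<le> R" by auto
    show "dist (\<Phi> v) (\<Phi> w) \<le> 1 / 2 * dist v w"
    proof (rule dist_bound)
      fix t
      have "dist (apply_bcontfun (\<Phi> v) t) (apply_bcontfun (\<Phi> w) t) = norm (integral {t0..cl t} (\<lambda>\<tau>. g v \<tau> - g w \<tau>))"
        by (simp add: \<Phi> vw J_def dist_norm integral_diff ig)
      also have "\<dots> \<le> 2 * C * R * dist v w * (cl t - t0)"
      proof (intro integral_bound cl continuous_intros cg)
        fix \<tau>
        have "norm (g v \<tau> - g w \<tau>) \<le> 2 * C * R * norm (apply_bcontfun v \<tau> - apply_bcontfun w \<tau>)"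
          unfolding g_def using vw norm_bounded[of v \<tau>] norm_bounded[of w \<tau>]
          by (intro bilinear_square_diff[OF B C C0]) auto
        also have "\<dots> \<le> 2 * C * R * dist v w"
          using dist_bounded[of v \<tau> w] C0 R by (intro mult_left_mono) (auto simp: dist_norm)
        finally show "norm (g v \<tau> - g w \<tau>) \<le> 2 * C * R * dist v w" .
      qed
      also have "\<dots> \<le> 2 * C * R * dist v w * \<delta>"
        using cl(2)[of t] C0 R by (intro mult_left_mono) auto
      also have "\<dots> = (\<delta> * (2 * C * R)) * dist v w" by simp
      also have "\<dots> \<le> 1 / 2 * dist v w" by (intro mult_right_mono \<delta>) auto
      finally show "dist (apply_bcontfun (\<Phi> v) t) (apply_bcontfun (\<Phi> w) t) \<le> 1 / 2 * dist v w" .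
    qed
  qed auto
  then obtain w where w: "norm w \<le> R" "\<Phi> w = w" by auto
  have wt: "apply_bcontfun w t = x0 + integral {t0..cl t} (g w)" for t
    using \<Phi>[OF w(1)] w(2) by (simp add: J_def)
  have "solves B (apply_bcontfun w) {t0..t0 + \<delta>}"
    unfolding solves_def
  proof
    fix t assume t: "t \<in> {t0..t0 + \<delta>}"
    have "((\<lambda>u. integral {t0..u} (g w)) has_vector_derivative g w t) (at t within {t0..t0 + \<delta>})"
      by (rule integral_has_vector_derivative[OF cg t])
    then have "((\<lambda>u. x0 + integral {t0..u} (g w)) has_vector_derivative g w t) (at t within {t0..t0 + \<delta>})"
      by (auto intro: derivative_eq_intros)
    then show "(apply_bcontfun w has_vector_derivative B (apply_bcontfun w t) (apply_bcontfun w t)) (at t within {t0..t0 + \<delta>})"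
      unfolding g_def[of w t, symmetric]
      by (rule has_vector_derivative_transform[OF t, rotated]) (simp add: wt cl_def)
  qed
  moreover have "apply_bcontfun w t0 = x0" using \<delta> by (simp add: wt cl_def)
  moreover have "norm (apply_bcontfun w t) \<le> R" for t using norm_bounded[of w t] w by simp
  ultimately show ?thesis using that by blast
qed

text \<open>At a point where the norm of the difference is largest, the derivative bound makes that
  norm at most half of itself.\<close>

lemma quadratic_ode_unique:
  assumes B: "bounded_bilinear B" and C: "\<And>x y. norm (B x y) \<le> norm x * norm y * C" and C0: "0 \<le> C"
    and s: "solves B v {t0..t1}" "solves B w {t0..t1}" and e: "v t0 = w t0" and le: "t0 \<le> t1"
    and R: "\<And>t. t \<in> {t0..t1} \<Longrightarrow> norm (v t) \<le> R" "\<And>t. t \<in> {t0..t1} \<Longrightarrow> norm (w t) \<le> R"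
    and small: "(t1 - t0) * (2 * C * R) \<le> 1 / 2"
  shows "v t1 = w t1"
proof -
  have R0: "0 \<le> R" using R(1)[of t0] le norm_ge_zero[of "v t0"] by (simp del: norm_ge_zero)
  define d where "d t = v t - w t" for t
  have dd: "(d has_vector_derivative B (v t) (v t) - B (w t) (w t)) (at t within {t0..t1})" if "t \<in> {t0..t1}" for t
    unfolding d_def using s that by (intro has_vector_derivative_diff) (auto simp: solves_def)
  have "continuous_on {t0..t1} d"
    using dd by (meson continuous_on_eq_continuous_within has_vector_derivative_continuous)
  then have "continuous_on {t0..t1} (\<lambda>t. norm (d t))" by (rule continuous_on_norm)
  then obtain t where t: "t \<in> {t0..t1}" and max: "\<And>u. u \<in> {t0..t1} \<Longrightarrow> norm (d u) \<le> norm (d t)"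
    using continuous_attains_sup[of "{t0..t1}" "\<lambda>t. norm (d t)"] le by auto
  have "norm (d t - d t0) \<le> 2 * C * R * norm (d t) * \<bar>t - t0\<bar>"
  proof (rule norm_diff_le_vector_derivative[OF dd _ t])
    fix u assume u: "u \<in> {t0..t1}"
    have "norm (B (v u) (v u) - B (w u) (w u)) \<le> 2 * C * R * norm (d u)"
      unfolding d_def by (rule bilinear_square_diff[OF B C C0 R(1)[OF u] R(2)[OF u]])
    also have "\<dots> \<le> 2 * C * R * norm (d t)" using C0 R0 by (intro mult_left_mono max u) auto
    finally show "norm (B (v u) (v u) - B (w u) (w u)) \<le> 2 * C * R * norm (d t)" .
  qed (use le in auto)
  also have "\<dots> \<le> 2 * C * R * norm (d t) * (t1 - t0)" using t C0 R0 by (intro mult_left_mono) auto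
  also have "\<dots> = ((t1 - t0) * (2 * C * R)) * norm (d t)" by simp
  also have "\<dots> \<le> 1 / 2 * norm (d t)" by (intro mult_right_mono small) auto
  finally have "norm (d t) \<le> 0" using e by (simp add: d_def)
  then have "norm (d t1) \<le> 0" using max[of t1] le by auto
  then show ?thesis by (simp add: d_def)
qed

text \<open>The bound K fixes a step length that is the same for all starting times, so restarting
  at most \<delta> / 2 before T carries the solution past T.\<close>

lemma quadratic_ode_continuation:
  fixes B :: "'a \<Rightarrow> 'a \<Rightarrow> 'a::banach"
  assumes B: "bounded_bilinear B" and T: "0 < T" and U: "solves B U {0..<T}"
    and K: "\<And>t. t \<in> {0..<T} \<Longrightarrow> norm (U t) \<le> K"
  obtains T' V where "T < T'" "solves B V {0..<T'}" "\<And>t. t \<in> {0..<T} \<Longrightarrow> V t = U t"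
proof -
  obtain C where C: "0 \<le> C" "\<And>x y. norm (B x y) \<le> norm x * norm y * C"
    using bounded_bilinear.nonneg_bounded[OF B] by blast
  define R where "R = K + 1"
  have R: "1 \<le> R" using K[of 0] T norm_ge_zero[of "U 0"] by (simp add: R_def del: norm_ge_zero)
  \<comment> \<open>Chosen to meet both smallness conditions of the local theorem; the summand 1
    keeps the denominator positive even if C = 0.\<close>
  define \<delta> where "\<delta> = 1 / (4 * (C * R\<^sup>2 + C * R + 1))"
  have pos: "0 \<le> C * R\<^sup>2" "0 \<le> C * R" using C R by auto
  have \<delta>: "0 < \<delta>" "\<delta> * (C * R\<^sup>2) \<le> 1" "\<delta> * (2 * C * R) \<le> 1 / 2"
    unfolding \<delta>_def using pos by (auto simp: divide_simps) 
  define t0 where "t0 = max 0 (T - \<delta> / 2)"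
  have t0: "0 \<le> t0" "t0 < T" "T < t0 + \<delta>" using T \<delta>(1) by (auto simp: t0_def)
  have x0: "norm (U t0) \<le> R - 1" using K[of t0] t0 by (simp add: R_def)
  obtain w where w: "w t0 = U t0" "solves B w {t0..t0 + \<delta>}" "\<And>t. norm (w t) \<le> R"
    using quadratic_ode_local[OF B C(2,1) x0 \<delta>] by blast
  have eq: "w t = U t" if t: "t0 \<le> t" "t < T" for t
  proof (rule quadratic_ode_unique[OF B C(2,1), of w t0 t U R])
    show "solves B w {t0..t}" by (rule solves_subset[OF w(2)]) (use t t0 in auto)
    show "solves B U {t0..t}" by (rule solves_subset[OF U]) (use t t0 in auto)
    show "norm (U u) \<le> R" if "u \<in> {t0..t}" for u using K[of u] that t t0 by (auto simp: R_def)
    have "(t - t0) * (2 * C * R) \<le> \<delta> * (2 * C * R)" using t t0 C R by (intro mult_right_mono) auto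
    then show "(t - t0) * (2 * C * R) \<le> 1 / 2" using \<delta>(3) by linarith
  qed (use w t in auto)
  define T' where "T' = t0 + \<delta>"
  \<comment> \<open>At t = T the equation is inherited from \<open>w\<close>, which solves it on
    both sides of T because t0 < T < t0 + \<delta>.\<close>
  define V where "V t = (if t < T then U t else w t)" for t
  have VU: "V t = U t" if "t \<in> {0..<T}" for t using that by (simp add: V_def)
  have Vw: "V t = w t" if "t0 \<le> t" for t using that eq[of t] by (simp add: V_def)
  have "solves B V {0..<T'}"
    unfolding solves_def
  proof
    fix t assume t: "t \<in> {0..<T'}"
    show "(V has_vector_derivative B (V t) (V t)) (at t within {0..<T'})"
    proof (cases "t < T")
      case True
      have "(V has_vector_derivative B (V t) (V t)) (at t within {0..<T})"
        by (rule has_vector_derivative_transform[where f = U]) (use t True U VU in \<open>auto simp: solves_def\<close>)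
      then show ?thesis
        by (rule has_vector_derivative_at_within_nhd[where S = "{..<T}"]) (use True t0 T'_def in auto)
    next
      case False
      then have tt: "t \<in> {t0..T'}" "t \<in> {t0<..<T'}" using t t0 by auto
      have "(V has_vector_derivative B (V t) (V t)) (at t within {t0..T'})"
        by (rule has_vector_derivative_transform[where f = w]) (use tt w(2) Vw in \<open>auto simp: solves_def T'_def\<close>)
      then show ?thesis
        by (rule has_vector_derivative_at_within_nhd[where S = "{t0<..<T'}"]) (use tt t0 in auto)
    qed
  qed
  moreover have "T < T'" using t0 by (simp add: T'_def)
  ultimately show ?thesis using that VU by blast
qed

lemma gronwall:
  fixes y :: "real \<Rightarrow> real"
  assumes t: "0 \<le> t"
    and d: "\<And>\<tau>. \<tau> \<in> {0..t} \<Longrightarrow> (y has_real_derivative y' \<tau>) (at \<tau> within {0..t})"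
    and le: "\<And>\<tau>. \<tau> \<in> {0..t} \<Longrightarrow> y' \<tau> \<le> g \<tau> * y \<tau>" and g: "continuous_on {0..t} g"
  shows "y t \<le> y 0 * exp (integral {0..t} g)"
proof -
  define G where "G \<tau> = integral {0..\<tau>} g" for \<tau>
  have G: "(G has_real_derivative g \<tau>) (at \<tau> within {0..t})" if "\<tau> \<in> {0..t}" for \<tau>
    unfolding G_def has_real_derivative_iff_has_vector_derivative by (rule integral_has_vector_derivative[OF g that])
  define z where "z \<tau> = y \<tau> * exp (- G \<tau>)" for \<tau>
  have z: "(z has_real_derivative (y' \<tau> - g \<tau> * y \<tau>) * exp (- G \<tau>)) (at \<tau> within {0..t})" if "\<tau> \<in> {0..t}" for \<tau>
  proof -
    have "(z has_real_derivative y' \<tau> * exp (- G \<tau>) + exp (- G \<tau>) * (- g \<tau>) * y \<tau>) (at \<tau> within {0..t})"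
      unfolding z_def by (intro DERIV_mult d[OF that] DERIV_chain2[OF DERIV_exp] DERIV_minus G[OF that])
    then show ?thesis by (simp add: algebra_simps)
  qed
  have "z t \<le> z 0"
  proof (rule DERIV_nonpos_imp_decreasing_open[OF t])
    fix x assume x: "0 < x" "x < t"
    have "(z has_real_derivative (y' x - g x * y x) * exp (- G x)) (at x)"
      using z[of x] x by (simp add: at_within_Icc_at)
    moreover have "(y' x - g x * y x) * exp (- G x) \<le> 0" using le[of x] x by (simp add: mult_le_0_iff)
    ultimately show "\<exists>y. (z has_real_derivative y) (at x) \<and> y \<le> 0" by blast
  next
    show "continuous_on {0..t} z"
      by (rule DERIV_continuous_on[OF z])
  qed
  then have "y t * exp (- G t) * exp (G t) \<le> y 0 * exp (G t)" by (simp add: z_def G_def)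
  then show ?thesis by (simp add: G_def mult.assoc exp_minus)
qed

section \<open>Fields and coefficient sequences\<close>

text \<open>Phrased through Fourier coefficients, hence insensitive to the representative of a class
  modulo null sets. Outside \<open>Mfreq\<close> it forces the coefficients of the field to vanish,
  since \<open>coef x\<close> does.\<close>

definition represents :: "real \<Rightarrow> (real ^ 3 \<Rightarrow> real ^ 3) \<Rightarrow> mseq \<Rightarrow> bool" where
  "represents s f x \<longleftrightarrow> (\<forall>k. fourier f k = (coef x k / of_real (weight s k)) *s cvec (vdir k))"

definition scaled :: "real \<Rightarrow> mseq \<Rightarrow> int ^ 3 \<Rightarrow> complex" where
  "scaled s x k = coef x k / of_real (weight s k)"

definition field_coeffs :: "real \<Rightarrow> mseq \<Rightarrow> 3 \<Rightarrow> int ^ 3 \<Rightarrow> complex" where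
  "field_coeffs s x j k = scaled s x k * of_real (vdir k $ j)"

definition vdir_coeff :: "(real ^ 3 \<Rightarrow> real ^ 3) \<Rightarrow> int ^ 3 \<Rightarrow> complex" where
  "vdir_coeff u k = (\<Sum>i\<in>UNIV. cvec (vdir k) $ i * fourier u k $ i)"

definition field_seq :: "real \<Rightarrow> (real ^ 3 \<Rightarrow> real ^ 3) \<Rightarrow> mseq" where
  "field_seq s u = mk_mseq (\<lambda>k. if k \<in> Mfreq then of_real (weight s k) * vdir_coeff u k else 0)"

lemma cvec_nth [simp]: "cvec v $ i = of_real (v $ i)"
  by (simp add: cvec_def)

lemma norm_smult_cvec: "norm (c *s cvec v) = norm c * norm v"
proof -
  have "(norm (c *s cvec v))\<^sup>2 = (norm c * norm v)\<^sup>2"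
    by (simp add: power2_norm_eq_inner inner_vec_def power_mult_distrib sum_distrib_left)
      (simp add: inner_complex_def cmod_power2 power2_eq_square algebra_simps)
  then show ?thesis by (simp add: power2_eq_iff_nonneg)
qed

lemma weight_square: "(weight s k)\<^sup>2 = (4 * pi\<^sup>2 * (norm (rvec k))\<^sup>2) powr s"
proof -
  have "(4 * pi\<^sup>2 * (norm (rvec k))\<^sup>2) = (2 * pi * norm (rvec k)) * (2 * pi * norm (rvec k))"
    by (simp add: power2_eq_square)
  then show ?thesis unfolding weight_def power2_eq_square by (simp only: powr_mult)
qed

lemma vdir_coeff_smult:
  assumes "k \<in> Mfreq" "fourier u k = c *s cvec (vdir k)" shows "vdir_coeff u k = c"
proof -
  have "vdir k \<bullet> vdir k = 1" using norm_vdir[OF assms(1)] by (simp add: norm_eq_1)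
  then have "(\<Sum>i\<in>UNIV. complex_of_real (vdir k $ i * vdir k $ i)) = 1"
    by (simp only: of_real_sum[symmetric] inner_vec_def inner_real_def of_real_1)
  then show ?thesis
    by (simp add: vdir_coeff_def assms(2) mult.left_commute flip: sum_distrib_left)
qed

lemma HdotM_fourier: "u \<in> HdotM s \<Longrightarrow> k \<in> Mfreq \<Longrightarrow> fourier u k = vdir_coeff u k *s cvec (vdir k)"
  using vdir_coeff_smult unfolding HdotM_def by blast

lemma field_seq_represents:
  assumes u: "u \<in> HdotM s" shows "represents s u (field_seq s u)"
proof -
  let ?f = "\<lambda>k. if k \<in> Mfreq then of_real (weight s k) * vdir_coeff u k else 0"
  have "hermitian ?f"
    unfolding hermitian_def vdir_coeff_def by (simp add: fourier_hermitian)
  moreover have "(\<lambda>k. (norm (?f k))\<^sup>2) summable_on UNIV"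
  proof -
    have "Hdot_weight s u summable_on (UNIV - {0})" using u by (auto simp: HdotM_def Hdot_def)
    then have "Hdot_weight s u summable_on Mfreq" by (rule summable_on_subset) auto
    moreover have "Hdot_weight s u k = (norm (?f k))\<^sup>2" if "k \<in> Mfreq" for k
      using that HdotM_fourier[OF u that] norm_vdir[OF that] weight_pos[OF that, of s]
      by (simp add: Hdot_weight_def weight_square[symmetric] norm_smult_cvec norm_mult power_mult_distrib)
    ultimately have "(\<lambda>k. (norm (?f k))\<^sup>2) summable_on Mfreq" by (simp cong: summable_on_cong)
    then show ?thesis by (subst summable_on_cong_neutral[where S = UNIV and T = Mfreq]) auto
  qed
  ultimately have e: "coef (field_seq s u) = ?f" unfolding field_seq_def by (intro mk_mseq_inverse) (simp add: mseq_set_def)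
  show ?thesis unfolding represents_def e
  proof
    fix k
    show "fourier u k = (?f k / of_real (weight s k)) *s cvec (vdir k)"
    proof (cases "k \<in> Mfreq")
      case True
      then show ?thesis using HdotM_fourier[OF u True] weight_pos[OF True, of s] by simp
    next
      case False
      then show ?thesis using u by (simp add: HdotM_def)
    qed
  qed
qed

lemma represents_weight:
  assumes "represents s f x" shows "Hdot_weight s f k = (norm (coef x k))\<^sup>2"
proof (cases "k \<in> Mfreq")
  case True
  then show ?thesis using assms norm_vdir[OF True] weight_pos[OF True, of s]
    by (simp add: Hdot_weight_def weight_square[symmetric] represents_def norm_smult_cvec norm_divide power_divide)
next
  case False
  then show ?thesis using assms by (simp add: Hdot_weight_def represents_def coef_props(2))
qed

text \<open>The correspondence is isometric, so limits in the Sobolev norm become limits in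
  \<open>mseq\<close>.\<close>

lemma represents_norm:
  assumes "represents s f x" shows "Hdot_norm s f = norm x"
proof -
  have "(\<Sum>\<^sub>\<infinity>k\<in>UNIV - {0}. Hdot_weight s f k) = (\<Sum>\<^sub>\<infinity>k. (norm (coef x k))\<^sup>2)"
    using represents_weight[OF assms] coef_props(2)[of 0 x] by (intro infsum_cong_neutral) auto
  then show ?thesis unfolding Hdot_norm_def norm_mseq_sq[symmetric] by simp
qed

lemma represents_diff:
  assumes "represents s f x" "represents s g y"
    and "\<And>j. integrable torus (\<lambda>t. f t $ j)" "\<And>j. integrable torus (\<lambda>t. g t $ j)"
  shows "represents s (\<lambda>t. f t - g t) (x - y)"
  unfolding represents_def
proof
  fix k
  have "fourier (\<lambda>t. f t - g t) k = fourier f k - fourier g k"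
    by (intro fourier_diff assms)
  also have "\<dots> = (coef (x - y) k / of_real (weight s k)) *s cvec (vdir k)"
    using assms(1,2) unfolding represents_def
    by (simp only: vec_eq_iff vector_minus_component vector_smult_component coef_simps diff_divide_distrib left_diff_distrib) simp
  finally show "fourier (\<lambda>t. f t - g t) k = (coef (x - y) k / of_real (weight s k)) *s cvec (vdir k)" .
qed

lemma represents_scaleR:
  assumes "represents s f x" shows "represents s (\<lambda>t. c *\<^sub>R f t) (c *\<^sub>R x)"
  unfolding represents_def
proof
  fix k
  have "fourier (\<lambda>t. c *\<^sub>R f t) k = c *\<^sub>R fourier f k" by (rule fourier_scaleR)
  also have "\<dots> = (coef (c *\<^sub>R x) k / of_real (weight s k)) *s cvec (vdir k)"
    using assms unfolding represents_def vec_eq_iff vector_scaleR_component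
    by (simp add: scaleR_conv_of_real mult.assoc)
  finally show "fourier (\<lambda>t. c *\<^sub>R f t) k = (coef (c *\<^sub>R x) k / of_real (weight s k)) *s cvec (vdir k)" .
qed

lemma represents_diff_quotient:
  assumes "represents s f x" "represents s g y" "represents s h z" "L2_field f" "L2_field g" "L2_field h"
  shows "represents s (\<lambda>t. c *\<^sub>R (f t - g t) - h t) (c *\<^sub>R (x - y) - z)"
proof (intro represents_diff represents_scaleR assms)
  fix j
  have "integrable torus (\<lambda>t. c * (f t $ j - g t $ j))"
    using L2_field_integrable[OF assms(4), of j] L2_field_integrable[OF assms(5), of j] by simp
  then show "integrable torus (\<lambda>t. (c *\<^sub>R (f t - g t)) $ j)" by simp
qed (intro L2_field_integrable assms)+

section \<open>Summability of the coefficients and synthesis of fields\<close>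

lemma field_coeffs_hermitian: "hermitian (field_coeffs s x j)"
  using coef_props(1)[of x] by (simp add: hermitian_def field_coeffs_def scaled_def)

abbreviation abssummable2 :: "(int ^ 3 \<Rightarrow> complex) \<Rightarrow> bool" where
  "abssummable2 a \<equiv> (\<lambda>k. (1 + norm (rvec k))\<^sup>2 * norm (a k)) summable_on UNIV"

lemma abssummable2_imp: 
  assumes "abssummable2 a" shows "abssummable1 a" "abssummable1 (fdiff i a)"
proof -
  have "(\<lambda>k. norm ((1 + norm (rvec k)) * norm (a k))) summable_on UNIV"
  proof (rule Infinite_Sum.abs_summable_on_comparison_test'[OF assms])
    show "norm ((1 + norm (rvec k)) * norm (a k)) \<le> (1 + norm (rvec k))\<^sup>2 * norm (a k)" for k
      unfolding power2_eq_square by (simp add: mult_right_mono algebra_simps)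
  qed
  then show "abssummable1 a" by (simp add: abs_mult)
  have "(\<lambda>k. norm ((1 + norm (rvec k)) * norm (fdiff i a k))) summable_on UNIV"
  proof (rule Infinite_Sum.abs_summable_on_comparison_test'[OF summable_on_cmult_right[OF assms, of "2 * pi"]])
    fix k
    have "\<bar>real_of_int (k $ i)\<bar> \<le> 1 + norm (rvec k)" using norm_rvec_component[of k i] by simp
    then have le: "((1 + norm (rvec k)) * norm (a k) * (2 * pi)) * \<bar>real_of_int (k $ i)\<bar> \<le> ((1 + norm (rvec k)) * norm (a k) * (2 * pi)) * (1 + norm (rvec k))"
      by (rule mult_left_mono) simp
    have "norm ((1 + norm (rvec k)) * norm (fdiff i a k)) = (1 + norm (rvec k)) * norm (fdiff i a k)"
      by (simp only: real_norm_def abs_of_nonneg norm_ge_zero add_nonneg_nonneg zero_le_one mult_nonneg_nonneg)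
    also have "\<dots> = (1 + norm (rvec k)) * (2 * pi * \<bar>real_of_int (k $ i)\<bar> * norm (a k))"
      by (simp add: fdiff_def norm_mult)
    also have "\<dots> = ((1 + norm (rvec k)) * norm (a k) * (2 * pi)) * \<bar>real_of_int (k $ i)\<bar>"
      by (simp only: mult_ac)
    also note le
    also have "((1 + norm (rvec k)) * norm (a k) * (2 * pi)) * (1 + norm (rvec k)) = 2 * pi * ((1 + norm (rvec k))\<^sup>2 * norm (a k))"
      by (simp only: power2_eq_square mult_ac)
    finally show "norm ((1 + norm (rvec k)) * norm (fdiff i a k)) \<le> 2 * pi * ((1 + norm (rvec k))\<^sup>2 * norm (a k))" .
  qed
  then show "abssummable1 (fdiff i a)" by (simp add: abs_mult)
qed

lemma weight_quotient:
  assumes k: "k \<in> Mfreq" and s: "2 < s"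
  shows "(1 + norm (rvec k))\<^sup>2 / weight s k \<le> 4 * norm (rvec k) powr (- (s - 2))"
proof -
  define N where "N = norm (rvec k)"
  have N: "1 \<le> N" using Mfreq_norm_ge_1[OF k] by (simp add: N_def)
  have "1 * N \<le> (2 * pi) * N" using pi_ge_two N by (intro mult_right_mono) auto
  then have w: "N powr s \<le> weight s k" unfolding weight_def N_def[symmetric] using s N by (intro powr_mono2) auto
  have "(1 + N)\<^sup>2 \<le> (2 * N)\<^sup>2" using N by (intro power_mono) auto
  then have "(1 + N)\<^sup>2 / weight s k \<le> (4 * N\<^sup>2) / N powr s"
    using w N by (intro frac_le) (auto simp: power_mult_distrib)
  also have "\<dots> = 4 * (N powr 2 / N powr s)" using N by simp
  also have "N powr 2 / N powr s = N powr (- (s - 2))" by (simp add: powr_diff[symmetric])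
  finally show ?thesis by (simp add: N_def)
qed

text \<open>Each coefficient is at most \<open>norm x\<close> over the weight; two powers of |k|
  against |k|^s leave a negative power, which is summable over the lacunary set. This gives two
  continuous derivatives.\<close>

lemma field_coeffs_summable:
  assumes s: "2 < s" shows "abssummable2 (field_coeffs s x j)"
proof -
  have "(\<lambda>k. norm ((1 + norm (rvec k))\<^sup>2 * norm (field_coeffs s x j k))) summable_on Mfreq"
  proof (rule Infinite_Sum.abs_summable_on_comparison_test')
    show "(\<lambda>k. (4 * norm x) * norm (rvec k) powr (- (s - 2))) summable_on Mfreq"
      using s by (intro summable_on_cmult_right summable_norm_powr_Mfreq) auto
    fix k assume k: "k \<in> Mfreq"
    have "\<bar>vdir k $ j\<bar> \<le> 1" using component_le_norm_cart[of "vdir k" j] norm_vdir_le[of k] by linarith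
    then have "norm (field_coeffs s x j k) \<le> norm (coef x k) / weight s k * 1"
      unfolding field_coeffs_def scaled_def norm_mult norm_divide norm_of_real
      using weight_pos[OF k, of s] by (intro mult_mono) auto
    also have "\<dots> \<le> norm x / weight s k"
      using norm_coef_le[of x k] weight_pos[OF k, of s] by (simp add: divide_right_mono)
    finally have "(1 + norm (rvec k))\<^sup>2 * norm (field_coeffs s x j k) \<le> (1 + norm (rvec k))\<^sup>2 * (norm x / weight s k)"
      by (intro mult_left_mono) auto
    also have "\<dots> = (1 + norm (rvec k))\<^sup>2 / weight s k * norm x" by simp
    also have "\<dots> \<le> 4 * norm (rvec k) powr (- (s - 2)) * norm x"
      by (intro mult_right_mono weight_quotient k s) auto
    finally show "norm ((1 + norm (rvec k))\<^sup>2 * norm (field_coeffs s x j k)) \<le> (4 * norm x) * norm (rvec k) powr (- (s - 2))"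
      by (simp add: mult_ac)
  qed
  then have "(\<lambda>k. (1 + norm (rvec k))\<^sup>2 * norm (field_coeffs s x j k)) summable_on Mfreq" by simp
  then show ?thesis
    by (subst summable_on_cong_neutral[where S = UNIV and T = Mfreq]) (auto simp: field_coeffs_def scaled_def coef_props(2))
qed

lemmas field_coeffs_summable1 = abssummable2_imp(1)[OF field_coeffs_summable]
lemmas field_coeffs_summable0 = abssummable1_imp[OF field_coeffs_summable1]

text \<open>The passage back from sequences to fields. It turns a solution of the equation in
  \<open>mseq\<close> into a solution of the original equation, as the continuation argument
  requires.\<close>

definition synth :: "real \<Rightarrow> mseq \<Rightarrow> real ^ 3 \<Rightarrow> real ^ 3" where
  "synth s x = vfseries (field_coeffs s x)"

lemma synth_represents: "2 < s \<Longrightarrow> represents s (synth s x) x"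
  unfolding represents_def synth_def
  by (simp add: fourier_vfseries field_coeffs_summable0 field_coeffs_hermitian)
    (simp add: vec_eq_iff field_coeffs_def scaled_def)

lemma synth_L2: "2 < s \<Longrightarrow> L2_field (synth s x)"
  unfolding synth_def by (intro L2_field_continuous continuous_vfseries periodic_vfseries field_coeffs_summable0)

lemma synth_HdotM:
  assumes s: "2 < s" shows "synth s x \<in> HdotM s"
proof -
  have r: "represents s (synth s x) x" by (rule synth_represents[OF s])
  have "(\<lambda>k. (norm (coef x k))\<^sup>2) summable_on (UNIV - {0})"
    by (rule summable_on_subset[OF coef_props(3)]) auto
  then have "Hdot_weight s (synth s x) summable_on (UNIV - {0})"
    using represents_weight[OF r] by (simp cong: summable_on_cong)
  moreover have "(LINT t|torus. synth s x t) = 0"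
    unfolding synth_def
    by (intro LINT_vfseries field_coeffs_summable0 s field_coeffs_hermitian)
       (simp add: field_coeffs_def scaled_def coef_props(2))
  moreover have "fourier (synth s x) k = 0" if "k \<notin> Mfreq" for k
    using r coef_props(2)[OF that, of x] by (simp add: represents_def)
  ultimately show ?thesis using r synth_L2[OF s] unfolding HdotM_def Hdot_def represents_def by blast
qed

lemma represents_fourier: "represents s f x \<Longrightarrow> fourier f k $ j = field_coeffs s x j k"
  by (simp add: represents_def field_coeffs_def scaled_def)

lemma represents_AE:
  assumes "2 < s" "represents s f x" "L2_field f"
  shows "AE t in torus. synth s x t = f t"
  unfolding synth_def
  by (intro L2_field_eq_vfseries assms field_coeffs_summable0 field_coeffs_hermitian represents_fourier)

lemma represents_cont_rep:
  assumes "2 < s" "represents s f x" "L2_field f"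
  shows "cont_rep f = vfseries (field_coeffs s x)"
  by (intro cont_rep_vfseries assms field_coeffs_summable0 field_coeffs_hermitian represents_fourier)

text \<open>The convolution collapses to \<open>partners k\<close> because coefficients vanish off
  \<open>Mfreq\<close>. The sums over components then factor into the two inner products of
  \<open>interaction\<close>.\<close>

lemma vdir_coeff_advection:
  assumes s: "2 < s" and r: "represents s f x" "L2_field f" and k: "k \<in> Mfreq"
  shows "vdir_coeff (advection f) k = interaction (scaled s x) (scaled s x) k"
proof -
  let ?a = "field_coeffs s x" and ?c = "scaled s x"
  have fa: "fourier (advection f) k $ j = (\<Sum>i\<in>UNIV. \<Sum>p\<in>partners k. ?a i p * fdiff i (?a j) (k - p))" for j
  proof -
    have "(\<Sum>\<^sub>\<infinity>p. ?a i p * fdiff i (?a j) (k - p)) = (\<Sum>\<^sub>\<infinity>p\<in>partners k. ?a i p * fdiff i (?a j) (k - p))" for i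
      by (rule infsum_cong_neutral) (auto simp: partners_def field_coeffs_def scaled_def fdiff_def coef_props(2))
    then show ?thesis
      unfolding fourier_advection[OF represents_cont_rep[OF s r] field_coeffs_summable1[OF s] field_coeffs_hermitian]
      using partners_finite[OF k] by simp
  qed
  have "vdir_coeff (advection f) k = (\<Sum>j\<in>UNIV. \<Sum>i\<in>UNIV. \<Sum>p\<in>partners k. of_real (vdir k $ j) * (?a i p * fdiff i (?a j) (k - p)))"
    unfolding vdir_coeff_def fa by (simp add: sum_distrib_left)
  also have "\<dots> = (\<Sum>j\<in>UNIV. \<Sum>p\<in>partners k. \<Sum>i\<in>UNIV. of_real (vdir k $ j) * (?a i p * fdiff i (?a j) (k - p)))"
    by (intro sum.cong refl sum.swap)
  also have "\<dots> = (\<Sum>p\<in>partners k. \<Sum>j\<in>UNIV. \<Sum>i\<in>UNIV. of_real (vdir k $ j) * (?a i p * fdiff i (?a j) (k - p)))"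
    by (rule sum.swap)
  also have "\<dots> = interaction ?c ?c k"
    unfolding interaction_def
  proof (intro sum.cong refl)
    fix p
    let ?C = "2 * pi * \<i> * (?c p * ?c (k - p))"
    have "(\<Sum>j\<in>UNIV. \<Sum>i\<in>UNIV. of_real (vdir k $ j) * (?a i p * fdiff i (?a j) (k - p))) =
      (\<Sum>j\<in>UNIV. \<Sum>i\<in>UNIV. ?C * (of_real (vdir (k - p) $ j * vdir k $ j) * of_real (vdir p $ i * rvec (k - p) $ i)))"
      by (intro sum.cong refl) (simp add: field_coeffs_def fdiff_def mult_ac del: rvec_simps(4))
    also have "\<dots> = ?C * (of_real (\<Sum>j\<in>UNIV. vdir (k - p) $ j * vdir k $ j) * of_real (\<Sum>i\<in>UNIV. vdir p $ i * rvec (k - p) $ i))"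
      by (simp only: sum_distrib_left[symmetric] sum_distrib_right[symmetric] of_real_sum)
    also have "\<dots> = 2 * pi * \<i> * of_real ((vdir p \<bullet> rvec (k - p)) * (vdir (k - p) \<bullet> vdir k)) * (?c p * ?c (k - p))"
      by (simp add: inner_vec_def mult_ac del: rvec_simps(4))
    finally show "(\<Sum>j\<in>UNIV. \<Sum>i\<in>UNIV. of_real (vdir k $ j) * (?a i p * fdiff i (?a j) (k - p))) =
      2 * pi * \<i> * of_real ((vdir p \<bullet> rvec (k - p)) * (vdir (k - p) \<bullet> vdir k)) * (?c p * ?c (k - p))" .
  qed
  finally show ?thesis .
qed

lemma coef_euler:
  assumes s: "2 < s"
  shows "coef (euler_bilinear s x x) k = (if k \<in> Mfreq then of_real (weight s k) * interaction (scaled s x) (scaled s x) k else 0)"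
  using s by (simp add: coef_euler_bilinear scaled_def[abs_def])

text \<open>\<open>vdir k\<close> is nonzero on \<open>Mfreq\<close>, so coefficients along it can
  be compared as scalars. At each time this turns the restricted Euler equation into an equation in
  \<open>mseq\<close>.\<close>

lemma is_projM_iff:
  assumes s: "2 < s" and f: "represents s f x" "L2_field f" and g: "represents s g y" "L2_field g"
  shows "is_projM (advection f) (\<lambda>t. - g t) \<longleftrightarrow> y = - euler_bilinear s x x"
proof -
  have L: "L2_field (\<lambda>t. - g t)"
    using g(2) by (auto simp: L2_field_def periodic_def)
  have "(fourier (\<lambda>t. - g t) k = (if k \<in> Mfreq then vdir_coeff (advection f) k *s cvec (vdir k) else 0)) \<longleftrightarrow>
    coef y k = - coef (euler_bilinear s x x) k" for k
  proof (cases "k \<in> Mfreq")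
    case True
    have "\<exists>j. vdir k $ j \<noteq> 0"
    proof (rule ccontr)
      assume "\<not> (\<exists>j. vdir k $ j \<noteq> 0)"
      then have "vdir k = 0" by (simp add: vec_eq_iff)
      then show False using norm_vdir[OF True] by simp
    qed
    then have inj: "a *s cvec (vdir k) = b *s cvec (vdir k) \<longleftrightarrow> a = b" for a b
      by (auto simp: vec_eq_iff)
    have "- ((coef y k / of_real (weight s k)) *s cvec (vdir k)) = (- (coef y k / of_real (weight s k))) *s cvec (vdir k)"
      by (simp add: vec_eq_iff)
    then have "fourier (\<lambda>t. - g t) k = (- (coef y k / of_real (weight s k))) *s cvec (vdir k)"
      using g(1) unfolding fourier_minus represents_def by simp
    moreover have "- (c / of_real (weight s k)) = z \<longleftrightarrow> c = - (of_real (weight s k) * z)" for c z :: complex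
    proof -
      have "- (c / of_real (weight s k)) = z \<longleftrightarrow> c / of_real (weight s k) = - z" by (metis minus_minus)
      also have "\<dots> \<longleftrightarrow> c = - z * of_real (weight s k)"
        using weight_pos[OF True, of s] by (intro nonzero_divide_eq_eq) simp
      finally show ?thesis by (simp add: mult.commute)
    qed
    ultimately show ?thesis
      by (simp only: True if_True coef_euler[OF s] vdir_coeff_advection[OF s f True] inj)
  next
    case False
    then show ?thesis using g(1) by (simp add: fourier_minus represents_def coef_props(2))
  qed
  then show ?thesis
    using L unfolding is_projM_def vdir_coeff_def[symmetric]
    by (metis coef_simps(3) mseq_eqI)
qed

text \<open>Brings the derivative into the form of the difference quotients in
  \<open>C1_HdotM\<close>. The point r = t, where the quotient has its default value, is invisible
  to the filter.\<close>

lemma has_vector_derivative_iff_norm_quotient: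
  fixes f :: "real \<Rightarrow> 'a::real_normed_vector"
  shows "(f has_vector_derivative d) (at t within S) \<longleftrightarrow>
    ((\<lambda>r. norm ((1 / (r - t)) *\<^sub>R (f r - f t) - d)) \<longlongrightarrow> 0) (at t within S)"
proof -
  have e: "norm ((1 / norm (r - t)) *\<^sub>R (f r - (f t + (r - t) *\<^sub>R d))) = norm ((1 / (r - t)) *\<^sub>R (f r - f t) - d)" if "r \<noteq> t" for r
  proof -
    have "(1 / (r - t)) *\<^sub>R (f r - f t) - d = (1 / (r - t)) *\<^sub>R (f r - (f t + (r - t) *\<^sub>R d))"
    proof -
      have "(1 / (r - t)) *\<^sub>R ((r - t) *\<^sub>R d) = d" using that by simp
      then show ?thesis by (simp only: scaleR_diff_right scaleR_add_right) simp
    qed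
    then show ?thesis by simp
  qed
  have "(f has_vector_derivative d) (at t within S) \<longleftrightarrow>
    ((\<lambda>r. (1 / norm (r - t)) *\<^sub>R (f r - (f t + (r - t) *\<^sub>R d))) \<longlongrightarrow> 0) (at t within S)"
    unfolding has_vector_derivative_def has_derivative_within by (auto simp: bounded_linear_scaleR_left)
  also have "\<dots> \<longleftrightarrow> ((\<lambda>r. norm ((1 / norm (r - t)) *\<^sub>R (f r - (f t + (r - t) *\<^sub>R d)))) \<longlongrightarrow> 0) (at t within S)"
    by (rule tendsto_norm_zero_iff[symmetric])
  also have "\<dots> \<longleftrightarrow> ((\<lambda>r. norm ((1 / (r - t)) *\<^sub>R (f r - f t) - d)) \<longlongrightarrow> 0) (at t within S)"
    by (rule filterlim_cong[OF refl refl]) (use e in \<open>auto simp: eventually_at_filter\<close>)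
  finally show ?thesis .
qed

text \<open>By linearity and isometry, the difference quotients of the fields and of their sequences
  have equal norms at all times of the interval.\<close>

lemma C1_iff:
  assumes r: "\<And>t. t \<in> time_interval T \<Longrightarrow> represents s (u t) (U t) \<and> represents s (du t) (dU t) \<and> u t \<in> HdotM s \<and> du t \<in> HdotM s"
  shows "C1_HdotM s T u du \<longleftrightarrow> (\<forall>t\<in>time_interval T. (U has_vector_derivative dU t) (at t within time_interval T))
      \<and> continuous_on (time_interval T) dU"
proof -
  have L: "L2_field (u t)" "L2_field (du t)" if "t \<in> time_interval T" for t
    using r[OF that] by (auto simp: HdotM_def Hdot_def)
  have q: "Hdot_norm s (\<lambda>x. (1 / (r - t)) *\<^sub>R (u r x - u t x) - du t x) = norm ((1 / (r - t)) *\<^sub>R (U r - U t) - dU t)"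
    if "t \<in> time_interval T" "r \<in> time_interval T" for t r
    by (intro represents_norm represents_diff_quotient) (use assms[of t] assms[of r] that L in auto)
  have c: "Hdot_norm s (\<lambda>x. du r x - du t x) = norm (dU r - dU t)"
    if "t \<in> time_interval T" "r \<in> time_interval T" for t r
    by (intro represents_norm represents_diff L2_field_integrable) (use assms[of t] assms[of r] that L in auto)
  have 1: "((\<lambda>r. Hdot_norm s (\<lambda>x. (1 / (r - t)) *\<^sub>R (u r x - u t x) - du t x)) \<longlongrightarrow> 0) (at t within time_interval T) \<longleftrightarrow>
      (U has_vector_derivative dU t) (at t within time_interval T)" if t: "t \<in> time_interval T" for t
    unfolding has_vector_derivative_iff_norm_quotient
    by (rule filterlim_cong[OF refl refl]) (use q[OF t] in \<open>auto simp: eventually_at_filter\<close>)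
  have 2: "((\<lambda>r. Hdot_norm s (\<lambda>x. du r x - du t x)) \<longlongrightarrow> 0) (at t within time_interval T) \<longleftrightarrow>
      (dU \<longlongrightarrow> dU t) (at t within time_interval T)" if t: "t \<in> time_interval T" for t
  proof -
    have "((\<lambda>r. Hdot_norm s (\<lambda>x. du r x - du t x)) \<longlongrightarrow> 0) (at t within time_interval T) \<longleftrightarrow>
      ((\<lambda>r. norm (dU r - dU t)) \<longlongrightarrow> 0) (at t within time_interval T)"
      by (rule filterlim_cong[OF refl refl]) (use c[OF t] in \<open>auto simp: eventually_at_filter\<close>)
    then show ?thesis by (simp add: tendsto_norm_zero_iff LIM_zero_iff)
  qed
  show ?thesis unfolding C1_HdotM_def continuous_on_def using 1 2 r by blast
qed

abbreviation minus_euler :: "real \<Rightarrow> mseq \<Rightarrow> mseq \<Rightarrow> mseq" where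
  "minus_euler s \<equiv> (\<lambda>x y. - euler_bilinear s x y)"

lemma bounded_bilinear_minus_euler: "1 \<le> s \<Longrightarrow> bounded_bilinear (minus_euler s)"
  using bounded_bilinear.comp[OF bounded_bilinear_euler bounded_linear_minus[OF bounded_linear_ident] bounded_linear_ident, of s]
  by (simp add: bounded_bilinear.minus_left[OF bounded_bilinear_euler])

lemma restricted_Euler_solution_solves:
  assumes s: "2 < s" and sol: "restricted_Euler_solution s T u"
  shows "solves (minus_euler s) (\<lambda>t. field_seq s (u t)) (time_interval T)"
    and "t \<in> time_interval T \<Longrightarrow> u t \<in> HdotM s"
proof -
  obtain du where C1: "C1_HdotM s T u du"
    and eq: "\<And>t. t \<in> time_interval T \<Longrightarrow> is_projM (advection (u t)) (\<lambda>x. - du t x)"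
    using sol by (auto simp: restricted_Euler_solution_def)
  have H: "u t \<in> HdotM s" "du t \<in> HdotM s" if "t \<in> time_interval T" for t
    using C1 that by (auto simp: C1_HdotM_def)
  then show "t \<in> time_interval T \<Longrightarrow> u t \<in> HdotM s" by blast
  have d: "(field_seq s \<circ> u has_vector_derivative field_seq s (du t)) (at t within time_interval T)" if "t \<in> time_interval T" for t
    using C1_iff[of T s u "field_seq s \<circ> u" du "field_seq s \<circ> du"] C1 that H field_seq_represents by auto
  have "field_seq s (du t) = - euler_bilinear s (field_seq s (u t)) (field_seq s (u t))" if t: "t \<in> time_interval T" for t
    using is_projM_iff[OF s field_seq_represents[OF H(1)[OF t]] _ field_seq_represents[OF H(2)[OF t]]] eq[OF t] H[OF t]
    by (auto simp: HdotM_def Hdot_def)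
  then show "solves (minus_euler s) (\<lambda>t. field_seq s (u t)) (time_interval T)"
    unfolding solves_def using d by (simp add: o_def)
qed

lemma solves_restricted_Euler_solution:
  assumes s: "2 < s" and U: "solves (minus_euler s) U (time_interval T)"
  shows "restricted_Euler_solution s T (\<lambda>t. synth s (U t))"
  unfolding restricted_Euler_solution_def
proof (intro exI[of _ "\<lambda>t. synth s (minus_euler s (U t) (U t))"] conjI ballI)
  have "continuous_on (time_interval T) U"
    using U unfolding solves_def continuous_on_eq_continuous_within by (auto intro: has_vector_derivative_continuous)
  then have "continuous_on (time_interval T) (\<lambda>t. minus_euler s (U t) (U t))"
    using s by (intro bounded_bilinear.continuous_on[OF bounded_bilinear_minus_euler]) auto
  then show "C1_HdotM s T (\<lambda>t. synth s (U t)) (\<lambda>t. synth s (minus_euler s (U t) (U t)))"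
    using U C1_iff[of T s "\<lambda>t. synth s (U t)" U "\<lambda>t. synth s (minus_euler s (U t) (U t))" "\<lambda>t. minus_euler s (U t) (U t)"]
      synth_represents[OF s] synth_HdotM[OF s] by (simp add: solves_def)
  fix t
  show "is_projM (advection (synth s (U t))) (\<lambda>x. - synth s (minus_euler s (U t) (U t)) x)"
    using is_projM_iff[OF s synth_represents[OF s] synth_L2[OF s] synth_represents[OF s] synth_L2[OF s]] by blast
qed

text \<open>A bounded norm would let the sequence be continued past T, and \<open>synth\<close>
  would turn the continuation into a solution that contradicts maximality.\<close>

lemma maximal_solution_norm_unbounded:
  assumes s: "2 < s" and max: "maximal_restricted_Euler_solution s (ereal T) u"
    and K: "\<And>t. t \<in> {0..<T} \<Longrightarrow> norm (field_seq s (u t)) \<le> K"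
  shows False
proof -
  have ti: "time_interval (ereal T) = {0..<T}" for T by (auto simp: time_interval_def)
  have T: "0 < T" and sol: "restricted_Euler_solution s (ereal T) u"
    using max by (auto simp: maximal_restricted_Euler_solution_def)
  note S = restricted_Euler_solution_solves[OF s sol, unfolded ti]
  have "bounded_bilinear (minus_euler s)" using s by (intro bounded_bilinear_minus_euler) auto
  then obtain T' V where T': "T < T'" and V: "solves (minus_euler s) V {0..<T'}"
    and eq: "\<And>t. t \<in> {0..<T} \<Longrightarrow> V t = field_seq s (u t)"
    using quadratic_ode_continuation[OF _ T S(1) K] by blast
  have "restricted_Euler_solution s (ereal T') (\<lambda>t. synth s (V t))"
    by (intro solves_restricted_Euler_solution s) (use V ti in auto)
  \<comment> \<open>Agreement with u is almost everywhere, since \<open>synth\<close> selects the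
    continuous representative.\<close>
  moreover have "AE x in torus. synth s (V t) x = u t x" if t: "t \<in> {0..<T}" for t
    unfolding eq[OF t] using S(2)[OF t] field_seq_represents[OF S(2)[OF t]]
    by (intro represents_AE s) (auto simp: HdotM_def Hdot_def)
  ultimately have "\<exists>T'' v. ereal T < T'' \<and> restricted_Euler_solution s T'' v \<and>
      (\<forall>t\<in>time_interval (ereal T). AE x in torus. v t x = u t x)"
    using T' by (intro exI[of _ "ereal T'"] exI[of _ "\<lambda>t. synth s (V t)"]) (simp add: ti)
  then show False using max unfolding maximal_restricted_Euler_solution_def by blast
qed

section \<open>The enstrophy identity\<close>

text \<open>Its norm is the L^2 norm of the gradient. As a bounded linear map into
  \<open>mseq\<close> it makes the enstrophy half a squared norm, which can be differentiated along
  the solution.\<close>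

definition gradient_seq :: "real \<Rightarrow> mseq \<Rightarrow> mseq" where
  "gradient_seq s x = mk_mseq (\<lambda>k. of_real (2 * pi * norm (rvec k)) * scaled s x k)"

lemma coef_gradient_seq:
  assumes s: "1 \<le> s"
  shows "coef (gradient_seq s x) k = of_real (2 * pi * norm (rvec k)) * scaled s x k"
    and "norm (gradient_seq s x) \<le> norm x"
proof -
  let ?f = "\<lambda>k. of_real (2 * pi * norm (rvec k)) * scaled s x k"
  have le: "norm (?f k) \<le> norm (coef x k)" if k: "k \<in> Mfreq" for k
  proof -
    have "norm (?f k) = (2 * pi * norm (rvec k) / weight s k) * norm (coef x k)"
      using weight_pos[OF k, of s] by (simp add: scaled_def norm_mult norm_divide)
    also have "\<dots> \<le> 1 * norm (coef x k)"
      using weight_ge[OF k s] weight_pos[OF k, of s] by (intro mult_right_mono) auto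
    finally show ?thesis by simp
  qed
  have b: "(\<Sum>k\<in>F. (norm (?f k))\<^sup>2) \<le> (norm x)\<^sup>2" if F: "finite F" "F \<subseteq> Mfreq" for F
  proof -
    have "(\<Sum>k\<in>F. (norm (?f k))\<^sup>2) \<le> (\<Sum>k\<in>F. (norm (coef x k))\<^sup>2)"
      using F le by (intro sum_mono power_mono) auto
    also have "\<dots> \<le> (norm x)\<^sup>2" by (rule sum_coef_le[OF F(1)])
    finally show ?thesis .
  qed
  have h: "hermitian ?f" using coef_props(1)[of x] by (simp add: hermitian_def scaled_def)
  have z: "?f k = 0" if "k \<notin> Mfreq" for k using that by (simp add: scaled_def coef_props(2))
  from mk_mseq[OF h z b norm_ge_zero] show "coef (gradient_seq s x) k = ?f k" "norm (gradient_seq s x) \<le> norm x"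
    unfolding gradient_seq_def by auto
qed

lemma bounded_linear_gradient_seq: "1 \<le> s \<Longrightarrow> bounded_linear (gradient_seq s)"
proof (rule bounded_linear_intro[where K = 1])
  fix x y r assume s: "1 \<le> s"
  show "gradient_seq s (x + y) = gradient_seq s x + gradient_seq s y"
    by (rule mseq_eqI) (simp add: coef_gradient_seq[OF s] scaled_def add_divide_distrib distrib_left)
  show "gradient_seq s (r *\<^sub>R x) = r *\<^sub>R gradient_seq s x"
    by (rule mseq_eqI) (simp add: coef_gradient_seq[OF s] scaled_def)
  show "norm (gradient_seq s x) \<le> norm x * 1" using coef_gradient_seq(2)[OF s] by simp
qed

section \<open>Parseval's identity and product rules under the integral\<close>

lemma parseval_fseries:
  assumes a: "abssummable a" "hermitian a" and b: "abssummable b" "hermitian b"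
  shows "complex_of_real (LINT x|torus. fseries a x * fseries b x) = (\<Sum>\<^sub>\<infinity>k. a k * cnj (b k))"
    and "(\<lambda>k. a k * cnj (b k)) summable_on UNIV"
proof -
  have i: "integrable torus (\<lambda>x. complex_of_real (fseries b x))"
    by (intro continuous_integrable_torus continuous_intros continuous_fseries b)
  have c: "(LINT x|torus. wave k x * complex_of_real (fseries b x)) = cnj (b k)" for k
    using fourier_coeff_fseries[OF b, of "- k"] b(2) by (simp add: hermitian_def mult.commute)
  have "complex_of_real (LINT x|torus. fseries a x * fseries b x) = (LINT x|torus. complex_of_real (fseries a x) * complex_of_real (fseries b x))"
    by (simp flip: integral_complex_of_real)
  then show "complex_of_real (LINT x|torus. fseries a x * fseries b x) = (\<Sum>\<^sub>\<infinity>k. a k * cnj (b k))"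
    using LINT_fseries_mult(1)[OF a i] by (simp add: c)
  show "(\<lambda>k. a k * cnj (b k)) summable_on UNIV"
    using LINT_fseries_mult(2)[OF a i] unfolding c by (rule abs_summable_summable)
qed

lemma fseries_sum_zero:
  assumes "finite I" "\<And>i. i \<in> I \<Longrightarrow> abssummable (b i)" "\<And>k. (\<Sum>i\<in>I. b i k) = 0"
  shows "(\<Sum>i\<in>I. fseries (b i) x) = 0"
proof -
  have "((\<lambda>k. \<Sum>i\<in>I. b i k * wave k x) has_sum (\<Sum>i\<in>I. \<Sum>\<^sub>\<infinity>k. b i k * wave k x)) UNIV"
    using assms by (intro has_sum_finite_sum has_sum_infsum wave_summable)
  then have "((\<lambda>k::int^3. 0::complex) has_sum (\<Sum>i\<in>I. \<Sum>\<^sub>\<infinity>k. b i k * wave k x)) UNIV"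
    by (simp add: assms(3) flip: sum_distrib_right)
  from infsumI[OF this] have "(\<Sum>i\<in>I. \<Sum>\<^sub>\<infinity>k. b i k * wave k x) = 0" by simp
  then show ?thesis unfolding fseries_def by (simp flip: Re_sum)
qed

lemma LINT_triple_product_rule:
  assumes a: "abssummable1 a" "abssummable1 b" "abssummable1 c"
  shows "(LINT x|torus. fseries (fdiff k a) x * fseries b x * fseries c x +
     fseries a x * fseries (fdiff k b) x * fseries c x + fseries a x * fseries b x * fseries (fdiff k c) x) = 0"
proof (rule LINT_partial_derivative[where i = k and F = "\<lambda>x. fseries a x * fseries b x * fseries c x"])
  note c = continuous_fseries abssummable1_imp abssummable_fdiff a
  show "continuous_on UNIV (\<lambda>x. fseries a x * fseries b x * fseries c x)"
    by (intro continuous_intros c)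
  show "continuous_on UNIV (\<lambda>x. fseries (fdiff k a) x * fseries b x * fseries c x +
     fseries a x * fseries (fdiff k b) x * fseries c x + fseries a x * fseries b x * fseries (fdiff k c) x)"
    by (intro continuous_intros c)
  fix x
  show "((\<lambda>\<tau>. fseries a (x + \<tau> *\<^sub>R axis k 1) * fseries b (x + \<tau> *\<^sub>R axis k 1) * fseries c (x + \<tau> *\<^sub>R axis k 1))
    has_real_derivative fseries (fdiff k a) x * fseries b x * fseries c x +
     fseries a x * fseries (fdiff k b) x * fseries c x + fseries a x * fseries b x * fseries (fdiff k c) x) (at 0)"
    using DERIV_mult[OF DERIV_mult[OF has_real_derivative_fseries[OF a(1), of x k] has_real_derivative_fseries[OF a(2)]] has_real_derivative_fseries[OF a(3)]]
    by (simp add: algebra_simps)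
qed (use periodic_fseries in \<open>simp_all add: periodic_def\<close>)

lemma LINT_product_rule:
  assumes a: "abssummable1 a" "abssummable1 b"
  shows "(LINT x|torus. fseries (fdiff k a) x * fseries b x + fseries a x * fseries (fdiff k b) x) = 0"
proof (rule LINT_partial_derivative[where i = k and F = "\<lambda>x. fseries a x * fseries b x"])
  note c = continuous_fseries abssummable1_imp abssummable_fdiff a
  show "continuous_on UNIV (\<lambda>x. fseries a x * fseries b x)"
    by (intro continuous_intros c)
  show "continuous_on UNIV (\<lambda>x. fseries (fdiff k a) x * fseries b x + fseries a x * fseries (fdiff k b) x)"
    by (intro continuous_intros c)
  fix x
  show "((\<lambda>\<tau>. fseries a (x + \<tau> *\<^sub>R axis k 1) * fseries b (x + \<tau> *\<^sub>R axis k 1))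
    has_real_derivative fseries (fdiff k a) x * fseries b x + fseries a x * fseries (fdiff k b) x) (at 0)"
    using DERIV_mult[OF has_real_derivative_fseries[OF a(1), of x k] has_real_derivative_fseries[OF a(2)]]
    by (simp add: algebra_simps)
qed (use periodic_fseries in \<open>simp_all add: periodic_def\<close>)

text \<open>With \<open>A j i\<close> $= \partial_i u_j$ and \<open>H j i k\<close> $= \partial_k \partial_i u_j$, the next two lemmas
  collect the terms of $-\Delta u \cdot (u \cdot \nabla) u - 4 \det S$ without and with second
  derivatives; the fractions come from the null Lagrangian $\mathrm{tr}\,(\nabla u)^3$, since
  $\mathrm{tr}(A A^T A) = 4 \det S - \frac13 \mathrm{tr} A^3$ when $\mathrm{tr} A = 0$.\<close>

lemma cubic_strain_identity:
  fixes A :: "3 \<Rightarrow> 3 \<Rightarrow> real"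
  assumes tr: "(\<Sum>i\<in>UNIV. A i i) = 0"
  shows "(\<Sum>i\<in>UNIV. \<Sum>j\<in>UNIV. \<Sum>k\<in>UNIV. - (A j k * A i k * A j i) + A k k * A j i * A j i / 2
      - A j k * A i j * A k i / 3 + A k k * A i j * A j i / 6) =
    - 4 * det (\<chi> j i. (A j i + A i j) / 2)"
proof -
  have "A 3 3 = - A 1 1 - A 2 2" using tr by (simp add: sum_3)
  then show ?thesis by (simp add: sum_3 det_3) (simp add: field_simps)
qed

lemma transport_cancellation:
  fixes A :: "3 \<Rightarrow> 3 \<Rightarrow> real" and H :: "3 \<Rightarrow> 3 \<Rightarrow> 3 \<Rightarrow> real" and u :: "3 \<Rightarrow> real"
  assumes sym: "\<And>j i k. H j i k = H j k i" and tr: "\<And>k. (\<Sum>i\<in>UNIV. H i i k) = 0"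
  shows "(\<Sum>i\<in>UNIV. \<Sum>j\<in>UNIV. \<Sum>k\<in>UNIV. - (A j k * u i * H j i k) + (u k * H j i k * A j i + u k * A j i * H j i k) / 2
      - (u j * H i j k * A k i + u j * A i j * H k i k) / 3 + (u k * H i j k * A j i + u k * A i j * H j i k) / 6) = 0"
proof -
  \<comment> \<open>Symmetry and vanishing trace eliminate the dependent second derivatives; what
    remains is a polynomial identity in independent quantities.\<close>
  have s: "H j 2 1 = H j 1 2" "H j 3 1 = H j 1 3" "H j 3 2 = H j 2 3" for j by (auto simp: sym)
  have t: "H 3 1 3 = - H 1 1 1 - H 2 1 2" "H 3 2 3 = - H 1 1 2 - H 2 2 2" "H 3 3 3 = - H 1 1 3 - H 2 2 3"
    using tr[of 1] tr[of 2] tr[of 3] s by (simp_all add: sum_3)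
  show ?thesis by (simp add: sum_3 s t) (simp add: field_simps)
qed

section \<open>Derivatives of a field as functions on the torus, and the enstrophy identity\<close>

abbreviation vel :: "real \<Rightarrow> mseq \<Rightarrow> 3 \<Rightarrow> real ^ 3 \<Rightarrow> real" where
  "vel s x j \<equiv> fseries (field_coeffs s x j)"

abbreviation grad :: "real \<Rightarrow> mseq \<Rightarrow> 3 \<Rightarrow> 3 \<Rightarrow> real ^ 3 \<Rightarrow> real" where
  "grad s x j i \<equiv> fseries (fdiff i (field_coeffs s x j))"

abbreviation hess :: "real \<Rightarrow> mseq \<Rightarrow> 3 \<Rightarrow> 3 \<Rightarrow> 3 \<Rightarrow> real ^ 3 \<Rightarrow> real" where
  "hess s x j i k \<equiv> fseries (fdiff k (fdiff i (field_coeffs s x j)))"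

lemma field_coeffs_fdiff_summable1: "2 < s \<Longrightarrow> abssummable1 (fdiff i (field_coeffs s x j))"
  by (intro abssummable2_imp(2) field_coeffs_summable)

lemma continuous_vel: "2 < s \<Longrightarrow> continuous_on UNIV (vel s x j)"
  by (intro continuous_fseries field_coeffs_summable0)

lemma continuous_grad: "2 < s \<Longrightarrow> continuous_on UNIV (grad s x j i)"
  by (intro continuous_fseries abssummable1_imp field_coeffs_fdiff_summable1)

lemma continuous_hess: "2 < s \<Longrightarrow> continuous_on UNIV (hess s x j i k)"
  by (intro continuous_fseries abssummable_fdiff field_coeffs_fdiff_summable1)

lemma field_coeffs_divergence: "(\<Sum>i\<in>UNIV. fdiff i (field_coeffs s x i) k) = 0"
proof -
  have "(\<Sum>i\<in>UNIV. fdiff i (field_coeffs s x i) k) = 2 * pi * \<i> * scaled s x k * of_real (vdir k \<bullet> rvec k)"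
    by (simp add: fdiff_def field_coeffs_def inner_vec_def sum_distrib_left mult_ac)
  then show ?thesis by (simp add: vdir_orthogonal)
qed

lemma grad_trace: "2 < s \<Longrightarrow> (\<Sum>i\<in>UNIV. grad s x i i t) = 0"
  by (intro fseries_sum_zero abssummable1_imp field_coeffs_fdiff_summable1) (auto simp: field_coeffs_divergence)

lemma hess_trace: "2 < s \<Longrightarrow> (\<Sum>i\<in>UNIV. hess s x i i k t) = 0"
proof (intro fseries_sum_zero abssummable_fdiff field_coeffs_fdiff_summable1)
  fix l
  have "(\<Sum>i\<in>UNIV. fdiff k (fdiff i (field_coeffs s x i)) l) = 2 * pi * \<i> * of_int (l $ k) * (\<Sum>i\<in>UNIV. fdiff i (field_coeffs s x i) l)"
    unfolding fdiff_def[of k] by (simp add: sum_distrib_left)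
  then show "(\<Sum>i\<in>UNIV. fdiff k (fdiff i (field_coeffs s x i)) l) = 0" by (simp add: field_coeffs_divergence)
qed auto

lemma hess_symmetric: "hess s x j i k = hess s x j k i"
  by (simp add: fdiff_commute)

lemma strain_represents:
  assumes "2 < s" "represents s f x" "L2_field f"
  shows "strain f t = (\<chi> j i. (grad s x j i t + grad s x i j t) / 2)"
  unfolding strain_def jacobian_vfseries[OF represents_cont_rep[OF assms] field_coeffs_summable1[OF assms(1)]]
  by (simp add: vec_eq_iff transpose_def add_divide_distrib)

lemma norm_matrix_square: "(norm (M :: real ^ 3 ^ 3))\<^sup>2 = (\<Sum>j\<in>UNIV. \<Sum>i\<in>UNIV. (M $ j $ i)\<^sup>2)"
  unfolding power2_norm_eq_inner inner_vec_def by (simp add: power2_eq_square)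

text \<open>The two integrands differ by the index sum of \<open>Q\<close>, a combination of exact
  derivatives of cubic expressions, each with integral 0. The two algebraic identities above supply
  the pointwise equality.\<close>

lemma LINT_laplacian_advection:
  assumes s: "2 < s"
  shows "(LINT t|torus. (\<Sum>j\<in>UNIV. - (\<Sum>k\<in>UNIV. hess s x j k k t) * (\<Sum>i\<in>UNIV. vel s x i t * grad s x j i t))) =
    (LINT t|torus. 4 * det (\<chi> j i. (grad s x j i t + grad s x i j t) / 2))"
proof -
  note c = continuous_vel[OF s] continuous_grad[OF s] continuous_hess[OF s]
  note sm = field_coeffs_summable1[OF s] field_coeffs_fdiff_summable1[OF s]
  \<comment> \<open>With A_ji for the i-th derivative of u_j, \<open>T1\<close> to \<open>T4\<close>
    expand the k-th derivatives of A_jk u_i A_ji, u_k A_ji A_ji, u_j A_ij A_ki and u_k A_ij A_ji.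
    The first moves a derivative off the Laplacian, the second is the transport of |A|^2, the last
    two account for the trace of A^3.\<close>
  define T1 where "T1 i j k t = hess s x j k k t * vel s x i t * grad s x j i t + grad s x j k t * grad s x i k t * grad s x j i t
    + grad s x j k t * vel s x i t * hess s x j i k t" for i j k t
  define T2 where "T2 i j k t = grad s x k k t * grad s x j i t * grad s x j i t + vel s x k t * hess s x j i k t * grad s x j i t
    + vel s x k t * grad s x j i t * hess s x j i k t" for i j k t
  define T3 where "T3 i j k t = grad s x j k t * grad s x i j t * grad s x k i t + vel s x j t * hess s x i j k t * grad s x k i t
    + vel s x j t * grad s x i j t * hess s x k i k t" for i j k t
  define T4 where "T4 i j k t = grad s x k k t * grad s x i j t * grad s x j i t + vel s x k t * hess s x i j k t * grad s x j i t
    + vel s x k t * grad s x i j t * hess s x j i k t" for i j k t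
  have z: "(LINT t|torus. T1 i j k t) = 0" "(LINT t|torus. T2 i j k t) = 0" "(LINT t|torus. T3 i j k t) = 0" "(LINT t|torus. T4 i j k t) = 0" for i j k
    unfolding T1_def T2_def T3_def T4_def by (intro LINT_triple_product_rule sm)+
  have ct: "continuous_on UNIV (T1 i j k)" "continuous_on UNIV (T2 i j k)" "continuous_on UNIV (T3 i j k)" "continuous_on UNIV (T4 i j k)" for i j k
    unfolding T1_def T2_def T3_def T4_def by (intro continuous_intros c)+
  have it: "integrable torus (T1 i j k)" "integrable torus (T2 i j k)" "integrable torus (T3 i j k)" "integrable torus (T4 i j k)" for i j k
    by (intro continuous_integrable_torus ct)+
  define Q where "Q i j k t = - T1 i j k t + T2 i j k t / 2 - T3 i j k t / 3 + T4 i j k t / 6" for i j k t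
  have Q: "(LINT t|torus. Q i j k t) = 0" "integrable torus (Q i j k)" for i j k
    unfolding Q_def using it[of i j k] z[of i j k] by simp_all
  let ?L = "\<lambda>t. \<Sum>j\<in>UNIV. - (\<Sum>k\<in>UNIV. hess s x j k k t) * (\<Sum>i\<in>UNIV. vel s x i t * grad s x j i t)"
  let ?D = "\<lambda>t. 4 * det (\<chi> j i. (grad s x j i t + grad s x i j t) / 2)"
  have pointwise: "(\<Sum>i\<in>UNIV. \<Sum>j\<in>UNIV. \<Sum>k\<in>UNIV. Q i j k t) = ?L t - ?D t" for t
  proof -
    let ?A = "\<lambda>j i. grad s x j i t" and ?H = "\<lambda>j i k. hess s x j i k t" and ?u = "\<lambda>i. vel s x i t"
    have cub: "(\<Sum>i\<in>UNIV. \<Sum>j\<in>UNIV. \<Sum>k\<in>UNIV. - (?A j k * ?A i k * ?A j i) + ?A k k * ?A j i * ?A j i / 2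
      - ?A j k * ?A i j * ?A k i / 3 + ?A k k * ?A i j * ?A j i / 6) = - ?D t"
      using cubic_strain_identity[of ?A] grad_trace[OF s] by simp
    have tra: "(\<Sum>i\<in>UNIV. \<Sum>j\<in>UNIV. \<Sum>k\<in>UNIV. - (?A j k * ?u i * ?H j i k) + (?u k * ?H j i k * ?A j i + ?u k * ?A j i * ?H j i k) / 2
      - (?u j * ?H i j k * ?A k i + ?u j * ?A i j * ?H k i k) / 3 + (?u k * ?H i j k * ?A j i + ?u k * ?A i j * ?H j i k) / 6) = 0"
      by (rule transport_cancellation) (simp_all add: hess_trace[OF s] fdiff_commute)
    have lap: "(\<Sum>i\<in>UNIV. \<Sum>j\<in>UNIV. \<Sum>k\<in>UNIV. - (?H j k k * ?u i * ?A j i)) = ?L t"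
    proof -
      have "?L t = (\<Sum>j\<in>UNIV. \<Sum>k\<in>UNIV. \<Sum>i\<in>UNIV. - (?H j k k * ?u i * ?A j i))"
        by (simp add: sum_product sum_negf mult.assoc)
      also have "\<dots> = (\<Sum>j\<in>UNIV. \<Sum>i\<in>UNIV. \<Sum>k\<in>UNIV. - (?H j k k * ?u i * ?A j i))"
        by (intro sum.cong refl sum.swap)
      also have "\<dots> = (\<Sum>i\<in>UNIV. \<Sum>j\<in>UNIV. \<Sum>k\<in>UNIV. - (?H j k k * ?u i * ?A j i))" by (rule sum.swap)
      finally show ?thesis by simp
    qed
    have Q: "Q i j k t = - (?H j k k * ?u i * ?A j i)
       + (- (?A j k * ?A i k * ?A j i) + ?A k k * ?A j i * ?A j i / 2 - ?A j k * ?A i j * ?A k i / 3 + ?A k k * ?A i j * ?A j i / 6)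
       + (- (?A j k * ?u i * ?H j i k) + (?u k * ?H j i k * ?A j i + ?u k * ?A j i * ?H j i k) / 2
         - (?u j * ?H i j k * ?A k i + ?u j * ?A i j * ?H k i k) / 3 + (?u k * ?H i j k * ?A j i + ?u k * ?A i j * ?H j i k) / 6)" for i j k
      unfolding Q_def T1_def T2_def T3_def T4_def add_divide_distrib by linarith
    have "(\<Sum>i\<in>UNIV. \<Sum>j\<in>UNIV. \<Sum>k\<in>UNIV. X i j k + Y i j k + Z i j k) = (\<Sum>i\<in>UNIV. \<Sum>j\<in>UNIV. \<Sum>k\<in>UNIV. X i j k) +
      (\<Sum>i\<in>UNIV. \<Sum>j\<in>UNIV. \<Sum>k\<in>UNIV. Y i j k) + (\<Sum>i\<in>UNIV. \<Sum>j\<in>UNIV. \<Sum>k\<in>UNIV. Z i j k)" for X Y Z :: "3 \<Rightarrow> 3 \<Rightarrow> 3 \<Rightarrow> real"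
      by (simp only: sum.distrib)
    then show ?thesis unfolding Q cub tra lap by (simp only: cub tra lap)
  qed
  have iL: "integrable torus ?L" by (intro continuous_integrable_torus continuous_intros c)
  have iD: "integrable torus ?D" unfolding det_3 by (intro continuous_integrable_torus continuous_intros c) (simp_all add: c continuous_intros)
  have "(LINT t|torus. ?L t) - (LINT t|torus. ?D t) = (LINT t|torus. (\<Sum>i\<in>UNIV. \<Sum>j\<in>UNIV. \<Sum>k\<in>UNIV. Q i j k t))"
    unfolding pointwise using iL iD by simp
  also have "\<dots> = 0" using Q by simp
  finally show ?thesis by simp
qed

text \<open>Pointwise |S|^2 is half of |A|^2 plus half of A_ji A_ij summed over indices. After one
  integration by parts the second part contains a derivative of the divergence and vanishes;
  Parseval evaluates the first.\<close>

lemma strain_norm_eq: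
  assumes s: "2 < s" and f: "represents s f x" "L2_field f"
  shows "(L2_norm (strain f))\<^sup>2 = (norm (gradient_seq s x))\<^sup>2 / 2"
proof -
  note c = continuous_vel[OF s] continuous_grad[OF s] continuous_hess[OF s]
  note sm = field_coeffs_summable1[OF s] field_coeffs_fdiff_summable1[OF s]
  let ?A = "\<lambda>t j i. grad s x j i t"
  have n: "(norm (strain f t))\<^sup>2 = (\<Sum>j\<in>UNIV. \<Sum>i\<in>UNIV. ?A t j i * ?A t j i) / 2 + (\<Sum>j\<in>UNIV. \<Sum>i\<in>UNIV. ?A t j i * ?A t i j) / 2" for t
    unfolding norm_matrix_square strain_represents[OF s f] by (simp add: sum_3 power2_eq_square) (simp add: field_simps)
  have ij: "integrable torus (\<lambda>t. ?A t j i * ?A t k l)" for i j k l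
    by (intro continuous_integrable_torus continuous_intros c)
  have iu: "integrable torus (\<lambda>t. vel s x j t * hess s x i j i t)" for i j
    by (intro continuous_integrable_torus continuous_intros c)
  have cross: "(\<Sum>j\<in>UNIV. \<Sum>i\<in>UNIV. LINT t|torus. ?A t j i * ?A t i j) = 0"
  proof -
    have "(LINT t|torus. ?A t j i * ?A t i j) = - (LINT t|torus. vel s x j t * hess s x i j i t)" for i j
      using LINT_product_rule[OF sm(1)[of x j] sm(2)[of j x i], of i] ij[of i j j i] iu[of j i] by simp
    moreover have "(\<Sum>i\<in>UNIV. LINT t|torus. vel s x j t * hess s x i j i t) = 0" for j
    proof -
      have "(\<Sum>i\<in>UNIV. LINT t|torus. vel s x j t * hess s x i j i t) = (LINT t|torus. (\<Sum>i\<in>UNIV. vel s x j t * hess s x i j i t))"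
        using iu by simp
      also have "(\<lambda>t. \<Sum>i\<in>UNIV. vel s x j t * hess s x i j i t) = (\<lambda>t. 0)"
      proof -
        have sym: "hess s x i j i = hess s x i i j" for i by (rule hess_symmetric)
        show ?thesis unfolding sym by (simp add: hess_trace[OF s] flip: sum_distrib_left)
      qed
      finally show ?thesis by simp
    qed
    ultimately show ?thesis by (simp add: sum_negf)
  qed
  have diag: "(\<Sum>j\<in>UNIV. \<Sum>i\<in>UNIV. LINT t|torus. ?A t j i * ?A t j i) = (norm (gradient_seq s x))\<^sup>2"
  proof -
    let ?F = "\<lambda>j i k. fdiff i (field_coeffs s x j) k"
    have hs: "((\<lambda>k. ?F j i k * cnj (?F j i k)) has_sum of_real (LINT t|torus. ?A t j i * ?A t j i)) UNIV" for j i
    proof -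
      note P = parseval_fseries[OF abssummable1_imp[OF sm(2)[of i x j]] hermitian_fdiff[OF field_coeffs_hermitian]
        abssummable1_imp[OF sm(2)[of i x j]] hermitian_fdiff[OF field_coeffs_hermitian]]
      show ?thesis unfolding P(1) by (rule has_sum_infsum[OF P(2)])
    qed
    have "((\<lambda>k. \<Sum>j\<in>UNIV. \<Sum>i\<in>UNIV. ?F j i k * cnj (?F j i k)) has_sum (\<Sum>j\<in>UNIV. \<Sum>i\<in>UNIV. of_real (LINT t|torus. ?A t j i * ?A t j i))) UNIV"
      by (intro has_sum_finite_sum hs) auto
    moreover have "(\<Sum>j\<in>UNIV. \<Sum>i\<in>UNIV. ?F j i k * cnj (?F j i k)) = of_real ((norm (coef (gradient_seq s x) k))\<^sup>2)" for k
    proof -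
      have "(\<Sum>j\<in>UNIV. \<Sum>i\<in>UNIV. ?F j i k * cnj (?F j i k)) =
        (\<Sum>j\<in>UNIV. \<Sum>i\<in>UNIV. of_real ((2 * pi)\<^sup>2 * (norm (scaled s x k))\<^sup>2 * ((vdir k $ j * vdir k $ j) * (rvec k $ i * rvec k $ i))))"
        by (intro sum.cong refl, simp add: fdiff_def field_coeffs_def power_mult_distrib mult_ac complex_norm_square[unfolded of_real_power],
            simp add: power2_eq_square)
      also have "\<dots> = of_real ((2 * pi)\<^sup>2 * (norm (scaled s x k))\<^sup>2 * ((vdir k \<bullet> vdir k) * (rvec k \<bullet> rvec k)))"
        unfolding of_real_sum[symmetric] sum_distrib_left[symmetric] sum_distrib_right[symmetric] by (simp only: inner_vec_def inner_real_def)
      also have "\<dots> = of_real ((norm (coef (gradient_seq s x) k))\<^sup>2)"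
      proof (cases "k \<in> Mfreq")
        case True
        then have "vdir k \<bullet> vdir k = 1" using norm_vdir[OF True] by (simp add: norm_eq_1)
        then show ?thesis using s
          by (simp add: coef_gradient_seq norm_mult power_mult_distrib power2_norm_eq_inner[of "rvec k"] mult_ac)
      next
        case False
        then show ?thesis using s by (simp add: coef_gradient_seq scaled_def coef_props(2))
      qed
      finally show ?thesis .
    qed
    ultimately have "((\<lambda>k. complex_of_real ((norm (coef (gradient_seq s x) k))\<^sup>2)) has_sum of_real (\<Sum>j\<in>UNIV. \<Sum>i\<in>UNIV. LINT t|torus. ?A t j i * ?A t j i)) UNIV"
      by simp
    moreover have "((\<lambda>k. complex_of_real ((norm (coef (gradient_seq s x) k))\<^sup>2)) has_sum of_real ((norm (gradient_seq s x))\<^sup>2)) UNIV"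
      unfolding norm_mseq_sq by (intro has_sum_of_real has_sum_infsum coef_props)
    ultimately show ?thesis using has_sum_unique of_real_eq_iff by blast
  qed
  have "(L2_norm (strain f))\<^sup>2 = (LINT t|torus. (norm (strain f t))\<^sup>2)"
    unfolding L2_norm_def by (intro real_sqrt_pow2 integral_nonneg_AE) auto
  also have "\<dots> = (\<Sum>j\<in>UNIV. \<Sum>i\<in>UNIV. LINT t|torus. ?A t j i * ?A t j i) / 2 + (\<Sum>j\<in>UNIV. \<Sum>i\<in>UNIV. LINT t|torus. ?A t j i * ?A t i j) / 2"
    unfolding n using ij by simp
  finally show ?thesis by (simp add: cross diag)
qed

text \<open>Minus the Laplacian multiplies mode k by a scalar, and u has only a
  \<open>vdir k\<close> component there. So pairing with the advection sees exactly the component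
  that the projection keeps, and the projection drops out.\<close>

lemma inner_gradient_euler:
  assumes s: "2 < s"
  shows "gradient_seq s x \<bullet> gradient_seq s (euler_bilinear s x x) =
    (LINT t|torus. (\<Sum>j\<in>UNIV. - (\<Sum>k\<in>UNIV. hess s x j k k t) * (\<Sum>i\<in>UNIV. vel s x i t * grad s x j i t)))"
proof -
  note c = continuous_vel[OF s] continuous_grad[OF s] continuous_hess[OF s]
  note sm = field_coeffs_summable1[OF s] field_coeffs_fdiff_summable1[OF s]
  let ?f = "synth s x" and ?W = "\<lambda>j t. \<Sum>i\<in>UNIV. vel s x i t * grad s x j i t"
  have f: "represents s ?f x" "L2_field ?f" using synth_represents[OF s] synth_L2[OF s] by auto
  have adv: "advection ?f t $ j = ?W j t" for t j
    using advection_vfseries[OF represents_cont_rep[OF s f] sm(1)] by simp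
  have cW: "continuous_on UNIV (?W j)" for j by (intro continuous_intros c)
  have wave_adv: "(LINT t|torus. wave k t * complex_of_real (?W j t)) = cnj (fourier (advection ?f) k $ j)" for k j
    unfolding fourier_hermitian[symmetric] by (simp add: fourier_component adv mult.commute)
  let ?G = "\<lambda>j i k. fdiff i (fdiff i (field_coeffs s x j)) k"
  have i: "integrable torus (\<lambda>t. hess s x j i i t * ?W j t)" for j i
    by (intro continuous_integrable_torus continuous_intros c cW)
  have hs: "((\<lambda>k. - (?G j i k * cnj (fourier (advection ?f) k $ j))) has_sum - of_real (LINT t|torus. hess s x j i i t * ?W j t)) UNIV" for j i
  proof -
    have "integrable torus (\<lambda>t. complex_of_real (?W j t))" by (intro continuous_integrable_torus continuous_on_of_real cW)
    note L = LINT_fseries_mult[OF abssummable_fdiff[OF sm(2)[of i x j], of i] hermitian_fdiff[OF hermitian_fdiff[OF field_coeffs_hermitian]] this, unfolded wave_adv]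
    have "((\<lambda>k. ?G j i k * cnj (fourier (advection ?f) k $ j)) has_sum (LINT t|torus. complex_of_real (hess s x j i i t) * complex_of_real (?W j t))) UNIV"
      unfolding L(1) by (rule has_sum_infsum[OF abs_summable_summable[OF L(2)]])
    also have "(LINT t|torus. complex_of_real (hess s x j i i t) * complex_of_real (?W j t)) = of_real (LINT t|torus. hess s x j i i t * ?W j t)"
      unfolding integral_complex_of_real[symmetric] of_real_mult ..
    finally have "((\<lambda>k. ?G j i k * cnj (fourier (advection ?f) k $ j)) has_sum of_real (LINT t|torus. hess s x j i i t * ?W j t)) UNIV" .
    then show ?thesis unfolding has_sum_uminus minus_minus .
  qed
  have "((\<lambda>k. \<Sum>j\<in>UNIV. \<Sum>i\<in>UNIV. - (?G j i k * cnj (fourier (advection ?f) k $ j))) has_sum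
     (\<Sum>j\<in>UNIV. \<Sum>i\<in>UNIV. - of_real (LINT t|torus. hess s x j i i t * ?W j t))) UNIV"
    by (intro has_sum_finite_sum hs) auto
  moreover have "(\<Sum>j\<in>UNIV. \<Sum>i\<in>UNIV. - complex_of_real (LINT t|torus. hess s x j i i t * ?W j t)) =
    of_real (LINT t|torus. (\<Sum>j\<in>UNIV. - (\<Sum>k\<in>UNIV. hess s x j k k t) * ?W j t))"
  proof -
    have "(LINT t|torus. (\<Sum>j\<in>UNIV. - (\<Sum>k\<in>UNIV. hess s x j k k t) * ?W j t)) =
      (LINT t|torus. (\<Sum>j\<in>UNIV. - (\<Sum>k\<in>UNIV. hess s x j k k t * ?W j t)))"
      by (simp add: sum_distrib_right)
    also have "\<dots> = (\<Sum>j\<in>UNIV. \<Sum>k\<in>UNIV. - (LINT t|torus. hess s x j k k t * ?W j t))"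
      using i by (simp add: sum_negf)
    finally show ?thesis by (simp only: of_real_sum of_real_minus)
  qed
  moreover have "(\<Sum>j\<in>UNIV. \<Sum>i\<in>UNIV. - (?G j i k * cnj (fourier (advection ?f) k $ j))) =
    coef (gradient_seq s x) k * cnj (coef (gradient_seq s (euler_bilinear s x x)) k)" for k
  proof -
    have "(\<Sum>j\<in>UNIV. \<Sum>i\<in>UNIV. - (?G j i k * cnj (fourier (advection ?f) k $ j))) =
      (\<Sum>j\<in>UNIV. \<Sum>i\<in>UNIV. ((2 * pi)\<^sup>2 * scaled s x k) * (cnj (of_real (vdir k $ j) * fourier (advection ?f) k $ j) * of_real (rvec k $ i * rvec k $ i)))"
      by (intro sum.cong refl) (simp add: fdiff_def field_coeffs_def power2_eq_square mult_ac)
    also have "\<dots> = ((2 * pi)\<^sup>2 * scaled s x k) * (cnj (vdir_coeff (advection ?f) k) * of_real (rvec k \<bullet> rvec k))"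
      unfolding sum_distrib_left[symmetric] sum_distrib_right[symmetric] vdir_coeff_def cnj_sum of_real_sum[symmetric]
      by (simp only: inner_vec_def inner_real_def cvec_nth)
    also have "\<dots> = coef (gradient_seq s x) k * cnj (coef (gradient_seq s (euler_bilinear s x x)) k)"
    proof (cases "k \<in> Mfreq")
      case True
      then show ?thesis using s weight_pos[OF True, of s]
        by (simp add: coef_gradient_seq vdir_coeff_advection[OF s f True] scaled_def[of s "euler_bilinear s x x"] coef_euler[OF s]
          power2_norm_eq_inner[symmetric] power2_eq_square mult_ac)
    next
      case False
      then show ?thesis using s by (simp add: coef_gradient_seq scaled_def coef_props(2))
    qed
    finally show ?thesis .
  qed
  ultimately have "((\<lambda>k. coef (gradient_seq s x) k * cnj (coef (gradient_seq s (euler_bilinear s x x)) k)) has_sum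
    of_real (LINT t|torus. (\<Sum>j\<in>UNIV. - (\<Sum>k\<in>UNIV. hess s x j k k t) * ?W j t))) UNIV" by simp
  from has_sum_Re[OF this] show ?thesis
    unfolding inner_mseq_def by (intro infsumI) simp
qed

lemma enstrophy_production:
  assumes "2 < s" "represents s f x" "L2_field f"
  shows "gradient_seq s x \<bullet> gradient_seq s (euler_bilinear s x x) = (LINT t|torus. 4 * det (strain f t))"
  unfolding inner_gradient_euler[OF assms(1)] LINT_laplacian_advection[OF assms(1)] strain_represents[OF assms] ..

section \<open>The middle eigenvalue\<close>

text \<open>The smallest and the largest root are determined by the polynomial and the ordering; the
  middle one then follows by cancellation.\<close>

lemma ordered_eigenvalues_unique:
  assumes "ordered_eigenvalues A a b c" "ordered_eigenvalues A a' b' c'"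
  shows "a = a'" "b = b'" "c = c'"
proof -
  have e: "(z - a) * (z - b) * (z - c) = (z - a') * (z - b') * (z - c')" for z
    using assms unfolding ordered_eigenvalues_def by metis
  have o: "a \<le> b" "b \<le> c" "a' \<le> b'" "b' \<le> c'" using assms by (auto simp: ordered_eigenvalues_def)
  have "a = a' \<or> a = b' \<or> a = c'" using e[of a] by auto
  moreover have "a' = a \<or> a' = b \<or> a' = c" using e[of a'] by auto
  ultimately show a: "a = a'" using o by linarith
  have "c = a' \<or> c = b' \<or> c = c'" using e[of c] by auto
  moreover have "c' = a \<or> c' = b \<or> c' = c" using e[of c'] by auto
  ultimately show c: "c = c'" using o by linarith
  \<comment> \<open>At \<open>c' + 1\<close> the two common linear factors are at least 1 and
    cancel.\<close>
  show "b = b'" using e[of "c' + 1"] o unfolding a c by auto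
qed

text \<open>Evaluating the characteristic polynomial at 0, 1 and -1 recovers Vieta's formulas, so no
  diagonalisation is involved. For a traceless symmetric matrix |S|^2 is -2 times the second
  elementary symmetric function of the eigenvalues.\<close>

lemma ordered_eigenvalues_traceless:
  fixes S :: "real ^ 3 ^ 3"
  assumes S: "ordered_eigenvalues S a b c" and sym: "\<And>i j. S $ i $ j = S $ j $ i" and tr: "(\<Sum>i\<in>UNIV. S $ i $ i) = 0"
  shows "a + b + c = 0" "det S = a * b * c" "(norm S)\<^sup>2 = a\<^sup>2 + b\<^sup>2 + c\<^sup>2"
proof -
  have s: "S $ 2 $ 1 = S $ 1 $ 2" "S $ 3 $ 1 = S $ 1 $ 3" "S $ 3 $ 2 = S $ 2 $ 3" by (auto simp: sym)
  have t: "S $ 3 $ 3 = - S $ 1 $ 1 - S $ 2 $ 2" using tr by (simp add: sum_3)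
  have e: "det (mat z - S) = (z - a) * (z - b) * (z - c)" for z
    using S by (auto simp: ordered_eigenvalues_def)
  \<comment> \<open>The sum of the principal 2 by 2 minors, with the last diagonal entry eliminated
    through the trace.\<close>
  define e2 where "e2 = S $ 1 $ 1 * S $ 2 $ 2 - (S $ 1 $ 1 + S $ 2 $ 2) * (S $ 1 $ 1 + S $ 2 $ 2) - S $ 1 $ 2 * S $ 1 $ 2 - S $ 1 $ 3 * S $ 1 $ 3 - S $ 2 $ 3 * S $ 2 $ 3"
  have d: "det (mat z - S) = z * z * z + e2 * z - det S" for z
    by (simp add: det_3 mat_def s t e2_def) (simp add: algebra_simps)
  have 0: "det S = a * b * c" using e[of 0] d[of 0] by simp
  have 1: "1 + e2 - det S = (1 - a) * (1 - b) * (1 - c)" using e[of 1] d[of 1] by simp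
  have 2: "- 1 - e2 - det S = (- 1 - a) * (- 1 - b) * (- 1 - c)" using e[of "-1"] d[of "-1"] by simp
  show "det S = a * b * c" by fact
  show abc: "a + b + c = 0" using 1 2 0 by (simp add: algebra_simps)
  then have c: "c = - a - b" by simp
  have "e2 = a * b + b * c + a * c" using 1 0 abc by (simp add: algebra_simps)
  moreover have "(norm S)\<^sup>2 = - 2 * e2"
    unfolding norm_matrix_square by (simp add: sum_3 s t e2_def) (simp add: power2_eq_square algebra_simps)
  ultimately show "(norm S)\<^sup>2 = a\<^sup>2 + b\<^sup>2 + c\<^sup>2" unfolding c by (simp add: power2_eq_square algebra_simps)
qed

text \<open>If b \<le> 0, then a b and c are nonnegative and the left side has the right sign. If b
  > 0, the bound is -2 a c \<le> a^2 + c^2 multiplied by 2 b.\<close>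

lemma det_le_middle_eigenvalue:
  fixes a b c :: real
  assumes "a \<le> b" "b \<le> c" "a + b + c = 0"
  shows "- (4 * (a * b * c)) \<le> 2 * max b 0 * (a\<^sup>2 + b\<^sup>2 + c\<^sup>2)"
proof (cases "b \<le> 0")
  case True
  then have "0 \<le> a * b" "0 \<le> c" using assms by (auto simp: mult_nonpos_nonpos)
  then have "0 \<le> a * b * c" by (rule mult_nonneg_nonneg)
  then show ?thesis using True by simp
next
  case False
  have "0 \<le> (a + c)\<^sup>2" by (rule zero_le_power2)
  also have "(a + c)\<^sup>2 = a\<^sup>2 + c\<^sup>2 + 2 * (a * c)" by (simp add: power2_sum)
  finally have "- (2 * (a * c)) \<le> a\<^sup>2 + b\<^sup>2 + c\<^sup>2" using zero_le_power2[of b] by linarith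
  then have "(2 * b) * - (2 * (a * c)) \<le> (2 * b) * (a\<^sup>2 + b\<^sup>2 + c\<^sup>2)" using False by (intro mult_left_mono) auto
  then show ?thesis using False by (simp add: max_def mult_ac)
qed

text \<open>The ordered eigenvalues are bounded and determined by the characteristic polynomial, so their
  graph is closed; no spectral theorem is needed.\<close>

lemma continuous_middle_eigenvalue:
  fixes F :: "'a::euclidean_space \<Rightarrow> real ^ 3 ^ 3"
  assumes K: "compact K" and F: "continuous_on K F"
    and l: "\<And>z. z \<in> K \<Longrightarrow> ordered_eigenvalues (F z) (l1 z) (l2 z) (l3 z)"
    and sym: "\<And>z i j. z \<in> K \<Longrightarrow> F z $ i $ j = F z $ j $ i" and tr: "\<And>z. z \<in> K \<Longrightarrow> (\<Sum>i\<in>UNIV. F z $ i $ i) = 0"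
  shows "continuous_on K l2"
proof -
  obtain B where B: "\<And>z. z \<in> K \<Longrightarrow> norm (F z) \<le> B"
    using compact_imp_bounded[OF compact_continuous_image[OF F K]] unfolding bounded_iff by blast
  have bound: "\<bar>l1 z\<bar> \<le> B" "\<bar>l2 z\<bar> \<le> B" "\<bar>l3 z\<bar> \<le> B" if z: "z \<in> K" for z
  proof -
    have n: "(norm (F z))\<^sup>2 = (l1 z)\<^sup>2 + (l2 z)\<^sup>2 + (l3 z)\<^sup>2"
      by (rule ordered_eigenvalues_traceless(3)[OF l[OF z] sym[OF z] tr[OF z]])
    have "\<bar>y\<bar> \<le> norm (F z)" if "y\<^sup>2 \<le> (norm (F z))\<^sup>2" for y
      using that by (simp add: abs_le_square_iff[symmetric])
    then show "\<bar>l1 z\<bar> \<le> B" "\<bar>l2 z\<bar> \<le> B" "\<bar>l3 z\<bar> \<le> B" using n B[OF z] by (smt (verit) zero_le_power2)+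
  qed
  define f where "f z = (l1 z, l2 z, l3 z)" for z
  have "continuous_on K f"
  proof (rule continuous_from_closed_graph)
    show "compact ({-B..B} \<times> {-B..B} \<times> {-B..B})" by (intro compact_Times compact_Icc)
    have "y \<in> {-B..B}" if "\<bar>y\<bar> \<le> B" for y using that by auto
    then show "f \<in> K \<rightarrow> {-B..B} \<times> {-B..B} \<times> {-B..B}" using bound unfolding f_def by blast
    show "closed ((\<lambda>x. (x, f x)) ` K)"
      unfolding closed_sequential_limits
    proof (intro allI impI)
      fix X L assume "(\<forall>n. X n \<in> (\<lambda>x. (x, f x)) ` K) \<and> X \<longlonglongrightarrow> L"
      then have X: "\<And>n. X n \<in> (\<lambda>x. (x, f x)) ` K" and lim: "X \<longlonglongrightarrow> L" by auto
      obtain z a b c where L: "L = (z, a, b, c)" by (cases L) auto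
      define Z where "Z n = fst (X n)" for n
      have Z: "Z n \<in> K" "X n = (Z n, l1 (Z n), l2 (Z n), l3 (Z n))" for n
        using X[of n] by (auto simp: Z_def f_def)
      have lz: "Z \<longlonglongrightarrow> z" "(\<lambda>n. l1 (Z n)) \<longlonglongrightarrow> a" "(\<lambda>n. l2 (Z n)) \<longlonglongrightarrow> b" "(\<lambda>n. l3 (Z n)) \<longlonglongrightarrow> c"
        using tendsto_fst[OF lim] tendsto_fst[OF tendsto_snd[OF lim]] tendsto_fst[OF tendsto_snd[OF tendsto_snd[OF lim]]]
          tendsto_snd[OF tendsto_snd[OF tendsto_snd[OF lim]]] by (simp_all add: Z(2) L Z_def[symmetric])
      have zK: "z \<in> K" using compact_imp_closed[OF K] Z(1) lz(1) closed_sequentially by blast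
      have lF: "(\<lambda>n. F (Z n)) \<longlonglongrightarrow> F z"
        using continuous_on_tendsto_compose[OF F lz(1) zK] Z(1) by simp
      have ev: "det (mat w - F (Z n)) = (w - l1 (Z n)) * (w - l2 (Z n)) * (w - l3 (Z n))" for w n
        using l[OF Z(1)] by (simp add: ordered_eigenvalues_def)
      have "det (mat w - F z) = (w - a) * (w - b) * (w - c)" for w
      proof (rule LIMSEQ_unique)
        have "continuous_on UNIV (\<lambda>A :: real ^ 3 ^ 3. det (mat w - A))"
          unfolding det_3 by (intro continuous_intros)
        from continuous_on_tendsto_compose[OF this lF]
        show "(\<lambda>n. det (mat w - F (Z n))) \<longlonglongrightarrow> det (mat w - F z)" by simp
        show "(\<lambda>n. det (mat w - F (Z n))) \<longlonglongrightarrow> (w - a) * (w - b) * (w - c)"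
          unfolding ev by (intro tendsto_intros lz)
      qed
      moreover have "a \<le> b" by (rule LIMSEQ_le[OF lz(2,3)]) (use l[OF Z(1)] in \<open>auto simp: ordered_eigenvalues_def\<close>)
      moreover have "b \<le> c" by (rule LIMSEQ_le[OF lz(3,4)]) (use l[OF Z(1)] in \<open>auto simp: ordered_eigenvalues_def\<close>)
      ultimately have "ordered_eigenvalues (F z) a b c" by (simp add: ordered_eigenvalues_def)
      from ordered_eigenvalues_unique[OF this l[OF zK]] show "L \<in> (\<lambda>x. (x, f x)) ` K"
        using zK by (auto simp: L f_def)
    qed
  qed
  then have "continuous_on K (\<lambda>z. fst (snd (f z)))" by (intro continuous_intros)
  then show ?thesis by (simp add: f_def)
qed

section \<open>Joint continuity in space and time, and the sup norm as a function of time\<close>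

lemma fseries_diff:
  assumes "abssummable a" "abssummable b"
  shows "fseries (\<lambda>k. a k - b k) x = fseries a x - fseries b x"
proof -
  have "(\<lambda>k. - (b k * wave k x)) summable_on UNIV" using wave_summable[OF assms(2)] by (simp only: summable_on_uminus)
  from infsum_add[OF wave_summable[OF assms(1)] this, of x]
  have "(\<Sum>\<^sub>\<infinity>k. (a k - b k) * wave k x) = (\<Sum>\<^sub>\<infinity>k. a k * wave k x) - (\<Sum>\<^sub>\<infinity>k. b k * wave k x)"
    by (simp add: infsum_uminus left_diff_distrib)
  then show ?thesis by (simp add: fseries_def)
qed

lemma abs_fseries_le: "abssummable a \<Longrightarrow> \<bar>fseries a x\<bar> \<le> (\<Sum>\<^sub>\<infinity>k. norm (a k))"
  unfolding fseries_def
  using norm_infsum_bound[of "\<lambda>k. a k * wave k x" UNIV] abs_Re_le_cmod[of "\<Sum>\<^sub>\<infinity>k. a k * wave k x"]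
  by (simp add: norm_mult)

text \<open>The embedding into C^1: gradients are bounded uniformly in space by a multiple of the
  norm of the sequence, again by lacunary summability.\<close>

lemma grad_bound:
  assumes s: "2 < s"
  obtains Q where "\<And>y j i t. \<bar>grad s y j i t\<bar> \<le> Q * norm y"
proof
  fix y j i t
  \<comment> \<open>8 pi is 2 pi from the derivative times the 4 of
    \<open>weight_quotient\<close>.\<close>
  define q where "q k = (if k \<in> Mfreq then 8 * pi * norm (rvec k) powr (- (s - 2)) else 0)" for k
  have q: "q summable_on UNIV"
  proof -
    have "(\<lambda>k. 8 * pi * norm (rvec k) powr (- (s - 2))) summable_on Mfreq"
      using s by (intro summable_on_cmult_right summable_norm_powr_Mfreq) auto
    then show ?thesis by (subst summable_on_cong_neutral[where S = UNIV and T = Mfreq]) (auto simp: q_def)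
  qed
  have le: "norm (fdiff i (field_coeffs s y j) k) \<le> q k * norm y" for k
  proof (cases "k \<in> Mfreq")
    case True
    note w = weight_pos[OF True, of s]
    have v: "\<bar>vdir k $ j\<bar> \<le> 1" using component_le_norm_cart[of "vdir k" j] norm_vdir_le[of k] by linarith
    have "norm (fdiff i (field_coeffs s y j) k) = 2 * pi * \<bar>real_of_int (k $ i)\<bar> * (norm (coef y k) / weight s k) * \<bar>vdir k $ j\<bar>"
      using w by (simp add: fdiff_def field_coeffs_def scaled_def norm_mult norm_divide)
    also have "\<dots> \<le> 2 * pi * (1 + norm (rvec k))\<^sup>2 * (norm y / weight s k) * 1"
    proof (intro mult_mono v divide_right_mono norm_coef_le)
      have "\<bar>real_of_int (k $ i)\<bar> \<le> norm (rvec k)" by (rule norm_rvec_component)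
      also have "\<dots> \<le> (1 + norm (rvec k))\<^sup>2" by (simp add: power2_eq_square algebra_simps)
      finally show "\<bar>real_of_int (k $ i)\<bar> \<le> (1 + norm (rvec k))\<^sup>2" .
    qed (use w in auto)
    also have "\<dots> = 2 * pi * ((1 + norm (rvec k))\<^sup>2 / weight s k) * norm y" by simp
    also have "\<dots> \<le> 2 * pi * (4 * norm (rvec k) powr (- (s - 2))) * norm y"
      by (intro mult_right_mono mult_left_mono weight_quotient True s) auto
    finally show ?thesis using True by (simp add: q_def)
  next
    case False
    then show ?thesis by (simp add: fdiff_def field_coeffs_def scaled_def coef_props(2) q_def)
  qed
  have sm: "abssummable (fdiff i (field_coeffs s y j))" by (intro abssummable1_imp field_coeffs_fdiff_summable1 s)
  have "\<bar>grad s y j i t\<bar> \<le> (\<Sum>\<^sub>\<infinity>k. norm (fdiff i (field_coeffs s y j) k))" by (rule abs_fseries_le[OF sm])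
  also have "\<dots> \<le> (\<Sum>\<^sub>\<infinity>k. q k * norm y)"
    by (intro infsum_mono sm summable_on_cmult_left q le)
  also have "\<dots> = (\<Sum>\<^sub>\<infinity>k. q k) * norm y" by (rule infsum_cmult_left')
  finally show "\<bar>grad s y j i t\<bar> \<le> (\<Sum>\<^sub>\<infinity>k. if k \<in> Mfreq then 8 * pi * norm (rvec k) powr (- (s - 2)) else 0) * norm y"
    unfolding q_def .
qed

text \<open>The gradient is linear in the sequence, with a bound uniform in the point. So the change
  in time is small uniformly in space, while at a frozen time continuity in space is known.\<close>

lemma continuous_grad_joint:
  assumes s: "2 < s" and U: "continuous_on I U"
  shows "continuous_on (X \<times> I) (\<lambda>z. grad s (U (snd z)) j i (fst z))"
  unfolding continuous_on_def
proof
  fix z0 assume z0: "z0 \<in> X \<times> I"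
  obtain Q where Q: "\<And>y j i t. \<bar>grad s y j i t\<bar> \<le> Q * norm y" using grad_bound[OF s] by blast
  let ?F = "at z0 within X \<times> I"
  have sm: "abssummable (fdiff i (field_coeffs s y j))" for y by (intro abssummable1_imp field_coeffs_fdiff_summable1 s)
  have lin: "grad s (y - y') j i t = grad s y j i t - grad s y' j i t" for y y' t
  proof -
    have "fdiff i (field_coeffs s (y - y') j) = (\<lambda>k. fdiff i (field_coeffs s y j) k - fdiff i (field_coeffs s y' j) k)"
      by (rule ext) (simp add: fdiff_def field_coeffs_def scaled_def diff_divide_distrib algebra_simps)
    then show ?thesis using fseries_diff[OF sm sm] by simp
  qed
  have "continuous_on (X \<times> I) (\<lambda>z. U (snd z))"
    by (intro continuous_on_compose2[OF U continuous_on_snd[OF continuous_on_id]]) auto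
  then have "((\<lambda>z. U (snd z)) \<longlongrightarrow> U (snd z0)) ?F" using z0 by (auto simp: continuous_on_def)
  then have "((\<lambda>z. Q * norm (U (snd z) - U (snd z0))) \<longlongrightarrow> Q * norm (U (snd z0) - U (snd z0))) ?F"
    by (intro tendsto_intros)
  then have "((\<lambda>z. Q * norm (U (snd z) - U (snd z0))) \<longlongrightarrow> 0) ?F" by simp
  then have 1: "((\<lambda>z. grad s (U (snd z) - U (snd z0)) j i (fst z)) \<longlongrightarrow> 0) ?F"
    by (rule Lim_null_comparison[rotated]) (use Q in \<open>auto intro!: always_eventually\<close>)
  have "continuous_on (X \<times> I) (\<lambda>z. grad s (U (snd z0)) j i (fst z))"
    by (intro continuous_on_compose2[OF continuous_grad[OF s] continuous_on_fst[OF continuous_on_id]]) auto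
  then have 2: "((\<lambda>z. grad s (U (snd z0)) j i (fst z)) \<longlongrightarrow> grad s (U (snd z0)) j i (fst z0)) ?F"
    using z0 by (auto simp: continuous_on_def)
  show "((\<lambda>z. grad s (U (snd z)) j i (fst z)) \<longlongrightarrow> grad s (U (snd z0)) j i (fst z0)) ?F"
    using tendsto_add[OF 1 2] by (simp add: lin)
qed

text \<open>Uniform continuity on the compact product makes the sup norm continuous in time.
  \<open>g\<close> is its real version, tied both to \<open>Linf_norm\<close> and to the almost
  everywhere bound that the enstrophy estimate uses.\<close>

lemma Linf_norm_continuous:
  fixes l :: "real ^ 3 \<Rightarrow> real \<Rightarrow> real"
  assumes l: "continuous_on (cbox 0 1 \<times> {0..T}) (\<lambda>z. l (fst z) (snd z))"
  obtains g where "continuous_on {0..T} g" "\<And>\<tau>. \<tau> \<in> {0..T} \<Longrightarrow> Linf_norm (\<lambda>x. max (l x \<tau>) 0) = ennreal (g \<tau>)"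
    "\<And>\<tau>. 0 \<le> g \<tau>" "\<And>\<tau>. \<tau> \<in> {0..T} \<Longrightarrow> AE x in torus. max (l x \<tau>) 0 \<le> g \<tau>"
proof -
  let ?K = "cbox (0::real^3) 1 \<times> {0..T}"
  let ?m = "\<lambda>\<tau> x. max (l x \<tau>) 0"
  have K: "compact ?K" by (intro compact_Times compact_cbox compact_Icc)
  obtain B where B: "\<And>z. z \<in> ?K \<Longrightarrow> norm (l (fst z) (snd z)) \<le> B"
    using compact_imp_bounded[OF compact_continuous_image[OF l K]] unfolding bounded_iff by blast
  have meas: "(\<lambda>x. ennreal \<bar>?m \<tau> x\<bar>) \<in> borel_measurable torus" if \<tau>: "\<tau> \<in> {0..T}" for \<tau>
  proof -
    have "continuous_on (cbox 0 1) (\<lambda>x. (\<lambda>z. l (fst z) (snd z)) (x, \<tau>))"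
      by (rule continuous_on_compose2[OF l]) (use \<tau> in \<open>auto intro!: continuous_intros\<close>)
    then have "continuous_on (cbox 0 1) (\<lambda>x. l x \<tau>)" by simp
    then have "(\<lambda>x. l x \<tau>) \<in> borel_measurable torus"
      unfolding torus_def by (intro continuous_imp_measurable_on_sets_lebesgue) auto
    then show ?thesis by measurable
  qed
  have fin: "Linf_norm (?m \<tau>) \<le> ennreal (max B 0)" if \<tau>: "\<tau> \<in> {0..T}" for \<tau>
    unfolding Linf_norm_def
  proof (rule esssup_I[OF meas[OF \<tau>]], rule AE_I2)
    fix x assume "x \<in> space torus"
    then have "\<bar>l x \<tau>\<bar> \<le> B" using B[of "(x, \<tau>)"] \<tau> by auto
    then show "ennreal \<bar>?m \<tau> x\<bar> \<le> ennreal (max B 0)" by (intro ennreal_leI) auto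
  qed
  define g where "g \<tau> = enn2real (Linf_norm (?m \<tau>))" for \<tau>
  have Lg: "Linf_norm (?m \<tau>) = ennreal (g \<tau>)" if "\<tau> \<in> {0..T}" for \<tau>
    using fin[OF that] unfolding g_def by (metis ennreal_enn2real le_less_trans ennreal_less_top)
  have g0: "0 \<le> g \<tau>" for \<tau> by (simp add: g_def)
  have AE: "AE x in torus. ?m \<tau> x \<le> g \<tau>" if \<tau>: "\<tau> \<in> {0..T}" for \<tau>
  proof -
    have "AE x in torus. ennreal \<bar>?m \<tau> x\<bar> \<le> ennreal (g \<tau>)"
      using esssup_AE[of "\<lambda>x. ennreal \<bar>?m \<tau> x\<bar>" torus] Lg[OF \<tau>] unfolding Linf_norm_def by simp
    then show ?thesis by eventually_elim (use g0 in simp)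
  qed
  \<comment> \<open>If two time slices differ by at most e everywhere, so do their essential
    suprema.\<close>
  have lip: "g \<tau> \<le> g \<tau>' + e" if \<tau>: "\<tau> \<in> {0..T}" "\<tau>' \<in> {0..T}" and e: "0 \<le> e" "\<And>x. x \<in> cbox 0 1 \<Longrightarrow> \<bar>l x \<tau> - l x \<tau>'\<bar> \<le> e" for \<tau> \<tau>' e
  proof -
    have "Linf_norm (?m \<tau>) \<le> ennreal (g \<tau>' + e)"
      unfolding Linf_norm_def
    proof (rule esssup_I[OF meas[OF \<tau>(1)]])
      have "AE x in torus. x \<in> cbox 0 1" by (rule AE_I2) simp
      then show "AE x in torus. ennreal \<bar>?m \<tau> x\<bar> \<le> ennreal (g \<tau>' + e)"
        using AE[OF \<tau>(2)]
      proof eventually_elim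
        case (elim x)
        then have "?m \<tau> x \<le> g \<tau>' + e" using e(2)[of x] e(1) by linarith
        then show ?case by (intro ennreal_leI) simp
      qed
    qed
    from this[unfolded Lg[OF \<tau>(1)]] show ?thesis using g0[of \<tau>'] e(1) by (subst (asm) ennreal_le_iff) auto
  qed
  have "continuous_on {0..T} g"
    unfolding continuous_on_iff
  proof (intro ballI allI impI)
    fix \<tau> e :: real assume \<tau>: "\<tau> \<in> {0..T}" and e: "0 < e"
    have "uniformly_continuous_on ?K (\<lambda>z. l (fst z) (snd z))" by (rule compact_uniformly_continuous[OF l K])
    then obtain d where d: "0 < d" and dd: "\<And>z z'. z \<in> ?K \<Longrightarrow> z' \<in> ?K \<Longrightarrow> dist z' z < d \<Longrightarrow> dist (l (fst z') (snd z')) (l (fst z) (snd z)) < e / 2"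
      unfolding uniformly_continuous_on_def using e half_gt_zero by meson
    have "dist (g \<tau>') (g \<tau>) < e" if \<tau>': "\<tau>' \<in> {0..T}" "dist \<tau>' \<tau> < d" for \<tau>'
    proof -
      have c: "\<bar>l x \<tau>' - l x \<tau>\<bar> \<le> e / 2" if "x \<in> cbox 0 1" for x
        using dd[of "(x, \<tau>)" "(x, \<tau>')"] that \<tau> \<tau>' by (auto simp: dist_Pair_Pair dist_real_def)
      have "g \<tau>' \<le> g \<tau> + e / 2" using lip[OF \<tau>'(1) \<tau>, of "e / 2"] c e by simp
      moreover have "g \<tau> \<le> g \<tau>' + e / 2" using lip[OF \<tau> \<tau>'(1), of "e / 2"] c e by (simp add: abs_minus_commute)
      ultimately show ?thesis using e by (simp add: dist_real_def abs_le_iff abs_less_iff)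
    qed
    then show "\<exists>d>0. \<forall>\<tau>'\<in>{0..T}. dist \<tau>' \<tau> < d \<longrightarrow> dist (g \<tau>') (g \<tau>) < e" using d by blast
  qed
  then show ?thesis using that Lg g0 AE by blast
qed

text \<open>Translates the [0,\<infinity>]-valued integral of the statement into the gauge integral
  used in \<open>gronwall\<close>.\<close>

lemma nn_integral_eq_ennreal_integral:
  fixes g :: "real \<Rightarrow> real"
  assumes g: "continuous_on {a..b} g" "\<And>\<tau>. 0 \<le> g \<tau>" and f: "\<And>\<tau>. \<tau> \<in> {a..b} \<Longrightarrow> f \<tau> = ennreal (g \<tau>)"
  shows "(\<integral>\<^sup>+\<tau>\<in>{a..b}. f \<tau> \<partial>lborel) = ennreal (integral {a..b} g)"
proof -
  have si: "set_integrable lborel {a..b} g" by (rule borel_integrable_atLeastAtMost'[OF g(1)])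
  have "(\<integral>\<^sup>+\<tau>\<in>{a..b}. f \<tau> \<partial>lborel) = (\<integral>\<^sup>+\<tau>. ennreal (indicator {a..b} \<tau> *\<^sub>R g \<tau>) \<partial>lborel)"
    by (intro nn_integral_cong) (simp add: f split: split_indicator)
  also have "\<dots> = ennreal (LINT \<tau>|lborel. indicator {a..b} \<tau> *\<^sub>R g \<tau>)"
    using si g(2) unfolding set_integrable_def by (intro nn_integral_eq_integral) auto
  also have "(LINT \<tau>|lborel. indicator {a..b} \<tau> *\<^sub>R g \<tau>) = integral {a..b} g"
    using set_borel_integral_eq_integral(2)[OF si] by (simp add: set_lebesgue_integral_def)
  finally show ?thesis .
qed

section \<open>The enstrophy inequality and blowup\<close>

lemma has_real_derivative_norm_square:
  fixes f :: "real \<Rightarrow> 'a::real_inner"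
  assumes "(f has_vector_derivative f') (at t within S)"
  shows "((\<lambda>\<tau>. (norm (f \<tau>))\<^sup>2) has_real_derivative 2 * (f t \<bullet> f')) (at t within S)"
proof -
  have "((\<lambda>\<tau>. f \<tau> \<bullet> f \<tau>) has_derivative (\<lambda>h. f t \<bullet> (h *\<^sub>R f') + (h *\<^sub>R f') \<bullet> f t)) (at t within S)"
    using assms unfolding has_vector_derivative_def by (intro has_derivative_inner)
  then show ?thesis
    unfolding has_field_derivative_def power2_norm_eq_inner
    by (rule has_derivative_eq_rhs) (auto simp: inner_commute)
qed

lemma enstrophy_inequality:
  assumes s: "2 < s" and sol: "restricted_Euler_solution s T u"
    and lam: "\<And>x t. t \<in> time_interval T \<Longrightarrow> ordered_eigenvalues (strain (u t) x) (lam1 x t) (lam2 x t) (lam3 x t)"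
    and t: "t \<in> time_interval T"
  shows "(L2_norm (strain (u t)))\<^sup>2 \<le> (L2_norm (strain (u 0)))\<^sup>2 *
    exp (2 * enn2real (\<integral>\<^sup>+\<tau>\<in>{0..t}. Linf_norm (\<lambda>x. max (lam2 x \<tau>) 0) \<partial>lborel))"
proof -
  have t0: "0 \<le> t" using t by (simp add: time_interval_def)
  have sub: "{0..t} \<subseteq> time_interval T"
    using t by (auto simp: time_interval_def intro: le_less_trans[of "ereal _" "ereal t"])
  define U where "U \<tau> = field_seq s (u \<tau>)" for \<tau>
  have H: "u \<tau> \<in> HdotM s" if "\<tau> \<in> {0..t}" for \<tau>
    using restricted_Euler_solution_solves(2)[OF s sol] that sub by blast
  have rep: "represents s (u \<tau>) (U \<tau>)" "L2_field (u \<tau>)" if "\<tau> \<in> {0..t}" for \<tau>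
    using H[OF that] field_seq_represents by (auto simp: U_def HdotM_def Hdot_def)
  have "solves (minus_euler s) U {0..t}"
    using solves_subset[OF restricted_Euler_solution_solves(1)[OF s sol] sub] by (simp add: U_def[abs_def])
  then have dU: "(U has_vector_derivative - euler_bilinear s (U \<tau>) (U \<tau>)) (at \<tau> within {0..t})" if "\<tau> \<in> {0..t}" for \<tau>
    using that by (simp add: solves_def)
  have cU: "continuous_on {0..t} U"
    unfolding continuous_on_eq_continuous_within using dU has_vector_derivative_continuous by blast
  let ?K = "cbox (0::real^3) 1 \<times> {0..t}"
  let ?F = "\<lambda>z. strain (u (snd z)) (fst z)"
  have F: "?F z = (\<chi> j i. (grad s (U (snd z)) j i (fst z) + grad s (U (snd z)) i j (fst z)) / 2)" if "z \<in> ?K" for z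
    by (rule strain_represents[OF s rep]) (use that in auto)
  have cF: "continuous_on ?K ?F"
  proof -
    have "continuous_on ?K (\<lambda>z. \<chi> j i. (grad s (U (snd z)) j i (fst z) + grad s (U (snd z)) i j (fst z)) / 2)"
      by (intro continuous_intros continuous_grad_joint[OF s cU]) auto
    then show ?thesis using F by (simp cong: continuous_on_cong)
  qed
  have sym: "?F z $ i $ j = ?F z $ j $ i" and tr: "(\<Sum>i\<in>UNIV. ?F z $ i $ i) = 0" if "z \<in> ?K" for z i j
    using grad_trace[OF s, of "U (snd z)" "fst z"] by (simp_all add: F[OF that] add.commute)
  have lamK: "ordered_eigenvalues (?F z) (lam1 (fst z) (snd z)) (lam2 (fst z) (snd z)) (lam3 (fst z) (snd z))" if "z \<in> ?K" for z
    using lam[of "snd z" "fst z"] that sub by auto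
  have cl: "continuous_on ?K (\<lambda>z. lam2 (fst z) (snd z))"
    by (rule continuous_middle_eigenvalue[OF _ cF lamK sym tr]) (intro compact_Times compact_cbox compact_Icc)
  obtain g where g: "continuous_on {0..t} g"
    and Lg: "\<And>\<tau>. \<tau> \<in> {0..t} \<Longrightarrow> Linf_norm (\<lambda>x. max (lam2 x \<tau>) 0) = ennreal (g \<tau>)" and g0: "\<And>\<tau>. 0 \<le> g \<tau>"
    and AE: "\<And>\<tau>. \<tau> \<in> {0..t} \<Longrightarrow> AE x in torus. max (lam2 x \<tau>) 0 \<le> g \<tau>"
    using Linf_norm_continuous[OF cl] by blast
  define y where "y \<tau> = (norm (gradient_seq s (U \<tau>)))\<^sup>2 / 2" for \<tau>
  define y' where "y' \<tau> = gradient_seq s (U \<tau>) \<bullet> gradient_seq s (- euler_bilinear s (U \<tau>) (U \<tau>))" for \<tau>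
  have L2: "(L2_norm (strain (u \<tau>)))\<^sup>2 = y \<tau>" if "\<tau> \<in> {0..t}" for \<tau>
    unfolding y_def by (rule strain_norm_eq[OF s rep[OF that]])
  have bl: "bounded_linear (gradient_seq s)" using s by (intro bounded_linear_gradient_seq) simp
  have dy: "(y has_real_derivative y' \<tau>) (at \<tau> within {0..t})" if "\<tau> \<in> {0..t}" for \<tau>
    using DERIV_cdivide[OF has_real_derivative_norm_square[OF bounded_linear.has_vector_derivative[OF bl dU[OF that]]], of 2]
    by (simp add: y_def[abs_def] y'_def)
  have le: "y' \<tau> \<le> (2 * g \<tau>) * y \<tau>" if \<tau>: "\<tau> \<in> {0..t}" for \<tau>
  proof -
    let ?S = "strain (u \<tau>)"
    have S: "?S = (\<lambda>x. \<chi> j i. (grad s (U \<tau>) j i x + grad s (U \<tau>) i j x) / 2)"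
      using strain_represents[OF s rep[OF \<tau>]] by blast
    have cS: "continuous_on UNIV ?S" unfolding S by (intro continuous_intros continuous_grad[OF s]) auto
    have cd: "continuous_on UNIV (\<lambda>x. det (?S x))"
      unfolding det_3 by (intro continuous_intros cS)
    have "y' \<tau> = - (gradient_seq s (U \<tau>) \<bullet> gradient_seq s (euler_bilinear s (U \<tau>) (U \<tau>)))"
      by (simp add: y'_def linear_neg[OF bounded_linear.linear[OF bl]])
    also have "\<dots> = (LINT x|torus. - (4 * det (?S x)))"
      unfolding enstrophy_production[OF s rep[OF \<tau>]] by simp
    also have "\<dots> \<le> (LINT x|torus. 2 * g \<tau> * (norm (?S x))\<^sup>2)"
    proof (rule integral_mono_AE)
      show "integrable torus (\<lambda>x. - (4 * det (?S x)))" "integrable torus (\<lambda>x. 2 * g \<tau> * (norm (?S x))\<^sup>2)"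
        by (intro continuous_integrable_torus continuous_intros cd cS)+
      have "AE x in torus. x \<in> cbox 0 1" by (rule AE_I2) simp
      then show "AE x in torus. - (4 * det (?S x)) \<le> 2 * g \<tau> * (norm (?S x))\<^sup>2"
        using AE[OF \<tau>]
      proof eventually_elim
        case (elim x)
        then have z: "(x, \<tau>) \<in> ?K" using \<tau> by simp
        have o: "ordered_eigenvalues (?S x) (lam1 x \<tau>) (lam2 x \<tau>) (lam3 x \<tau>)" using lamK[OF z] by simp
        have e: "lam1 x \<tau> + lam2 x \<tau> + lam3 x \<tau> = 0" "det (?S x) = lam1 x \<tau> * lam2 x \<tau> * lam3 x \<tau>"
          "(norm (?S x))\<^sup>2 = (lam1 x \<tau>)\<^sup>2 + (lam2 x \<tau>)\<^sup>2 + (lam3 x \<tau>)\<^sup>2"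
          using ordered_eigenvalues_traceless[OF o] sym[OF z] tr[OF z] by auto
        have "- (4 * det (?S x)) \<le> 2 * max (lam2 x \<tau>) 0 * (norm (?S x))\<^sup>2"
          unfolding e(2,3) using o e(1) by (intro det_le_middle_eigenvalue) (auto simp: ordered_eigenvalues_def)
        also have "\<dots> \<le> 2 * g \<tau> * (norm (?S x))\<^sup>2" using elim by (intro mult_right_mono) auto
        finally show ?case .
      qed
    qed
    also have "\<dots> = 2 * g \<tau> * (LINT x|torus. (norm (?S x))\<^sup>2)" by simp
    also have "(LINT x|torus. (norm (?S x))\<^sup>2) = y \<tau>"
      unfolding L2[OF \<tau>, symmetric] L2_norm_def by (intro real_sqrt_pow2[symmetric] integral_nonneg_AE) auto
    finally show ?thesis .
  qed
  have "y t \<le> y 0 * exp (integral {0..t} (\<lambda>\<tau>. 2 * g \<tau>))"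
    by (rule gronwall[OF t0 dy le]) (auto intro!: continuous_intros g)
  also have "integral {0..t} (\<lambda>\<tau>. 2 * g \<tau>) = 2 * integral {0..t} g" by simp
  \<comment> \<open>The integral over {0..t} is finite because g is continuous, so
    \<open>enn2real\<close> loses nothing here.\<close>
  also have "integral {0..t} g = enn2real (\<integral>\<^sup>+\<tau>\<in>{0..t}. Linf_norm (\<lambda>x. max (lam2 x \<tau>) 0) \<partial>lborel)"
  proof -
    have "(\<integral>\<^sup>+\<tau>\<in>{0..t}. Linf_norm (\<lambda>x. max (lam2 x \<tau>) 0) \<partial>lborel) = ennreal (integral {0..t} g)"
      by (rule nn_integral_eq_ennreal_integral[OF g g0]) (rule Lg)
    moreover have "0 \<le> integral {0..t} g" using g g0 by (intro integral_nonneg integrable_continuous_real)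
    ultimately show ?thesis by simp
  qed
  finally show ?thesis using L2[of t] L2[of 0] t0 by simp
qed

text \<open>A single mode of the gradient is bounded by its full norm, so bounded enstrophy bounds
  |q| times every coefficient. The nonlinearity then grows at most linearly in the Sobolev norm, and
  Gronwall keeps that norm bounded up to T.\<close>

lemma blowup_criterion:
  assumes s: "2 < s" and max: "maximal_restricted_Euler_solution s (ereal T) u"
    and E: "\<And>t. t \<in> {0..<T} \<Longrightarrow> (L2_norm (strain (u t)))\<^sup>2 \<le> E"
  shows False
proof -
  have ti: "time_interval (ereal T) = {0..<T}" by (auto simp: time_interval_def)
  have T: "0 < T" and sol: "restricted_Euler_solution s (ereal T) u"
    using max by (auto simp: maximal_restricted_Euler_solution_def)
  define U where "U t = field_seq s (u t)" for t
  note S = restricted_Euler_solution_solves[OF s sol, unfolded ti]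
  have rep: "represents s (u t) (U t)" "L2_field (u t)" if "t \<in> {0..<T}" for t
    using S(2)[OF that] field_seq_represents by (auto simp: U_def HdotM_def Hdot_def)
  \<comment> \<open>The squared gradient norm is twice the squared strain norm, by
    \<open>strain_norm_eq\<close>.\<close>
  define R where "R = sqrt (2 * E)"
  have E0: "0 \<le> E" by (rule order_trans[OF zero_le_power2 E[of 0]]) (use T in simp)
  have R0: "0 \<le> R" using E0 by (simp add: R_def)
  have R: "norm (rvec q) * norm (coef (U t) q) / weight s q \<le> R" if t: "t \<in> {0..<T}" and q: "q \<in> Mfreq" for t q
  proof -
    have "(norm (gradient_seq s (U t)))\<^sup>2 \<le> 2 * E"
      using E[OF t] unfolding strain_norm_eq[OF s rep[OF t]] by simp
    then have n: "norm (gradient_seq s (U t)) \<le> R" unfolding R_def by (rule real_le_rsqrt)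
    have "1 * norm (rvec q) \<le> (2 * pi) * norm (rvec q)" using pi_ge_two by (intro mult_right_mono) auto
    then have "norm (rvec q) * (norm (coef (U t) q) / weight s q) \<le> (2 * pi * norm (rvec q)) * (norm (coef (U t) q) / weight s q)"
      using weight_pos[OF q, of s] by (intro mult_right_mono) auto
    also have "\<dots> = norm (coef (gradient_seq s (U t)) q)"
      using s weight_pos[OF q, of s] by (simp add: coef_gradient_seq scaled_def norm_mult norm_divide)
    also have "\<dots> \<le> R" using norm_coef_le n by (rule order_trans)
    finally show ?thesis by simp
  qed
  define C where "C = 2 * pi * 6 powr s * 324 * R"
  have C0: "0 \<le> C" using R0 by (simp add: C_def)
  have growth: "norm (euler_bilinear s (U t) (U t)) \<le> C * norm (U t)" if t: "t \<in> {0..<T}" for t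
    unfolding C_def using s by (intro euler_bilinear_props(2) R[OF t] R0) auto
  have bound: "(norm (U t))\<^sup>2 \<le> (norm (U 0))\<^sup>2 * exp (2 * C * T)" if t: "t \<in> {0..<T}" for t
  proof -
    have "solves (minus_euler s) U {0..t}"
      unfolding U_def[abs_def] by (rule solves_subset[OF S(1)]) (use t in auto)
    then have dU: "(U has_vector_derivative - euler_bilinear s (U \<tau>) (U \<tau>)) (at \<tau> within {0..t})" if "\<tau> \<in> {0..t}" for \<tau>
      using that by (simp add: solves_def)
    have "(norm (U t))\<^sup>2 \<le> (norm (U 0))\<^sup>2 * exp (integral {0..t} (\<lambda>\<tau>. 2 * C))"
    proof (rule gronwall[OF _ has_real_derivative_norm_square[OF dU]])
      fix \<tau> assume \<tau>: "\<tau> \<in> {0..t}"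
      have "U \<tau> \<bullet> - euler_bilinear s (U \<tau>) (U \<tau>) \<le> norm (U \<tau>) * norm (- euler_bilinear s (U \<tau>) (U \<tau>))"
        by (rule norm_cauchy_schwarz)
      also have "\<dots> \<le> norm (U \<tau>) * (C * norm (U \<tau>))"
      proof (rule mult_left_mono)
        show "norm (- euler_bilinear s (U \<tau>) (U \<tau>)) \<le> C * norm (U \<tau>)"
          unfolding norm_minus_cancel by (rule growth) (use \<tau> t in simp)
      qed simp
      also have "\<dots> = C * (norm (U \<tau>))\<^sup>2" by (simp only: power2_eq_square mult_ac)
      finally show "2 * (U \<tau> \<bullet> - euler_bilinear s (U \<tau>) (U \<tau>)) \<le> 2 * C * (norm (U \<tau>))\<^sup>2" by linarith
    qed (use t in \<open>simp_all add: continuous_on_const\<close>)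
    also have "\<dots> \<le> (norm (U 0))\<^sup>2 * exp (2 * C * T)"
      using t mult_left_mono[of t T C] C0 by (intro mult_left_mono) (auto simp: mult.commute)
    finally show ?thesis .
  qed
  show False
  proof (rule maximal_solution_norm_unbounded[OF s max])
    fix t assume "t \<in> {0..<T}"
    then show "norm (field_seq s (u t)) \<le> sqrt ((norm (U 0))\<^sup>2 * exp (2 * C * T))"
      using bound[of t] by (intro real_le_rsqrt) (simp add: U_def)
  qed
qed

theorem theorem2p2:
  fixes s :: real and Tmax :: ereal
    and u :: "real \<Rightarrow> real ^ 3 \<Rightarrow> real ^ 3"
    and lam1 lam2 lam3 :: "real ^ 3 \<Rightarrow> real \<Rightarrow> real"
  assumes "s > 5 / 2"
    and "maximal_restricted_Euler_solution s Tmax u"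
    and "\<And>x t. t \<in> time_interval Tmax \<Longrightarrow>
           ordered_eigenvalues (strain (u t) x) (lam1 x t) (lam2 x t) (lam3 x t)"
  shows "(\<forall>t\<in>time_interval Tmax.
            (L2_norm (strain (u t)))\<^sup>2 \<le> (L2_norm (strain (u 0)))\<^sup>2 *
              exp (2 * enn2real (\<integral>\<^sup>+\<tau>\<in>{0..t}. Linf_norm (\<lambda>x. max (lam2 x \<tau>) 0) \<partial>lborel))) \<and>
         (Tmax < \<infinity> \<longrightarrow>
            (\<integral>\<^sup>+t\<in>time_interval Tmax. Linf_norm (\<lambda>x. max (lam2 x t) 0) \<partial>lborel) = \<infinity>)"
proof (intro conjI impI)
  have s: "2 < s" using assms(1) by simp
  have sol: "restricted_Euler_solution s Tmax u" and pos: "0 < Tmax"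
    using assms(2) by (auto simp: maximal_restricted_Euler_solution_def)
  show ineq: "\<forall>t\<in>time_interval Tmax. (L2_norm (strain (u t)))\<^sup>2 \<le> (L2_norm (strain (u 0)))\<^sup>2 *
      exp (2 * enn2real (\<integral>\<^sup>+\<tau>\<in>{0..t}. Linf_norm (\<lambda>x. max (lam2 x \<tau>) 0) \<partial>lborel))"
    by (intro ballI enstrophy_inequality[OF s sol assms(3)])
  assume "Tmax < \<infinity>"
  then obtain T where T: "Tmax = ereal T" using pos by (cases Tmax) auto
  let ?J = "\<integral>\<^sup>+t\<in>time_interval Tmax. Linf_norm (\<lambda>x. max (lam2 x t) 0) \<partial>lborel"
  show "?J = \<infinity>"
  proof (rule ccontr)
    assume J: "?J \<noteq> \<infinity>"
    \<comment> \<open>A finite integral would bound the enstrophy on the whole interval by one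
      constant, through the inequality just proved.\<close>
    show False
    proof (rule blowup_criterion[OF s assms(2)[unfolded T]])
      fix t assume "t \<in> {0..<T}"
      then have t: "t \<in> time_interval Tmax" by (simp add: time_interval_def T)
      have sub: "{0..t} \<subseteq> time_interval Tmax" using \<open>t \<in> {0..<T}\<close> by (auto simp: time_interval_def T)
      have "(\<integral>\<^sup>+\<tau>\<in>{0..t}. Linf_norm (\<lambda>x. max (lam2 x \<tau>) 0) \<partial>lborel) \<le> ?J"
        by (intro nn_integral_mono mult_left_mono) (use sub in \<open>auto simp: indicator_def\<close>)
      \<comment> \<open>\<open>enn2real\<close> is monotone only below a finite bound; the assumed
        finiteness of the full integral enters here.\<close>
      then have "enn2real (\<integral>\<^sup>+\<tau>\<in>{0..t}. Linf_norm (\<lambda>x. max (lam2 x \<tau>) 0) \<partial>lborel) \<le> enn2real ?J"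
        using J by (intro enn2real_mono) (auto simp: top.not_eq_extremum)
      then have "(L2_norm (strain (u 0)))\<^sup>2 * exp (2 * enn2real (\<integral>\<^sup>+\<tau>\<in>{0..t}. Linf_norm (\<lambda>x. max (lam2 x \<tau>) 0) \<partial>lborel))
        \<le> (L2_norm (strain (u 0)))\<^sup>2 * exp (2 * enn2real ?J)"
        by (intro mult_left_mono) auto
      with bspec[OF ineq t] show "(L2_norm (strain (u t)))\<^sup>2 \<le> (L2_norm (strain (u 0)))\<^sup>2 * exp (2 * enn2real ?J)"
        by (rule order_trans)
    qed
  qed
qed

end
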